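(* Let $G=(V,E)$ be a tree with $1<|V|<\infty$, edge weights $q=(q_e)_{e\in E}$ and set of leaves $L_G$. (1) Assume that $q\in(-\infty,1)^E$. If $K$ is a random vector taking values in $\mathcal D$ such that for every leaf $\ell\in L_G$ the components of $\Psi^{(\ell)}(K)$ are independent and non-Dirac, then there exist $\beta\in(0,\infty)$ and $a\in(0,\infty)^V$ such that $K\sim \mathrm{TB}^G_{\mathrm I}(a,\beta,q)$. (2) Assume that $q\in[0,\infty)^E$ and $q_e\neq 1$ for every $e\in E$. If $K$ is a random vector taking values in $(0,\infty)^V$ such that for every leaf $\ell\in L_G$ the components of $\psi^{(\ell)}(K)$ are independent and non-Dirac, then there exist $\beta\in(0,\infty)$ and $a\in(0,\beta)^V$, with $a_v+a_w<\beta$ whenever $\{v,w\}\in E$ and $q_{w,v}=0$, such that $K\sim \mathrm{TB}^G_{\mathrm{II}}(a,\beta,q)$.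
   Context: A random variable is non-Dirac if it is not almost surely constant. A leaf is a vertex of degree $1$. Polynomials. For $e=\{v,w\}\in E$ write $q_{v,w}=q_{w,v}=q_e$. For $U\subseteq V$ let $E_U$ be the set of edges of $G$ with both ends in $U$, $k^U=\prod_{v\in U}k_v$, $q^{E_U}=\prod_{e\in E_U}q_e$ (empty products equal $1$). For $U\subseteq V$ and $k\in\mathbb R^V$, $$\Delta_U(k)=\sum_{W\subseteq U}(-1)^{|W|}q^{E_W}k^W,\qquad \delta_U(k)=\sum_{W\subseteq U}q^{E_W}k^W,$$ and $\Delta_G=\Delta_V$, $\delta_G=\delta_V$. Put $\mathcal D=\{k\in(0,1)^V:\ \Delta_U(k)>0\ \ \forall\, U\subseteq V\}$. Tree-beta laws. For $a\in(0,\infty)^V$, $\beta>0$, $q\in(-\infty,1)^E$, $\mathrm{TB}^G_{\mathrm I}(a,\beta,q)$ is the probability law on $\mathbb R^V$ with Lebesgue density proportional to $\Delta_G(k)^{\beta-1}\prod_{v\in V}k_v^{a_v-1}\mathbf 1_{\mathcal D}(k)$. For $\beta>0$, $a\in(0,\beta)^V$, $q\in[0,\infty)^E$ with $a_v+a_w<\beta$ whenever $\{v,w\}\in E$ and $q_{v,w}=0$, $\mathrm{TB}^G_{\mathrm{II}}(a,\beta,q)$ is the probability law with density proportional to $\delta_G(k)^{-\beta}\prod_{v\in V}k_v^{a_v-1}\mathbf 1_{(0,\infty)^V}(k)$. Rooted trees and maps. For $r\in V$, $G^{(r)}$ is the directed tree obtained from $G$ by orienting each edge away from $r$: $v\to w$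 if $\{v,w\}\in E$ and $v$ lies on the path from $r$ to $w$. $\mathfrak{de}^{(r)}(v)$ is the set of $w\ne v$ such that there is a directed path in $G^{(r)}$ from $v$ to $w$, and $\overline{\mathfrak{de}}^{(r)}(v)=\mathfrak{de}^{(r)}(v)\cup\{v\}$. For $q\in(-\infty,1)^E$, $\Psi^{(r)}:\mathcal D\to(0,1)^V$ is $$\Psi^{(r)}_v(k)=1-\frac{\Delta_{\overline{\mathfrak{de}}^{(r)}(v)}(k)}{\Delta_{\mathfrak{de}^{(r)}(v)}(k)},\quad v\in V,$$ and for $q\in[0,\infty)^E$, $\psi^{(r)}:(0,\infty)^V\to(0,\infty)^V$ is $$\psi^{(r)}_v(k)=\frac{\delta_{\overline{\mathfrak{de}}^{(r)}(v)}(k)}{\delta_{\mathfrak{de}^{(r)}(v)}(k)}-1,\quad v\in V.$$ *)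

theory Defs
  imports "HOL-Probability.Probability"
begin

section \<open>Finite simple graphs and trees\<close>

text \<open>
  A graph is given by a vertex set \<open>V\<close> and a set \<open>E\<close> of two-element subsets of \<open>V\<close>.
  The trees of the AFP entry Graph Theory are not used: there a forest only has to
  avoid \<^emph>\<open>directed\<close> cycles, so an acyclically oriented triangle would count as a tree.
\<close>

definition simple_graph :: "'v set \<Rightarrow> 'v set set \<Rightarrow> bool" where
  "simple_graph V E \<longleftrightarrow> (\<forall>e\<in>E. \<exists>v\<in>V. \<exists>w\<in>V. v \<noteq> w \<and> e = {v, w})"

definition graph_path :: "'v set \<Rightarrow> 'v set set \<Rightarrow> 'v \<Rightarrow> 'v \<Rightarrow> 'v list \<Rightarrow> bool" where
  "graph_path V E u w p \<longleftrightarrow>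
     p \<noteq> [] \<and> hd p = u \<and> last p = w \<and> set p \<subseteq> V \<and> distinct p \<and>
     successively (\<lambda>x y. {x, y} \<in> E) p"

definition graph_connected :: "'v set \<Rightarrow> 'v set set \<Rightarrow> bool" where
  "graph_connected V E \<longleftrightarrow> V \<noteq> {} \<and> (\<forall>u\<in>V. \<forall>w\<in>V. \<exists>p. graph_path V E u w p)"

definition graph_cycle :: "'v set \<Rightarrow> 'v set set \<Rightarrow> 'v list \<Rightarrow> bool" where
  "graph_cycle V E p \<longleftrightarrow>
     3 \<le> length p \<and> graph_path V E (hd p) (last p) p \<and> {last p, hd p} \<in> E"

definition graph_tree :: "'v set \<Rightarrow> 'v set set \<Rightarrow> bool" where
  "graph_tree V E \<longleftrightarrow>
     simple_graph V E \<and> graph_connected V E \<and> (\<nexists>p. graph_cycle V E p)"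

definition graph_degree :: "'v set set \<Rightarrow> 'v \<Rightarrow> nat" where
  "graph_degree E v = card {e \<in> E. v \<in> e}"

definition graph_leaves :: "'v set \<Rightarrow> 'v set set \<Rightarrow> 'v set" where
  "graph_leaves V E = {v \<in> V. graph_degree E v = 1}"


section \<open>Rooted trees\<close>

text \<open>In a tree the path from \<open>r\<close> to \<open>w\<close> exists and is unique, so \<open>\<exists>p\<close> means ``the path''.\<close>

definition rooted_edge :: "'v set \<Rightarrow> 'v set set \<Rightarrow> 'v \<Rightarrow> 'v \<Rightarrow> 'v \<Rightarrow> bool" where
  "rooted_edge V E r v w \<longleftrightarrow> {v, w} \<in> E \<and> (\<exists>p. graph_path V E r w p \<and> v \<in> set p)"

definition descendants :: "'v set \<Rightarrow> 'v set set \<Rightarrow> 'v \<Rightarrow> 'v \<Rightarrow> 'v set" where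
  "descendants V E r v = {w. w \<noteq> v \<and> (rooted_edge V E r)\<^sup>*\<^sup>* v w}"

definition closed_descendants :: "'v set \<Rightarrow> 'v set set \<Rightarrow> 'v \<Rightarrow> 'v \<Rightarrow> 'v set" where
  "closed_descendants V E r v = insert v (descendants V E r v)"


section \<open>The graph polynomials\<close>

definition induced_edges :: "'v set set \<Rightarrow> 'v set \<Rightarrow> 'v set set" where
  "induced_edges E U = {e \<in> E. e \<subseteq> U}"

definition graph_Delta ::
  "'v set set \<Rightarrow> ('v set \<Rightarrow> real) \<Rightarrow> 'v set \<Rightarrow> ('v \<Rightarrow> real) \<Rightarrow> real" where
  "graph_Delta E q U k =
     (\<Sum>W\<in>Pow U. (-1) ^ card W * (\<Prod>e\<in>induced_edges E W. q e) * (\<Prod>v\<in>W. k v))"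

definition graph_delta ::
  "'v set set \<Rightarrow> ('v set \<Rightarrow> real) \<Rightarrow> 'v set \<Rightarrow> ('v \<Rightarrow> real) \<Rightarrow> real" where
  "graph_delta E q U k =
     (\<Sum>W\<in>Pow U. (\<Prod>e\<in>induced_edges E W. q e) * (\<Prod>v\<in>W. k v))"

text \<open>
  A vector in \<open>\<real>\<^sup>V\<close> is an extensional function on \<open>V\<close>, that is, a point of the space of
  \<open>\<Pi>\<^sub>M v\<in>V. lborel\<close>.
\<close>

definition Delta_domain ::
  "'v set \<Rightarrow> 'v set set \<Rightarrow> ('v set \<Rightarrow> real) \<Rightarrow> ('v \<Rightarrow> real) set" where
  "Delta_domain V E q =
     {k \<in> (\<Pi>\<^sub>E v\<in>V. {0<..<1}). \<forall>U\<subseteq>V. graph_Delta E q U k > 0}"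

definition graph_Psi ::
  "'v set \<Rightarrow> 'v set set \<Rightarrow> ('v set \<Rightarrow> real) \<Rightarrow> 'v \<Rightarrow> ('v \<Rightarrow> real) \<Rightarrow> 'v \<Rightarrow> real" where
  "graph_Psi V E q r k v =
     1 - graph_Delta E q (closed_descendants V E r v) k
         / graph_Delta E q (descendants V E r v) k"

definition graph_psi ::
  "'v set \<Rightarrow> 'v set set \<Rightarrow> ('v set \<Rightarrow> real) \<Rightarrow> 'v \<Rightarrow> ('v \<Rightarrow> real) \<Rightarrow> 'v \<Rightarrow> real" where
  "graph_psi V E q r k v =
     graph_delta E q (closed_descendants V E r v) k
       / graph_delta E q (descendants V E r v) k - 1"


section \<open>Tree-beta laws\<close>

text \<open>
  The measure whose density with respect to \<open>N\<close> is proportional to \<open>f\<close>. If the integral of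
  \<open>f\<close> is \<open>0\<close> or \<open>\<infinity>\<close>, this is the zero measure, so it equals the law of a random
  vector only if the normalisation makes sense.
\<close>

definition normalized_density :: "'a measure \<Rightarrow> ('a \<Rightarrow> real) \<Rightarrow> 'a measure" where
  "normalized_density N f = density N (\<lambda>x. ennreal (f x) / (\<integral>\<^sup>+y. ennreal (f y) \<partial>N))"

definition TB_I ::
  "'v set \<Rightarrow> 'v set set \<Rightarrow> ('v \<Rightarrow> real) \<Rightarrow> real \<Rightarrow> ('v set \<Rightarrow> real) \<Rightarrow> ('v \<Rightarrow> real) measure" where
  "TB_I V E a \<beta> q = normalized_density (\<Pi>\<^sub>M v\<in>V. lborel)
     (\<lambda>k. graph_Delta E q V k powr (\<beta> - 1) * (\<Prod>v\<in>V. k v powr (a v - 1))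
            * indicator (Delta_domain V E q) k)"

definition TB_II ::
  "'v set \<Rightarrow> 'v set set \<Rightarrow> ('v \<Rightarrow> real) \<Rightarrow> real \<Rightarrow> ('v set \<Rightarrow> real) \<Rightarrow> ('v \<Rightarrow> real) measure" where
  "TB_II V E a \<beta> q = normalized_density (\<Pi>\<^sub>M v\<in>V. lborel)
     (\<lambda>k. graph_delta E q V k powr (- \<beta>) * (\<Prod>v\<in>V. k v powr (a v - 1))
            * indicator (\<Pi>\<^sub>E v\<in>V. {0<..}) k)"


section \<open>Random variables\<close>

definition non_Dirac :: "'a measure \<Rightarrow> ('a \<Rightarrow> real) \<Rightarrow> bool" where
  "non_Dirac M X \<longleftrightarrow> \<not> (\<exists>c. AE \<omega> in M. X \<omega> = c)"

end

theory Submission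
  imports Defs
begin

text \<open>
  Both parts are treated together: with \<open>\<epsilon> = -1\<close> in part (1) and \<open>\<epsilon> = 1\<close> in part (2), everything is
  expressed by \<open>\<delta>\<close> at \<open>\<epsilon> k\<close>. With \<open>\<phi>(x) = (1 + \<epsilon> x) / (1 + \<epsilon> q x)\<close> the components \<open>X\<^sub>v\<close> of \<open>\<epsilon>\<close>-signed
  \<open>\<Psi>\<close> or \<open>\<psi>\<close> satisfy \<open>k\<^sub>v = X\<^sub>v * \<Prod>\<^sub>c \<phi>(X\<^sub>c)\<close>, the product being over the children of \<open>v\<close>, and \<open>X\<^sub>v\<close> depends on
  the root only through the parent of \<open>v\<close>. Every directed edge points towards some leaf, so computing the
  mixed moments of \<open>k\<^sub>v\<close> and \<open>k\<^sub>w\<close> from both sides of an edge \<open>{v, w}\<close> gives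
  \<open>E(X\<^sup>t \<phi>(X)\<^sup>s) S(s) = E(U\<^sup>s \<phi>(U)\<^sup>t) R(t)\<close>. The relation \<open>1 + \<epsilon> x - \<phi> - \<epsilon> q x \<phi> = 0\<close> makes both
  transforms solutions of one linear lattice equation; compatibility forces \<open>R(t + 1) / R(t)\<close> to be
  the ratio of consecutive moments of a beta law, and what remains is a Stein equation for the law of
  \<open>X\<close>, which identifies its density without any regularity assumption. In part (2) moments need not
  exist, so the argument is run for the laws tilted by powers of \<open>\<delta>\<close>. The law of \<open>k\<close> follows from that of
  the \<open>X\<^sub>v\<close> by a triangular change of variables.
\<close>

section \<open>Branches and rooted subtrees\<close>

text \<open>The unknown factors \<open>R\<close> and \<open>S\<close> make the problem rigid.
  Reversal adds to the relation for \<phi> a second equation between the same four moments F(t, s),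
  F(t+1, s), F(t, s+1), F(t+1, s+1). Eliminating the last one leaves a three-term relation whose
  unknown coefficients involve only one ratio R(t+1) / R(t) and one ratio S(s+1) / S(s). In the
  variables 1 / (1 + \<epsilon> ratio) the relations at four neighbouring lattice points are
  consistent only if the increments in t and in s agree; a factor q - 1 is cancelled here, hence the
  condition on \<open>q\<close> in part (2). The common slope spreads over the tree and becomes
  \<beta>, while the initial value belongs to the vertex. Slope zero is the degenerate case: it
  makes the expectation of a square vanish, and this is where non-Dirac enters. In part (2) the tilt
  m only opens degrees up to m, so the parameters found at different m have to be matched; x / (1 +
  x) turns the accessible moments into powers of a variable in the unit interval, and integrability
  at infinity finally gives the upper bounds on \<open>a\<close>.\<close>

definition neighbours :: "'v set set \<Rightarrow> 'v \<Rightarrow> 'v set" where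
  "neighbours E v = {w. {v, w} \<in> E}"

definition avoiding_step :: "'v set set \<Rightarrow> 'v \<Rightarrow> 'v \<Rightarrow> 'v \<Rightarrow> bool" where
  "avoiding_step E w x y \<longleftrightarrow> {x, y} \<in> E \<and> x \<noteq> w \<and> y \<noteq> w"

text \<open>For adjacent \<open>v\<close> and \<open>w\<close> this is the component of
  \<open>v\<close> after deletion of \<open>w\<close>. Reachability by steps that never touch
  \<open>w\<close> is symmetric and transitive at once, which simple paths would not give so
  cheaply.\<close>

definition branch :: "'v set set \<Rightarrow> 'v \<Rightarrow> 'v \<Rightarrow> 'v set" where
  "branch E v w = {u. (avoiding_step E w)\<^sup>*\<^sup>* v u}"

lemma neighbours_sym: "w \<in> neighbours E v \<Longrightarrow> v \<in> neighbours E w"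
  by (simp add: neighbours_def insert_commute)

lemma branch_refl [simp]: "v \<in> branch E v w"
  by (simp add: branch_def)

lemma avoiding_step_sym: "(avoiding_step E w)\<^sup>*\<^sup>* x y \<Longrightarrow> (avoiding_step E w)\<^sup>*\<^sup>* y x"
proof -
  have "symp (avoiding_step E w)"
    by (auto simp: symp_def avoiding_step_def insert_commute)
  then show "(avoiding_step E w)\<^sup>*\<^sup>* x y \<Longrightarrow> (avoiding_step E w)\<^sup>*\<^sup>* y x"
    by (meson symp_rtranclp sympD)
qed

lemma branch_sym: "x \<in> branch E y w \<longleftrightarrow> y \<in> branch E x w"
  using avoiding_step_sym by (auto simp: branch_def)

lemma branch_trans: "x \<in> branch E y w \<Longrightarrow> y \<in> branch E z w \<Longrightarrow> x \<in> branch E z w"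
  by (auto simp: branch_def)

lemma branch_step:
  "x \<in> branch E v w \<Longrightarrow> {x, y} \<in> E \<Longrightarrow> x \<noteq> w \<Longrightarrow> y \<noteq> w \<Longrightarrow> y \<in> branch E v w"
  by (auto simp: branch_def avoiding_step_def intro: rtranclp.rtrancl_into_rtrancl)

lemma not_in_branch:
  assumes "v \<noteq> w" shows "w \<notin> branch E v w"
proof
  assume "w \<in> branch E v w"
  then have "(avoiding_step E w)\<^sup>*\<^sup>* v w" by (simp add: branch_def)
  then show False
    using assms by cases (auto simp: avoiding_step_def)
qed

lemma path_imp_branch:
  assumes "graph_path V E u x p" "w \<notin> set p" "y \<in> set p"
  shows "y \<in> branch E u w"
  using assms
proof (induction p arbitrary: u)
  case Nil
  then show ?case by simp
next
  case (Cons a p)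
  have [simp]: "a = u" using Cons.prems by (simp add: graph_path_def)
  show ?case
  proof (cases "y = u")
    case False
    then have "y \<in> set p" using Cons.prems by simp
    then obtain b p' where p: "p = b # p'" by (cases p) auto
    have "graph_path V E b x p"
      using Cons.prems p by (auto simp: graph_path_def)
    then have "y \<in> branch E b w"
      using Cons \<open>y \<in> set p\<close> by auto
    moreover have "{u, b} \<in> E" "u \<noteq> w" "b \<noteq> w"
      using Cons.prems p by (auto simp: graph_path_def)
    then have "b \<in> branch E u w" using branch_step branch_refl by metis
    ultimately show ?thesis using branch_trans by metis
  qed simp
qed

lemma graph_path_prefix:
  assumes "graph_path V E u x (p @ c # p')"
  shows "graph_path V E u c (p @ [c])"
proof -
  have "successively (\<lambda>x y. {x, y} \<in> E) ((p @ [c]) @ p')" using assms by (simp add: graph_path_def)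
  then have "successively (\<lambda>x y. {x, y} \<in> E) (p @ [c])" by (simp only: successively_append_iff)
  then show ?thesis using assms by (cases p) (auto simp: graph_path_def)
qed

lemma graph_path_snoc:
  assumes "graph_path V E u x p" "{x, y} \<in> E" "y \<in> V" "y \<notin> set p"
  shows "graph_path V E u y (p @ [y])"
  using assms by (auto simp: graph_path_def successively_append_iff)

text \<open>A walk is cut back whenever it returns to a vertex already visited, since
  \<open>graph_path\<close> demands distinct vertices.\<close>

lemma branch_imp_path:
  assumes "simple_graph V E" "x \<in> branch E u w" "u \<in> V" "u \<noteq> w"
  shows "\<exists>p. graph_path V E u x p \<and> w \<notin> set p"
proof -
  have "(avoiding_step E w)\<^sup>*\<^sup>* u x" using assms by (simp add: branch_def)
  then show ?thesis
  proof (induction rule: rtranclp_induct)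
    case base
    show ?case using assms by (intro exI[of _ "[u]"]) (auto simp: graph_path_def)
  next
    case (step y z)
    then obtain p where p: "graph_path V E u y p" "w \<notin> set p" by blast
    have "{y, z} \<in> E" "z \<noteq> w" using step by (auto simp: avoiding_step_def)
    then have "z \<in> V" using assms(1) by (fastforce simp: simple_graph_def doubleton_eq_iff)
    show ?case
    proof (cases "z \<in> set p")
      case True
      then obtain p1 p2 where "p = p1 @ z # p2" by (meson split_list)
      then show ?thesis using p graph_path_prefix[of V E u y p1 z p2]
        by (intro exI[of _ "p1 @ [z]"]) auto
    next
      case False
      then show ?thesis
        using graph_path_snoc[OF p(1) \<open>{y, z} \<in> E\<close> \<open>z \<in> V\<close>] p \<open>z \<noteq> w\<close> by (intro exI[of _ "p @ [z]"]) auto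
    qed
  qed
qed

locale finite_tree =
  fixes V :: "'v set" and E :: "'v set set"
  assumes tree: "graph_tree V E" and finite_V: "finite V" and card_V: "1 < card V"
begin

lemma simple: "simple_graph V E"
  using tree by (simp add: graph_tree_def)

lemma edgeD: "{v, w} \<in> E \<Longrightarrow> v \<in> V \<and> w \<in> V \<and> v \<noteq> w"
  using simple by (fastforce simp: simple_graph_def doubleton_eq_iff)

lemma edge_endpoints: "e \<in> E \<Longrightarrow> \<exists>v w. e = {v, w} \<and> v \<in> V \<and> w \<in> V \<and> v \<noteq> w"
  using simple by (fastforce simp: simple_graph_def)

lemma neighbours_subset: "neighbours E v \<subseteq> V"
  using edgeD by (auto simp: neighbours_def)

lemma finite_neighbours: "finite (neighbours E v)"
  using finite_subset[OF neighbours_subset finite_V] .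

lemma branch_subset: "v \<in> V \<Longrightarrow> branch E v w \<subseteq> V"
proof
  fix u assume "v \<in> V" "u \<in> branch E v w"
  then have "(avoiding_step E w)\<^sup>*\<^sup>* v u" by (simp add: branch_def)
  then show "u \<in> V" using \<open>v \<in> V\<close>
    by (induction rule: rtranclp_induct) (use edgeD in \<open>auto simp: avoiding_step_def\<close>)
qed

lemma finite_branch: "v \<in> V \<Longrightarrow> finite (branch E v w)"
  using finite_subset[OF branch_subset finite_V] .

text \<open>If the branches met, \<open>c'\<close> would be reachable from \<open>c\<close> without
  touching \<open>v\<close>, and a simple path between them would close up through \<open>v\<close>
  to a cycle. This is the one place where acyclicity is used.\<close>

lemma branch_disjoint:
  assumes "c \<in> neighbours E v" "c' \<in> neighbours E v" "c \<noteq> c'"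
  shows "branch E c v \<inter> branch E c' v = {}"
proof (rule ccontr)
  assume "branch E c v \<inter> branch E c' v \<noteq> {}"
  then have "c' \<in> branch E c v" using branch_sym branch_trans by (metis disjoint_iff)
  have e: "{v, c} \<in> E" "{v, c'} \<in> E" using assms by (auto simp: neighbours_def)
  then obtain p where p: "graph_path V E c c' p" "v \<notin> set p"
    using branch_imp_path[OF simple \<open>c' \<in> branch E c v\<close>] edgeD by metis
  \<comment> \<open>As \<open>c\<close> and \<open>c'\<close> differ, \<open>p\<close> has at least
    two vertices, so \<open>v # p\<close> has the length 3 required of a cycle.\<close>
  obtain p' where p': "p = c # p'" "p' \<noteq> []"
    using p assms(3) by (cases p) (auto simp: graph_path_def split: if_splits)
  have "graph_cycle V E (v # p)"
    using p p' e edgeD[OF e(1)] by (cases p') (auto simp: graph_cycle_def graph_path_def insert_commute)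
  then show False using tree by (auto simp: graph_tree_def)
qed

lemma branch_cover:
  assumes "u \<in> V" "v \<in> V" "u \<noteq> v"
  shows "\<exists>c\<in>neighbours E v. u \<in> branch E c v"
proof -
  obtain p where p: "graph_path V E v u p"
    using tree assms(1,2) unfolding graph_tree_def graph_connected_def by blast
  then obtain c p' where p': "p = v # c # p'"
    using assms(3) by (cases p; cases "tl p") (auto simp: graph_path_def split: if_splits)
  have "last (c # p') = u" using p p' by (auto simp: graph_path_def)
  then have "u \<in> set (c # p')" by (metis last_in_set list.distinct(1))
  have "graph_path V E c u (c # p')" "v \<notin> set (c # p')" "{v, c} \<in> E"
    using p p' by (auto simp: graph_path_def)
  then show ?thesis using path_imp_branch[of V E c u "c # p'" v u] \<open>u \<in> set (c # p')\<close>
    by (auto simp: neighbours_def)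
qed

lemma branch_subset_unfold:
  assumes "{v, w} \<in> E"
  shows "branch E v w \<subseteq> insert v (\<Union>c\<in>neighbours E v - {w}. branch E c v)"
proof
  fix u assume "u \<in> branch E v w"
  then have "(avoiding_step E w)\<^sup>*\<^sup>* v u" by (simp add: branch_def)
  then show "u \<in> insert v (\<Union>c\<in>neighbours E v - {w}. branch E c v)"
  proof (induction rule: rtranclp_induct)
    case (step y z)
    then have yz: "{y, z} \<in> E" "y \<noteq> w" "z \<noteq> w" by (auto simp: avoiding_step_def)
    show ?case
    proof (cases "y = v")
      case True
      then show ?thesis using yz by (auto simp: neighbours_def intro!: bexI[of _ z])
    next
      case False
      then obtain c where "c \<in> neighbours E v - {w}" "y \<in> branch E c v" using step by auto
      then show ?thesis using branch_step[OF _ yz(1) False] by auto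
    qed
  qed simp
qed

lemma branch_unfold:
  assumes "{v, w} \<in> E"
  shows "branch E v w = insert v (\<Union>c\<in>neighbours E v - {w}. branch E c v)" (is "_ = ?R")
proof
  have ne: "v \<noteq> w" "v \<in> V" "w \<in> V" using edgeD[OF assms] by auto
  have w: "w \<in> neighbours E v" using assms by (simp add: neighbours_def)
  show "?R \<subseteq> branch E v w"
  proof
    fix u assume u: "u \<in> ?R"
    show "u \<in> branch E v w"
    proof (cases "u = v")
      case False
      then obtain c where c: "c \<in> neighbours E v" "c \<noteq> w" "u \<in> branch E c v" using u by auto
      have nw: "w \<notin> branch E c v" using branch_disjoint[OF c(1) w c(2)] by auto
      have "(avoiding_step E v)\<^sup>*\<^sup>* c u" using c by (simp add: branch_def)
      then have "u \<in> branch E v w"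
      proof (induction rule: rtranclp_induct)
        case base
        have "{v, c} \<in> E" using c by (simp add: neighbours_def)
        then show ?case using branch_step[OF branch_refl] c ne by metis
      next
        case (step y z)
        then have "y \<in> branch E c v" "z \<in> branch E c v"
          by (auto simp: branch_def intro: rtranclp.rtrancl_into_rtrancl)
        then have "y \<noteq> w" "z \<noteq> w" using nw by auto
        moreover have "{y, z} \<in> E" using step by (simp add: avoiding_step_def)
        ultimately show ?case using step.IH branch_step by metis
      qed
      then show ?thesis .
    qed simp
  qed
qed (rule branch_subset_unfold[OF assms])

lemma branch_opposite:
  assumes "{v, w} \<in> E" shows "branch E v w \<inter> branch E w v = {}"
proof -
  have "v \<notin> branch E w v" using edgeD[OF assms] not_in_branch by metis
  moreover have "branch E c v \<inter> branch E w v = {}" if "c \<in> neighbours E v - {w}" for c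
    using branch_disjoint[of c v w] that assms by (auto simp: neighbours_def)
  ultimately show ?thesis using branch_unfold[OF assms] by auto
qed

lemma vertices_unfold:
  assumes "v \<in> V" shows "V = insert v (\<Union>c\<in>neighbours E v. branch E c v)"
proof
  show "V \<subseteq> insert v (\<Union>c\<in>neighbours E v. branch E c v)"
    using branch_cover[OF _ assms] by auto
  show "insert v (\<Union>c\<in>neighbours E v. branch E c v) \<subseteq> V"
    using branch_subset neighbours_subset assms by (auto simp: subset_iff)
qed

lemma exists_neighbour:
  assumes "v \<in> V" shows "neighbours E v \<noteq> {}"
proof -
  have "\<not> V \<subseteq> {v}" using card_V card_mono[of "{v}" V] by auto
  then obtain u where "u \<in> V" "u \<noteq> v" by blast
  then show ?thesis using branch_cover assms by blast
qed

text \<open>Moving on to a further neighbour strictly shrinks the branch, so the descent ends at a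
  vertex whose only neighbour is the one it was entered from.\<close>

lemma exists_leaf_in_branch:
  assumes "{v, w} \<in> E"
  shows "\<exists>l\<in>graph_leaves V E. l \<in> branch E w v"
  using assms
proof (induction "card (branch E w v)" arbitrary: v w rule: less_induct)
  case less
  have e: "{w, v} \<in> E" using less.prems by (simp add: insert_commute)
  have v: "v \<in> neighbours E w" using e by (simp add: neighbours_def)
  show ?case
  proof (cases "neighbours E w = {v}")
    case True
    have "{e \<in> E. w \<in> e} = {{v, w}}"
    proof -
      have "e = {v, w}" if e: "e \<in> E" "w \<in> e" for e
      proof -
        obtain a where "e = {w, a}" using edge_endpoints[OF e(1)] e(2) by (auto simp: insert_commute)
        then have "a \<in> neighbours E w" using e by (simp add: neighbours_def)
        then show ?thesis using True \<open>e = {w, a}\<close> by (simp add: insert_commute)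
      qed
      then show ?thesis using less.prems by blast
    qed
    then have "w \<in> graph_leaves V E" using edgeD[OF less.prems]
      by (simp add: graph_leaves_def graph_degree_def)
    then show ?thesis using branch_refl[of w E v] by blast
  next
    case False
    then obtain c where c: "c \<in> neighbours E w" "c \<noteq> v" using v by auto
    have "branch E c w \<subseteq> branch E w v" using branch_unfold[OF e] c by (metis Diff_iff UN_upper empty_iff insert_iff subset_insertI2)
    moreover have "w \<notin> branch E c w" using not_in_branch[of c w] c edgeD[of w c] by (auto simp: neighbours_def)
    ultimately have "branch E c w \<subset> branch E w v" using branch_refl[of w E v] by blast
    then have "card (branch E c w) < card (branch E w v)"
      using psubset_card_mono[OF finite_branch] edgeD[OF e] by blast
    moreover have "{w, c} \<in> E" using c by (simp add: neighbours_def)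
    ultimately obtain l where "l \<in> graph_leaves V E" "l \<in> branch E c w" using less.hyps by blast
    then show ?thesis using \<open>branch E c w \<subseteq> branch E w v\<close> by blast
  qed
qed

lemma tree_propagate:
  assumes "u \<in> V" "P u" "\<And>v w. {v, w} \<in> E \<Longrightarrow> P v \<Longrightarrow> P w" "v \<in> V"
  shows "P v"
proof -
  obtain p where "graph_path V E u v p"
    using tree assms(1,4) unfolding graph_tree_def graph_connected_def by blast
  then show ?thesis using assms(2)
  proof (induction p arbitrary: u)
    case Nil
    then show ?case by (simp add: graph_path_def)
  next
    case (Cons a p)
    show ?case
    proof (cases p)
      case Nil
      then show ?thesis using Cons.prems by (auto simp: graph_path_def)
    next
      case (Cons b p')
      then have "graph_path V E b v p" "{u, b} \<in> E" using Cons.prems by (auto simp: graph_path_def)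
      then show ?thesis using Cons.IH Cons.prems assms(3) by blast
    qed
  qed
qed

section \<open>Subtrees for a chosen root\<close>

definition parent :: "'v \<Rightarrow> 'v \<Rightarrow> 'v" where
  "parent r v = (SOME w. w \<in> neighbours E v \<and> r \<in> branch E w v)"

text \<open>The condition says that \<open>r\<close> lies on the side of \<open>v\<close>, which
  excludes the parent without mentioning it. The choice inside \<open>parent\<close> is unique for a
  non-root because branches at \<open>v\<close> are disjoint.\<close>

definition children :: "'v \<Rightarrow> 'v \<Rightarrow> 'v set" where
  "children r v = {c \<in> neighbours E v. r \<in> branch E v c}"

definition subtree :: "'v \<Rightarrow> 'v \<Rightarrow> 'v set" where
  "subtree r v = (if v = r then V else branch E v (parent r v))"

context
  fixes r assumes r: "r \<in> V"
begin

lemma parent: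
  assumes "v \<in> V" "v \<noteq> r"
  shows "parent r v \<in> neighbours E v" "r \<in> branch E (parent r v) v"
proof -
  have "\<exists>w. w \<in> neighbours E v \<and> r \<in> branch E w v"
    using branch_cover[OF r assms(1)] assms(2) by blast
  from someI_ex[OF this] show "parent r v \<in> neighbours E v" "r \<in> branch E (parent r v) v"
    by (simp_all add: parent_def)
qed

lemma parent_eqI:
  assumes "v \<in> V" "w \<in> neighbours E v" "r \<in> branch E w v"
  shows "v \<noteq> r" "parent r v = w"
proof -
  have "{v, w} \<in> E" using assms(2) by (simp add: neighbours_def)
  then have "w \<noteq> v" using edgeD[of v w] by auto
  from not_in_branch[OF this, of E] show *: "v \<noteq> r" using assms(3) by metis
  show "parent r v = w"
    using branch_disjoint[OF assms(2) parent(1)[OF assms(1) *]] parent(2)[OF assms(1) *] assms(3)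
    by blast
qed

lemma children_iff:
  assumes "v \<in> V"
  shows "c \<in> children r v \<longleftrightarrow> c \<in> V \<and> c \<noteq> r \<and> parent r c = v"
proof
  assume "c \<in> children r v"
  then have c: "c \<in> neighbours E v" "r \<in> branch E v c" by (simp_all add: children_def)
  then have "v \<in> neighbours E c" "c \<in> V"
    using neighbours_subset[of v] neighbours_sym[OF c(1)] by auto
  with c(2) show "c \<in> V \<and> c \<noteq> r \<and> parent r c = v" using parent_eqI by blast
next
  assume "c \<in> V \<and> c \<noteq> r \<and> parent r c = v"
  then have "v \<in> neighbours E c" "r \<in> branch E v c" using parent[of c] by simp_all
  then show "c \<in> children r v" using neighbours_sym[of v E c] by (simp add: children_def)
qed

lemma children_root: "children r r = neighbours E r"
  by (auto simp: children_def)

lemma children_nonroot: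
  assumes "v \<in> V" "v \<noteq> r"
  shows "children r v = neighbours E v - {parent r v}"
proof -
  have p: "parent r v \<in> neighbours E v" "r \<in> branch E (parent r v) v" using parent[OF assms] .
  have "parent r v \<notin> children r v"
    using p branch_opposite[of v "parent r v"] unfolding children_def neighbours_def by blast
  moreover have "c \<in> children r v" if c: "c \<in> neighbours E v" "c \<noteq> parent r v" for c
  proof -
    have "{v, c} \<in> E" using c by (simp add: neighbours_def)
    from branch_unfold[OF this] have "r \<in> branch E v c" using p c by blast
    then show ?thesis using c by (simp add: children_def)
  qed
  ultimately show ?thesis unfolding children_def by blast
qed

lemma children_subset: "children r v \<subseteq> V"
  using neighbours_subset by (auto simp: children_def)

lemma finite_children: "finite (children r v)"
  using finite_subset[OF children_subset finite_V] .

lemma subtree_child: "v \<in> V \<Longrightarrow> c \<in> children r v \<Longrightarrow> subtree r c = branch E c v"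
  using children_iff by (auto simp: subtree_def)

lemma subtree_unfold:
  assumes "v \<in> V" shows "subtree r v = insert v (\<Union>c\<in>children r v. subtree r c)"
proof -
  have "subtree r v = insert v (\<Union>c\<in>children r v. branch E c v)"
  proof (cases "v = r")
    case True
    have "subtree r r = V" by (simp add: subtree_def)
    then show ?thesis unfolding \<open>v = r\<close> children_root using vertices_unfold[OF r] by simp
  next
    case False
    have "{v, parent r v} \<in> E" using parent[OF assms False] by (simp add: neighbours_def)
    from branch_unfold[OF this] show ?thesis using children_nonroot[OF assms False] False by (simp add: subtree_def)
  qed
  then show ?thesis using subtree_child[OF assms] by auto
qed

lemma subtree_self: "v \<in> V \<Longrightarrow> v \<in> subtree r v"
  by (simp add: subtree_unfold)

lemma subtree_subset: "v \<in> V \<Longrightarrow> subtree r v \<subseteq> V"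
  using branch_subset by (auto simp: subtree_def)

lemma finite_subtree: "v \<in> V \<Longrightarrow> finite (subtree r v)"
  using finite_subset[OF subtree_subset finite_V] .

lemma not_in_child_subtree:
  assumes "v \<in> V" "c \<in> children r v" shows "v \<notin> subtree r c"
proof -
  have "{v, c} \<in> E" using assms by (simp add: children_def neighbours_def)
  then have "c \<noteq> v" using edgeD[of v c] by auto
  then show ?thesis using not_in_branch[of c v E] subtree_child[OF assms] by simp
qed

lemma subtree_disjoint:
  assumes "v \<in> V" "c \<in> children r v" "c' \<in> children r v" "c \<noteq> c'"
  shows "subtree r c \<inter> subtree r c' = {}"
  using branch_disjoint[of c v c'] subtree_child assms by (auto simp: children_def)

lemma subtree_minus_self:
  assumes "v \<in> V" shows "subtree r v - {v} = (\<Union>c\<in>children r v. subtree r c)"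
  using subtree_unfold[OF assms] not_in_child_subtree[OF assms] by auto

lemma card_subtree_less:
  assumes "v \<in> V" "c \<in> children r v" shows "card (subtree r c) < card (subtree r v)"
proof -
  have "subtree r c \<subset> subtree r v"
    using subtree_unfold[OF assms(1)] not_in_child_subtree[OF assms] assms by blast
  then show ?thesis using psubset_card_mono finite_subtree[OF assms(1)] by blast
qed

lemma tree_induct [consumes 1, case_names step]:
  assumes "v \<in> V" "\<And>v. v \<in> V \<Longrightarrow> (\<And>c. c \<in> children r v \<Longrightarrow> P c) \<Longrightarrow> P v"
  shows "P v"
  using assms(1)
proof (induction "card (subtree r v)" arbitrary: v rule: less_induct)
  case less
  then show ?case using assms(2) card_subtree_less children_subset by (metis subsetD)
qed

lemma no_edge_between_subtrees:
  assumes "v \<in> V" "c \<in> children r v" "c' \<in> children r v" "c \<noteq> c'" "x \<in> subtree r c" "y \<in> subtree r c'"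
  shows "{x, y} \<notin> E"
proof
  assume "{x, y} \<in> E"
  moreover have "x \<noteq> v" "y \<noteq> v" using not_in_child_subtree assms by metis+
  moreover have "x \<in> branch E c v" using assms subtree_child by auto
  ultimately have "y \<in> subtree r c" using branch_step assms subtree_child by metis
  then show False using subtree_disjoint assms by blast
qed

lemma edge_to_child_subtree:
  assumes "v \<in> V" "c \<in> children r v" "x \<in> subtree r c" "{v, x} \<in> E"
  shows "x = c"
proof (rule ccontr)
  assume "x \<noteq> c"
  have "x \<in> neighbours E v" using assms by (simp add: neighbours_def)
  moreover have "x \<in> branch E c v" using assms subtree_child by simp
  moreover have "c \<in> neighbours E v" using assms by (simp add: children_def)
  ultimately show False using branch_disjoint[of x v c] \<open>x \<noteq> c\<close> branch_refl[of x E v] by blast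
qed

text \<open>A simple path from \<open>r\<close> to \<open>c\<close> through \<open>v\<close> meets
  \<open>c\<close> only at its end, so its part up to \<open>v\<close> avoids \<open>c\<close> and
  puts \<open>r\<close> on the side of \<open>v\<close>. This is the bridge from the path-based
  orientation to branches.\<close>

lemma rooted_edge_iff:
  assumes "v \<in> V"
  shows "rooted_edge V E r v c \<longleftrightarrow> c \<in> children r v"
proof
  assume "rooted_edge V E r v c"
  then obtain p where e: "{v, c} \<in> E" and p: "graph_path V E r c p" "v \<in> set p"
    by (auto simp: rooted_edge_def)
  then have "v \<noteq> c" using edgeD by blast
  have "p \<noteq> []" "last p = c" using p by (auto simp: graph_path_def)
  then obtain p1 where p1: "p = p1 @ [c]" by (metis append_butlast_last_id)
  then have v: "v \<in> set p1" "c \<notin> set p1" using p \<open>v \<noteq> c\<close> by (auto simp: graph_path_def)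
  then obtain a b where "p1 = a @ v # b" by (meson split_list)
  then have "graph_path V E r v (a @ [v])" "c \<notin> set (a @ [v])"
    using graph_path_prefix[of V E r c a v "b @ [c]"] p p1 v by auto
  then have "v \<in> branch E r c" using path_imp_branch by fastforce
  then have "r \<in> branch E v c" by (simp add: branch_sym)
  then show "c \<in> children r v" using e by (auto simp: children_def neighbours_def)
next
  assume "c \<in> children r v"
  then have c: "{v, c} \<in> E" "r \<in> branch E v c" by (auto simp: children_def neighbours_def)
  then have "v \<in> branch E r c" "r \<noteq> c" using branch_sym not_in_branch edgeD by metis+
  then obtain p where p: "graph_path V E r v p" "c \<notin> set p"
    using branch_imp_path[OF simple _ r] by metis
  have "v \<in> set p" using p by (auto simp: graph_path_def)
  then show "rooted_edge V E r v c"
    unfolding rooted_edge_def using graph_path_snoc[OF p(1) c(1)] p edgeD[OF c(1)] c by fastforce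
qed

lemma closed_descendants_eq:
  assumes "v \<in> V" shows "closed_descendants V E r v = subtree r v"
proof -
  have "u \<in> subtree r v" if "(rooted_edge V E r)\<^sup>*\<^sup>* v u" "v \<in> V" for u v
    using that
  proof (induction rule: converse_rtranclp_induct)
    case (step y z)
    then show ?case using rooted_edge_iff subtree_unfold children_subset by blast
  qed (simp add: subtree_self)
  moreover have "(rooted_edge V E r)\<^sup>*\<^sup>* v u" if "u \<in> subtree r v" for u
    using assms that
  proof (induction v rule: tree_induct)
    case (step v)
    then show ?case using subtree_unfold[OF step(1)] rooted_edge_iff[OF step(1)]
      by (metis UN_E converse_rtranclp_into_rtranclp insertE rtranclp.rtrancl_refl)
  qed
  ultimately show ?thesis using assms subtree_self[OF assms]
    by (auto simp: closed_descendants_def descendants_def)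
qed

lemma descendants_eq:
  assumes "v \<in> V" shows "descendants V E r v = subtree r v - {v}"
  using closed_descendants_eq[OF assms] by (auto simp: closed_descendants_def descendants_def)

text \<open>Every vertex except the root is the child of exactly one vertex. In this way factors
  that arise at the parents are collected at the message they depend on.\<close>

lemma prod_children:
  fixes f :: "'v \<Rightarrow> 'v \<Rightarrow> 'b::comm_monoid_mult"
  shows "(\<Prod>v\<in>V. \<Prod>c\<in>children r v. f v c) = (\<Prod>c\<in>V - {r}. f (parent r c) c)"
proof -
  have "(\<Prod>c\<in>V - {r}. f (parent r c) c) = (\<Prod>v\<in>V. \<Prod>c\<in>{c \<in> V - {r}. parent r c = v}. f (parent r c) c)"
    using parent neighbours_subset by (intro prod.group[symmetric]) (use finite_V in auto)
  also have "\<dots> = (\<Prod>v\<in>V. \<Prod>c\<in>children r v. f v c)"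
    using children_iff by (intro prod.cong) auto
  finally show ?thesis by simp
qed

end

end

section \<open>Recursion for the graph polynomial\<close>

text \<open>
  \<open>boundary_delta E q Z U k\<close> is the part of \<open>\<delta>\<close> of \<open>U \<union> Z\<close> coming from the sets
  \<open>W \<union> Z\<close> with \<open>W \<subseteq> U\<close>, with the factor \<open>k\<^sup>Z\<close> removed.
\<close>

definition boundary_delta ::
  "'v set set \<Rightarrow> ('v set \<Rightarrow> real) \<Rightarrow> 'v set \<Rightarrow> 'v set \<Rightarrow> ('v \<Rightarrow> real) \<Rightarrow> real" where
  "boundary_delta E q Z U k = (\<Sum>W\<in>Pow U. (\<Prod>e\<in>induced_edges E (W \<union> Z). q e) * (\<Prod>v\<in>W. k v))"

lemma graph_delta_eq_boundary: "graph_delta E q U k = boundary_delta E q {} U k"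
  by (simp add: graph_delta_def boundary_delta_def)

lemma graph_Delta_eq_delta:
  assumes "finite U"
  shows "graph_Delta E q U k = graph_delta E q U (\<lambda>v. - k v)"
proof -
  have "(\<Prod>v\<in>W. - k v) = (-1) ^ card W * (\<Prod>v\<in>W. k v)" for W
    by (simp add: prod.distrib[symmetric] flip: prod_constant)
  then show ?thesis by (simp add: graph_Delta_def graph_delta_def mult_ac)
qed

lemma induced_edges_disjoint_Un:
  assumes "simple_graph V E" "\<And>x y. x \<in> A \<Longrightarrow> y \<in> B \<Longrightarrow> {x, y} \<notin> E"
  shows "induced_edges E (A \<union> B \<union> Z) = induced_edges E (A \<union> Z) \<union> induced_edges E (B \<union> Z)"
proof
  show "induced_edges E (A \<union> B \<union> Z) \<subseteq> induced_edges E (A \<union> Z) \<union> induced_edges E (B \<union> Z)"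
  proof
    fix e assume e: "e \<in> induced_edges E (A \<union> B \<union> Z)"
    then obtain x y where xy: "e = {x, y}"
      using assms(1) by (auto simp: simple_graph_def induced_edges_def)
    have "{x, y} \<in> E" "{y, x} \<in> E" "x \<in> A \<union> B \<union> Z" "y \<in> A \<union> B \<union> Z"
      using e xy by (auto simp: induced_edges_def insert_commute)
    then show "e \<in> induced_edges E (A \<union> Z) \<union> induced_edges E (B \<union> Z)"
      using assms(2)[of x y] assms(2)[of y x] xy by (auto simp: induced_edges_def)
  qed
qed (auto simp: induced_edges_def)

lemma finite_induced_edges: "finite U \<Longrightarrow> finite (induced_edges E U)"
  by (rule finite_subset[of _ "Pow U"]) (auto simp: induced_edges_def)

text \<open>Subsets of \<open>A \<union> B\<close> are pairs of subsets, and no edge runs between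
  the two halves. Edges from a half to \<open>Z\<close> belong to that half alone; edges inside
  \<open>Z\<close> would be counted twice, hence the assumption that there are none.\<close>

lemma boundary_delta_Un:
  assumes G: "simple_graph V E" and fin: "finite A" "finite B" "finite Z" and disj: "A \<inter> B = {}" "(A \<union> B) \<inter> Z = {}"
    and no_edge: "\<And>x y. x \<in> A \<Longrightarrow> y \<in> B \<Longrightarrow> {x, y} \<notin> E" and Z: "induced_edges E Z = {}"
  shows "boundary_delta E q Z (A \<union> B) k = boundary_delta E q Z A k * boundary_delta E q Z B k"
proof -
  let ?g = "\<lambda>W. (\<Prod>e\<in>induced_edges E (W \<union> Z). q e) * (\<Prod>v\<in>W. k v)"
  have "bij_betw (\<lambda>(X, Y). X \<union> Y) (Pow A \<times> Pow B) (Pow (A \<union> B))"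
    by (rule bij_betw_byWitness[where f' = "\<lambda>W. (W \<inter> A, W \<inter> B)"]) (use disj(1) in auto)
  then have "boundary_delta E q Z (A \<union> B) k = (\<Sum>(X, Y)\<in>Pow A \<times> Pow B. ?g (X \<union> Y))"
    unfolding boundary_delta_def by (subst sum.reindex_bij_betw[symmetric]) (auto simp: case_prod_unfold)
  also have "\<dots> = (\<Sum>(X, Y)\<in>Pow A \<times> Pow B. ?g X * ?g Y)"
  proof (intro sum.cong refl, clarify)
    fix X Y assume XY: "X \<subseteq> A" "Y \<subseteq> B"
    have fin': "finite X" "finite Y" using XY fin finite_subset by blast+
    have ind: "induced_edges E (X \<union> Y \<union> Z) = induced_edges E (X \<union> Z) \<union> induced_edges E (Y \<union> Z)"
      by (rule induced_edges_disjoint_Un[OF G]) (use XY no_edge in blast)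
    have "(X \<union> Z) \<inter> (Y \<union> Z) = Z" using XY disj by blast
    then have disj': "induced_edges E (X \<union> Z) \<inter> induced_edges E (Y \<union> Z) = {}"
      using Z unfolding induced_edges_def by blast
    have "(\<Prod>e\<in>induced_edges E (X \<union> Y \<union> Z). q e)
        = (\<Prod>e\<in>induced_edges E (X \<union> Z). q e) * (\<Prod>e\<in>induced_edges E (Y \<union> Z). q e)"
      unfolding ind by (intro prod.union_disjoint finite_induced_edges) (use fin fin' disj' in auto)
    moreover have "(\<Prod>v\<in>X \<union> Y. k v) = (\<Prod>v\<in>X. k v) * (\<Prod>v\<in>Y. k v)"
      by (intro prod.union_disjoint) (use fin' XY disj in auto)
    ultimately show "?g (X \<union> Y) = ?g X * ?g Y" by simp
  qed
  also have "\<dots> = boundary_delta E q Z A k * boundary_delta E q Z B k"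
    by (simp add: boundary_delta_def sum_product sum.cartesian_product)
  finally show ?thesis .
qed

lemma boundary_delta_empty: "induced_edges E Z = {} \<Longrightarrow> boundary_delta E q Z {} k = 1"
  by (simp add: boundary_delta_def)

lemma boundary_delta_UN:
  assumes G: "simple_graph V E" and "finite C" "finite Z" "\<And>c. c \<in> C \<Longrightarrow> finite (S c)"
    and "\<And>c. c \<in> C \<Longrightarrow> S c \<inter> Z = {}"
    and "\<And>c d. c \<in> C \<Longrightarrow> d \<in> C \<Longrightarrow> c \<noteq> d \<Longrightarrow> S c \<inter> S d = {}"
    and "\<And>c d x y. c \<in> C \<Longrightarrow> d \<in> C \<Longrightarrow> c \<noteq> d \<Longrightarrow> x \<in> S c \<Longrightarrow> y \<in> S d \<Longrightarrow> {x, y} \<notin> E"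
    and Z: "induced_edges E Z = {}"
  shows "boundary_delta E q Z (\<Union>c\<in>C. S c) k = (\<Prod>c\<in>C. boundary_delta E q Z (S c) k)"
  using assms(2,4-7)
proof (induction C rule: finite_induct)
  case empty
  then show ?case by (simp add: boundary_delta_empty Z)
next
  case (insert c C)
  have "boundary_delta E q Z (S c \<union> (\<Union>c\<in>C. S c)) k
      = boundary_delta E q Z (S c) k * boundary_delta E q Z (\<Union>c\<in>C. S c) k"
  proof (rule boundary_delta_Un[OF G _ _ assms(3) _ _ _ Z])
    show "S c \<inter> (\<Union>c\<in>C. S c) = {}" using insert.prems(3) insert.hyps(2) by blast
    show "{x, y} \<notin> E" if "x \<in> S c" "y \<in> (\<Union>c\<in>C. S c)" for x y
      using that insert.prems(4) insert.hyps(2) by blast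
    show "(S c \<union> (\<Union>c\<in>C. S c)) \<inter> Z = {}" using insert.prems(2) by blast
  qed (use insert in auto)
  also have "boundary_delta E q Z (\<Union>c\<in>C. S c) k = (\<Prod>c\<in>C. boundary_delta E q Z (S c) k)"
  proof (rule insert.IH)
    show "{x, y} \<notin> E" if "c \<in> C" "d \<in> C" "c \<noteq> d" "x \<in> S c" "y \<in> S d" for c d x y
      using insert.prems(4)[of c d x y] that by simp
  qed (use insert.prems(1-3) in simp_all)
  finally show ?case using insert.hyps by simp
qed

lemma graph_delta_insert:
  assumes "finite U" "v \<notin> U"
  shows "graph_delta E q (insert v U) k = graph_delta E q U k + k v * boundary_delta E q {v} U k"
proof -
  let ?g = "\<lambda>W. (\<Prod>e\<in>induced_edges E W. q e) * (\<Prod>v\<in>W. k v)"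
  have "graph_delta E q (insert v U) k = sum ?g (Pow U \<union> insert v ` Pow U)"
    by (simp add: graph_delta_def Pow_insert)
  also have "\<dots> = sum ?g (Pow U) + sum ?g (insert v ` Pow U)"
    by (rule sum.union_disjoint) (use assms in auto)
  also have "sum ?g (insert v ` Pow U) = (\<Sum>W\<in>Pow U. ?g (insert v W))"
    by (subst sum.reindex) (use assms in \<open>auto simp: inj_on_def\<close>)
  also have "\<dots> = k v * boundary_delta E q {v} U k"
    unfolding boundary_delta_def sum_distrib_left
  proof (rule sum.cong[OF refl])
    fix W assume "W \<in> Pow U"
    then have "W \<subseteq> U" by simp
    then have "finite W" "v \<notin> W" using assms finite_subset[of W U] by auto
    then show "?g (insert v W) = k v * ((\<Prod>e\<in>induced_edges E (W \<union> {v}). q e) * (\<Prod>v\<in>W. k v))"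
      by simp
  qed
  finally show ?thesis by (simp add: graph_delta_def)
qed

text \<open>Subsets avoiding \<open>c\<close> see no edge to \<open>v\<close> and sum to the
  polynomial of \<open>A - {c}\<close>. Those containing \<open>c\<close> gain exactly the factor
  \<open>q {v, c}\<close>, and without it their sum is the difference of the two
  polynomials.\<close>

lemma boundary_delta_single_edge:
  assumes G: "simple_graph V E" and "finite A" "c \<in> A" "v \<notin> A" "{v, c} \<in> E"
    and only: "\<And>x. x \<in> A \<Longrightarrow> {v, x} \<in> E \<Longrightarrow> x = c"
  shows "boundary_delta E q {v} A k
       = graph_delta E q (A - {c}) k + q {v, c} * (graph_delta E q A k - graph_delta E q (A - {c}) k)"
proof -
  let ?U = "A - {c}"
  have fin: "finite ?U" "c \<notin> ?U" and A: "A = insert c ?U" using assms(2,3) by auto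
  let ?g = "\<lambda>W. (\<Prod>e\<in>induced_edges E W. q e) * (\<Prod>v\<in>W. k v)"
  let ?h = "\<lambda>W. (\<Prod>e\<in>induced_edges E (W \<union> {v}). q e) * (\<Prod>v\<in>W. k v)"
  have ind: "induced_edges E (W \<union> {v}) = (if c \<in> W then insert {v, c} (induced_edges E W) else induced_edges E W)"
    if "W \<subseteq> A" for W
  proof -
    have "e \<in> induced_edges E (W \<union> {v}) \<Longrightarrow> v \<in> e \<Longrightarrow> e = {v, c} \<and> c \<in> W" for e
    proof -
      assume e: "e \<in> induced_edges E (W \<union> {v})" "v \<in> e"
      then obtain x y where xy: "e = {x, y}" "x \<noteq> y"
        using G by (auto simp: simple_graph_def induced_edges_def)
      then obtain z where z: "e = {v, z}" "z \<noteq> v" using e(2) by (auto simp: insert_commute)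
      then have "z \<in> W" "{v, z} \<in> E" using e by (auto simp: induced_edges_def)
      then show ?thesis using only[of z] that z by auto
    qed
    moreover have "{v, c} \<in> induced_edges E (W \<union> {v})" if "c \<in> W"
      using that assms(5) by (auto simp: induced_edges_def)
    ultimately show ?thesis by (auto simp: induced_edges_def)
  qed
  have "boundary_delta E q {v} A k = sum ?h (Pow ?U \<union> insert c ` Pow ?U)"
    by (subst A) (simp only: boundary_delta_def Pow_insert)
  also have "\<dots> = sum ?h (Pow ?U) + sum ?h (insert c ` Pow ?U)"
    by (rule sum.union_disjoint) (use fin in auto)
  also have "sum ?h (Pow ?U) = graph_delta E q ?U k"
    unfolding graph_delta_def
  proof (rule sum.cong[OF refl])
    fix W assume "W \<in> Pow ?U"
    then have "W \<subseteq> A" "c \<notin> W" by auto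
    then show "?h W = ?g W" using ind[of W] by simp
  qed
  also have "sum ?h (insert c ` Pow ?U) = q {v, c} * sum ?g (insert c ` Pow ?U)"
    unfolding sum_distrib_left
  proof (rule sum.cong[OF refl])
    fix W assume "W \<in> insert c ` Pow ?U"
    then have W: "W \<subseteq> A" "c \<in> W" using assms(3) by auto
    have "finite (induced_edges E W)" "{v, c} \<notin> induced_edges E W"
      using W assms(2,4) finite_subset[OF W(1)] by (auto intro: finite_induced_edges simp: induced_edges_def)
    then show "?h W = q {v, c} * ?g W" using ind[OF W(1)] W(2) by simp
  qed
  also have "sum ?g (insert c ` Pow ?U) = graph_delta E q A k - graph_delta E q ?U k"
  proof -
    have "graph_delta E q A k = sum ?g (Pow ?U \<union> insert c ` Pow ?U)"
      by (subst A) (simp only: graph_delta_def Pow_insert)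
    also have "\<dots> = sum ?g (Pow ?U) + sum ?g (insert c ` Pow ?U)"
      by (rule sum.union_disjoint) (use fin in auto)
    finally show ?thesis by (simp add: graph_delta_def)
  qed
  finally show ?thesis .
qed

context finite_tree
begin

lemma no_induced_edges_small: "induced_edges E {} = {}" "induced_edges E {v} = {}"
  using edge_endpoints by (fastforce simp: induced_edges_def)+

definition branch_ratio :: "('v set \<Rightarrow> real) \<Rightarrow> ('v \<Rightarrow> real) \<Rightarrow> 'v set \<Rightarrow> 'v \<Rightarrow> real" where
  "branch_ratio q k U v = graph_delta E q U k / graph_delta E q (U - {v}) k - 1"

context
  fixes r assumes r: "r \<in> V"
begin

lemma graph_delta_subtree_minus:
  assumes "v \<in> V"
  shows "graph_delta E q (subtree r v - {v}) k = (\<Prod>c\<in>children r v. graph_delta E q (subtree r c) k)"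
proof -
  have C: "c \<in> V" if "c \<in> children r v" for c using that children_subset[OF r] by auto
  show ?thesis
    unfolding subtree_minus_self[OF r assms] graph_delta_eq_boundary
    by (rule boundary_delta_UN[OF simple finite_children])
      (use r finite_subtree[OF r C] subtree_disjoint[OF r assms] no_edge_between_subtrees[OF r assms]
        no_induced_edges_small in auto)
qed

lemma graph_delta_subtree:
  assumes "v \<in> V"
  shows "graph_delta E q (subtree r v) k = graph_delta E q (subtree r v - {v}) k
    + k v * (\<Prod>c\<in>children r v. graph_delta E q (subtree r c - {c}) k
        + q {v, c} * (graph_delta E q (subtree r c) k - graph_delta E q (subtree r c - {c}) k))"
proof -
  have C: "c \<in> V" if "c \<in> children r v" for c using that children_subset[OF r] by auto
  have "graph_delta E q (insert v (subtree r v - {v})) k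
      = graph_delta E q (subtree r v - {v}) k + k v * boundary_delta E q {v} (subtree r v - {v}) k"
    by (rule graph_delta_insert) (use finite_subtree[OF r assms] in auto)
  moreover have "insert v (subtree r v - {v}) = subtree r v" using subtree_self[OF r assms] by auto
  moreover have "boundary_delta E q {v} (subtree r v - {v}) k
      = (\<Prod>c\<in>children r v. boundary_delta E q {v} (subtree r c) k)"
    unfolding subtree_minus_self[OF r assms]
    by (rule boundary_delta_UN[OF simple finite_children])
      (use r C finite_subtree[OF r] not_in_child_subtree[OF r assms] subtree_disjoint[OF r assms]
        no_edge_between_subtrees[OF r assms] no_induced_edges_small in auto)
  moreover have "\<dots> = (\<Prod>c\<in>children r v. graph_delta E q (subtree r c - {c}) k
        + q {v, c} * (graph_delta E q (subtree r c) k - graph_delta E q (subtree r c - {c}) k))"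
  proof (rule prod.cong[OF refl], rule boundary_delta_single_edge[OF simple])
    fix c assume c: "c \<in> children r v"
    show "finite (subtree r c)" "c \<in> subtree r c" "v \<notin> subtree r c" "{v, c} \<in> E"
      using finite_subtree[OF r C[OF c]] subtree_self[OF r C[OF c]] not_in_child_subtree[OF r assms c] c
      by (auto simp: children_def neighbours_def)
    show "x = c" if "x \<in> subtree r c" "{v, x} \<in> E" for x
      using edge_to_child_subtree[OF r assms c that] .
  qed
  ultimately show ?thesis by simp
qed

text \<open>Dividing \<open>graph_delta_subtree\<close> by the product of the polynomials of the
  child subtrees turns each child factor into (1 + q x) / (1 + x), where x is the ratio of the
  child. This is the origin of \<phi>, which appears here inverted.\<close>

lemma branch_ratio_subtree:
  assumes "v \<in> V" and nz: "\<And>U. U \<subseteq> V \<Longrightarrow> graph_delta E q U k \<noteq> 0"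
  shows "branch_ratio q k (subtree r v) v
    = k v * (\<Prod>c\<in>children r v. (1 + q {v, c} * branch_ratio q k (subtree r c) c)
                               / (1 + branch_ratio q k (subtree r c) c))"
proof -
  have S: "subtree r u \<subseteq> V" "subtree r u - {u} \<subseteq> V" if "u \<in> V" for u using subtree_subset[OF r that] by auto
  have C: "c \<in> V" if "c \<in> children r v" for c using that children_subset[OF r] by auto
  have "branch_ratio q k (subtree r v) v
      = k v * ((\<Prod>c\<in>children r v. graph_delta E q (subtree r c - {c}) k
        + q {v, c} * (graph_delta E q (subtree r c) k - graph_delta E q (subtree r c - {c}) k))
      / (\<Prod>c\<in>children r v. graph_delta E q (subtree r c) k))"
    using nz[OF S(2)[OF assms(1)]] graph_delta_subtree[OF assms(1), of q k]
    unfolding branch_ratio_def graph_delta_subtree_minus[OF assms(1), symmetric]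
    by (simp add: field_simps)
  also have "\<dots> = k v * (\<Prod>c\<in>children r v. (1 + q {v, c} * branch_ratio q k (subtree r c) c)
                               / (1 + branch_ratio q k (subtree r c) c))"
    unfolding prod_dividef[symmetric]
  proof (intro arg_cong[where f = "\<lambda>x. k v * x"] prod.cong refl)
    fix c assume c: "c \<in> children r v"
    show "(graph_delta E q (subtree r c - {c}) k
        + q {v, c} * (graph_delta E q (subtree r c) k - graph_delta E q (subtree r c - {c}) k))
      / graph_delta E q (subtree r c) k
      = (1 + q {v, c} * branch_ratio q k (subtree r c) c) / (1 + branch_ratio q k (subtree r c) c)"
      using nz[OF S(1)[OF C[OF c]]] nz[OF S(2)[OF C[OF c]]]
      by (simp add: branch_ratio_def field_simps)
  qed
  finally show ?thesis .
qed

text \<open>The product telescopes: the factor of \<open>u\<close> is the polynomial of its subtree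
  divided by that of the subtree without \<open>u\<close>, and this denominator is the product of
  the numerators belonging to the children.\<close>

lemma graph_delta_eq_prod_ratio:
  assumes "v \<in> V" and nz: "\<And>U. U \<subseteq> V \<Longrightarrow> graph_delta E q U k \<noteq> 0"
  shows "graph_delta E q (subtree r v) k = (\<Prod>u\<in>subtree r v. 1 + branch_ratio q k (subtree r u) u)"
  using r assms(1)
proof (induction v rule: tree_induct[consumes 2, case_names step])
  case (step v)
  have fin: "finite (subtree r v - {v})" using finite_subtree[OF r step(1)] by auto
  have C: "c \<in> V" if "c \<in> children r v" for c using that children_subset[OF r] by auto
  have "(\<Prod>u\<in>subtree r v. 1 + branch_ratio q k (subtree r u) u)
      = (1 + branch_ratio q k (subtree r v) v) * (\<Prod>u\<in>subtree r v - {v}. 1 + branch_ratio q k (subtree r u) u)"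
    using subtree_self[OF r step(1)] finite_subtree[OF r step(1)] by (simp add: prod.remove)
  also have "(\<Prod>u\<in>subtree r v - {v}. 1 + branch_ratio q k (subtree r u) u)
      = (\<Prod>c\<in>children r v. \<Prod>u\<in>subtree r c. 1 + branch_ratio q k (subtree r u) u)"
    unfolding subtree_minus_self[OF r step(1)]
    by (rule prod.UNION_disjoint)
      (use finite_children[OF r] C finite_subtree[OF r] subtree_disjoint[OF r step(1)] in auto)
  also have "\<dots> = graph_delta E q (subtree r v - {v}) k"
    using step.IH graph_delta_subtree_minus[OF step(1)] by simp
  also have "(1 + branch_ratio q k (subtree r v) v) * \<dots> = graph_delta E q (subtree r v) k"
    using nz[of "subtree r v - {v}"] subtree_subset[OF r step(1)] by (auto simp: branch_ratio_def)
  finally show ?case by simp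
qed

end

end

section \<open>Stein equations on the unit interval\<close>

text \<open>Ramps that fall from 1 to 0 within distance 1 / n to the right of \<open>c\<close> are
  approximated by Weierstrass. The uniform bound 2 is what dominated convergence will need.\<close>

lemma polynomial_approx_indicator:
  fixes c :: real
  shows "\<exists>p. (\<forall>n. real_polynomial_function (p n)) \<and> (\<forall>n. \<forall>y\<in>{0..1}. \<bar>p n y\<bar> \<le> 2) \<and>
    (\<forall>y\<in>{0..1}. (\<lambda>n. p n y) \<longlonglongrightarrow> indicator {..c} y)"
proof -
  define g where "g n y = max 0 (min 1 (1 - (y - c) * real n))" for n y
  have "\<exists>p. real_polynomial_function p \<and> (\<forall>y\<in>{0..1}. \<bar>g n y - p y\<bar> < 1 / real (Suc n))" for n
  proof -
    have "continuous_on {0..1} (g n)" unfolding g_def by (intro continuous_intros)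
    then obtain p where "real_polynomial_function p" "\<And>y. y \<in> {0..1} \<Longrightarrow> \<bar>g n y - p y\<bar> < 1 / real (Suc n)"
      using Stone_Weierstrass_real_polynomial_function[of "{0..1::real}" "g n" "1 / real (Suc n)"] by auto
    then show ?thesis by blast
  qed
  then obtain p where p: "\<And>n. real_polynomial_function (p n)"
    "\<And>n y. y \<in> {0..1} \<Longrightarrow> \<bar>g n y - p n y\<bar> < 1 / real (Suc n)" by metis
  have "\<bar>p n y\<bar> \<le> 2" if "y \<in> {0..1}" for n y
  proof -
    have "\<bar>g n y\<bar> \<le> 1" unfolding g_def by auto
    moreover have "1 / real (Suc n) \<le> 1" by simp
    ultimately show ?thesis using p(2)[OF that, of n] by linarith
  qed
  moreover have "(\<lambda>n. p n y) \<longlonglongrightarrow> indicator {..c} y" if y: "y \<in> {0..1}" for y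
  proof -
    have "(\<lambda>n. g n y) \<longlonglongrightarrow> indicator {..c} y"
    proof (cases "y \<le> c")
      case True
      then have "g n y = 1" for n using mult_nonpos_nonneg[of "y - c" "real n"] by (simp add: g_def)
      then show ?thesis using True by simp
    next
      case False
      then obtain N where N: "1 / (y - c) < real N" using reals_Archimedean2 by blast
      have "g n y = 0" if "N \<le> n" for n
      proof -
        have "1 / (y - c) \<le> real n" using N that by linarith
        then have "1 \<le> (y - c) * real n" using False by (simp add: field_simps)
        then show ?thesis by (simp add: g_def)
      qed
      then have "\<forall>\<^sub>F n in sequentially. g n y = 0" by (auto simp: eventually_sequentially)
      then show ?thesis using False by (simp add: tendsto_eventually)
    qed
    moreover have "(\<lambda>n. g n y - p n y) \<longlonglongrightarrow> 0"
    proof (rule Lim_null_comparison)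
      show "\<forall>\<^sub>F n in sequentially. norm (g n y - p n y) \<le> 1 / real (Suc n)"
        using p(2)[OF y] by (intro always_eventually allI) (simp add: less_imp_le)
      show "(\<lambda>n. 1 / real (Suc n)) \<longlonglongrightarrow> 0" by (rule LIMSEQ_Suc[OF lim_1_over_n])
    qed
    ultimately have "(\<lambda>n. g n y - (g n y - p n y)) \<longlonglongrightarrow> indicator {..c} y - 0"
      by (rule tendsto_diff)
    then show ?thesis by simp
  qed
  ultimately show ?thesis using p(1) by blast
qed

locale unit_law = prob_space D for D :: "real measure" +
  assumes sets_D [measurable_cong, simp]: "sets D = sets borel" and AE_unit: "AE z in D. 0 < z \<and> z < 1"
begin

lemma integrable_bounded_unit:
  assumes "f \<in> borel_measurable borel" "\<And>z. 0 < z \<Longrightarrow> z < 1 \<Longrightarrow> \<bar>f z\<bar> \<le> C"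
  shows "integrable D (f :: real \<Rightarrow> real)"
proof (rule integrable_const_bound)
  show "AE z in D. norm (f z) \<le> C" using AE_unit by eventually_elim (use assms(2) in auto)
qed (use assms in auto)

end

text \<open>
  Testing with \<open>z ^ n\<close>, hence with the primitive \<open>min z c\<close> of an indicator, shows that \<open>A\<close> times the law
  has the density \<open>dens c = E (B Z 1\<^bsub>Z \<le> c\<^esub>)\<close>, which therefore solves \<open>dens' = (B / A) * dens\<close>.
\<close>

locale stein_law = unit_law +
  fixes A B :: "real \<Rightarrow> real" and C :: real
  assumes A_meas [measurable]: "A \<in> borel_measurable borel" and B_meas [measurable]: "B \<in> borel_measurable borel"
    and A_bound: "\<And>z. 0 < z \<Longrightarrow> z < 1 \<Longrightarrow> \<bar>A z\<bar> \<le> C" and B_bound: "\<And>z. 0 < z \<Longrightarrow> z < 1 \<Longrightarrow> \<bar>B z\<bar> \<le> C"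
    and A_pos: "\<And>z. 0 < z \<Longrightarrow> z < 1 \<Longrightarrow> 0 < A z"
    and A_cont: "continuous_on {0<..<1} A" and B_cont: "continuous_on {0<..<1} B"
    and stein: "\<And>n. (\<integral>z. A z * (real n * z ^ (n - 1)) + B z * z ^ n \<partial>D) = 0"
begin

lemma C_nonneg: "0 \<le> C"
  using A_bound[of "1/2"] by auto

lemma integrable_A_mult:
  assumes [measurable]: "f \<in> borel_measurable borel" and "\<And>z. 0 < z \<Longrightarrow> z < 1 \<Longrightarrow> \<bar>f z\<bar> \<le> K"
  shows "integrable D (\<lambda>z. A z * f z)" "integrable D (\<lambda>z. B z * f z)"
  using assms A_bound B_bound C_nonneg
  by (auto intro!: integrable_bounded_unit[where C = "C * K"] mult_mono simp: abs_mult)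

text \<open>The Stein equation for the primitive of \<open>p\<close> that vanishes at 0. A monomial
  of degree i has a primitive of degree i + 1, so the hypothesis is used at \<open>Suc i\<close>
  with weight \<open>a i / Suc i\<close>.\<close>

lemma stein_polynomial:
  assumes "real_polynomial_function p"
  shows "(\<integral>z. A z * p z + B z * (\<integral>y. p y * indicator {0..z} y \<partial>lborel) \<partial>D) = 0"
proof -
  obtain a n where p: "p = (\<lambda>x. \<Sum>i\<le>n. a i * x ^ i)"
    using assms by (auto simp: real_polynomial_function_iff_sum)
  have prim: "(\<integral>y. p y * indicator {0..z} y \<partial>lborel) = (\<Sum>i\<le>n. a i / real (Suc i) * z ^ Suc i)" if "0 < z" for z
  proof -
    have "(\<integral>y. p y * indicator {0..z} y \<partial>lborel) = (\<integral>y. (\<Sum>i\<le>n. a i * (y ^ i * indicator {0..z} y)) \<partial>lborel)"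
      unfolding p by (simp add: sum_distrib_right mult.assoc)
    also have "\<dots> = (\<Sum>i\<le>n. a i * (\<integral>y. y ^ i * indicator {0..z} y \<partial>lborel))"
    proof -
      have "integrable lborel (\<lambda>y. y ^ i * indicator {0..z} y)" for i
        using borel_integrable_atLeastAtMost'[of 0 z "\<lambda>y. y ^ i"]
        by (simp add: set_integrable_def mult.commute continuous_intros)
      then show ?thesis by (subst Bochner_Integration.integral_sum) auto
    qed
    also have "\<dots> = (\<Sum>i\<le>n. a i / real (Suc i) * z ^ Suc i)"
      using that by (intro sum.cong refl) (simp add: integral_power)
    finally show ?thesis .
  qed
  have pow: "\<bar>z ^ k\<bar> \<le> 1" if "0 < z" "z < 1" for z :: real and k
    using that by (simp add: power_le_one)
  have "(\<integral>z. A z * p z + B z * (\<integral>y. p y * indicator {0..z} y \<partial>lborel) \<partial>D)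
      = (\<integral>z. (\<Sum>i\<le>n. a i / real (Suc i) * (A z * (real (Suc i) * z ^ (Suc i - 1)) + B z * z ^ Suc i)) \<partial>D)"
  proof (rule integral_cong_AE)
    show "AE z in D. A z * p z + B z * (\<integral>y. p y * indicator {0..z} y \<partial>lborel)
      = (\<Sum>i\<le>n. a i / real (Suc i) * (A z * (real (Suc i) * z ^ (Suc i - 1)) + B z * z ^ Suc i))"
      using AE_unit
    proof eventually_elim
      case (elim z)
      have "A z * p z + B z * (\<integral>y. p y * indicator {0..z} y \<partial>lborel)
          = (\<Sum>i\<le>n. A z * (a i * z ^ i) + B z * (a i / real (Suc i) * z ^ Suc i))"
        unfolding prim[OF conjunct1[OF elim]] by (simp add: p sum_distrib_left sum.distrib)
      also have "\<dots> = (\<Sum>i\<le>n. a i / real (Suc i) * (A z * (real (Suc i) * z ^ (Suc i - 1)) + B z * z ^ Suc i))"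
        by (intro sum.cong refl) (simp add: field_simps del: of_nat_Suc)
      finally show ?case .
    qed
    show "(\<lambda>z. A z * p z + B z * (\<integral>y. p y * indicator {0..z} y \<partial>lborel)) \<in> borel_measurable D"
    proof -
      have [measurable]: "p \<in> borel_measurable borel" unfolding p by measurable
      have "(\<lambda>z. A z * p z + B z * (\<integral>y. (if 0 \<le> y \<and> y \<le> z then p y else 0) \<partial>lborel)) \<in> borel_measurable borel"
        by measurable
      also have "(\<lambda>z. A z * p z + B z * (\<integral>y. (if 0 \<le> y \<and> y \<le> z then p y else 0) \<partial>lborel))
         = (\<lambda>z. A z * p z + B z * (\<integral>y. p y * indicator {0..z} y \<partial>lborel))"
        by (intro ext arg_cong2[where f = "(+)"] arg_cong2[where f = "(*)"] refl Bochner_Integration.integral_cong)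
          (auto simp: indicator_def)
      finally show ?thesis by simp
    qed
  qed measurable
  also have "\<dots> = (\<Sum>i\<le>n. a i / real (Suc i) * (\<integral>z. A z * (real (Suc i) * z ^ (Suc i - 1)) + B z * z ^ Suc i \<partial>D))"
  proof (subst Bochner_Integration.integral_sum)
    fix i
    have "integrable D (\<lambda>z. A z * (real (Suc i) * z ^ (Suc i - 1)))"
      by (rule integrable_A_mult(1)[where K = "real (Suc i)"]) (auto simp: abs_mult pow mult_le_cancel_left1 intro: power_le_one)
    moreover have "integrable D (\<lambda>z. B z * z ^ Suc i)"
      by (rule integrable_A_mult(2)[where K = 1]) (use pow in \<open>auto simp del: power_Suc\<close>)
    ultimately show "integrable D (\<lambda>z. a i / real (Suc i) * (A z * (real (Suc i) * z ^ (Suc i - 1)) + B z * z ^ Suc i))"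
      by (intro integrable_mult_right Bochner_Integration.integrable_add)
  qed simp
  also have "\<dots> = 0" by (simp only: stein) simp
  finally show ?thesis .
qed

text \<open>Limit of \<open>stein_polynomial\<close> along bounded polynomials tending to the
  indicator of \<open>{..c}\<close>, whose primitive on the unit interval is
  \<open>min z c\<close>.\<close>

lemma stein_indicator:
  assumes c: "0 < c" "c < 1"
  shows "(\<integral>z. A z * indicator {..c} z \<partial>D) = - (\<integral>z. B z * min z c \<partial>D)"
proof -
  obtain p where p: "\<And>n. real_polynomial_function (p n)" "\<And>n y. y \<in> {0..1} \<Longrightarrow> \<bar>p n y\<bar> \<le> 2"
    "\<And>y. y \<in> {0..1} \<Longrightarrow> (\<lambda>n. p n y) \<longlonglongrightarrow> indicator {..c} y"
    using polynomial_approx_indicator[of c] by blast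
  have [measurable]: "p n \<in> borel_measurable borel" for n
    using p(1)[of n] by (auto simp: real_polynomial_function_iff_sum)
  define P where "P n z = (\<integral>y. p n y * indicator {0..z} y \<partial>lborel)" for n z
  have P_meas [measurable]: "P n \<in> borel_measurable borel" for n
  proof -
    have "(\<lambda>z. \<integral>y. (if 0 \<le> y \<and> y \<le> z then p n y else 0) \<partial>lborel) \<in> borel_measurable borel" by measurable
    also have "(\<lambda>z. \<integral>y. (if 0 \<le> y \<and> y \<le> z then p n y else 0) \<partial>lborel) = P n"
      unfolding P_def by (intro ext Bochner_Integration.integral_cong) (auto simp: indicator_def)
    finally show ?thesis .
  qed
  have P_bound: "\<bar>P n z\<bar> \<le> 2" if "0 < z" "z < 1" for n z
  proof -
    have le: "norm (p n y * indicator {0..z} y) \<le> 2 * indicator {0..1} y" for y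
      using p(2)[of y n] that by (auto simp: indicator_def)
    have int: "integrable lborel (\<lambda>y::real. 2 * indicator {0..1} y :: real)"
      by (intro integrable_mult_right integrable_real_indicator) auto
    have "norm (P n z) \<le> (\<integral>y. norm (p n y * indicator {0..z} y) \<partial>lborel)"
      unfolding P_def by (rule integral_norm_bound)
    also have "\<dots> \<le> (\<integral>y. 2 * indicator {0..1::real} y \<partial>lborel)"
      by (rule Bochner_Integration.integral_mono'[OF int]) (use le in auto)
    finally show ?thesis by simp
  qed
  have P_lim: "(\<lambda>n. P n z) \<longlonglongrightarrow> min z c" if "0 < z" "z < 1" for z
  proof -
    have "(\<lambda>n. P n z) \<longlonglongrightarrow> (\<integral>y. indicator {..c} y * indicator {0..z} y \<partial>lborel)"
      unfolding P_def
    proof (rule integral_dominated_convergence[where w = "\<lambda>y. 2 * indicator {0..1} y"])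
      show "AE y in lborel. (\<lambda>n. p n y * indicator {0..z} y) \<longlonglongrightarrow> indicator {..c} y * indicator {0..z} y"
      proof (rule AE_I2)
        fix y show "(\<lambda>n. p n y * indicator {0..z} y) \<longlonglongrightarrow> indicator {..c} y * indicator {0..z} y"
          by (cases "y \<in> {0..z}") (use p(3)[of y] that in auto)
      qed
      show "AE y in lborel. norm (p n y * indicator {0..z} y) \<le> 2 * indicator {0..1} y" for n
        using p(2)[of _ n] that by (intro AE_I2) (auto simp: indicator_def)
    qed auto
    also have "(\<lambda>y. indicator {..c} y * indicator {0..z} y :: real) = indicator {0..min z c}"
      by (auto simp: indicator_def)
    finally show ?thesis using that c by simp
  qed
  have "(\<lambda>n. \<integral>z. A z * p n z + B z * P n z \<partial>D) \<longlonglongrightarrow> (\<integral>z. A z * indicator {..c} z + B z * min z c \<partial>D)"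
  proof (rule integral_dominated_convergence[where w = "\<lambda>z. C * 2 + C * 2"])
    show "AE z in D. (\<lambda>n. A z * p n z + B z * P n z) \<longlonglongrightarrow> A z * indicator {..c} z + B z * min z c"
      using AE_unit by eventually_elim (intro tendsto_intros p(3) P_lim; simp)
    show "AE z in D. norm (A z * p n z + B z * P n z) \<le> C * 2 + C * 2" for n
      using AE_unit
    proof eventually_elim
      case (elim z)
      have "\<bar>A z * p n z\<bar> \<le> C * 2" "\<bar>B z * P n z\<bar> \<le> C * 2"
        unfolding abs_mult using elim A_bound[of z] B_bound[of z] p(2)[of z n] P_bound[of z n] C_nonneg
        by (intro mult_mono; simp)+
      then show ?case by (simp add: abs_triangle_ineq[THEN order_trans])
    qed
  qed auto
  then have "(\<integral>z. A z * indicator {..c} z + B z * min z c \<partial>D) = 0"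
    using stein_polynomial[OF p(1)] LIMSEQ_unique[OF _ tendsto_const[of 0]] by (auto simp: P_def)
  moreover have "integrable D (\<lambda>z. A z * indicator {..c} z)" "integrable D (\<lambda>z. B z * min z c)"
    by (rule integrable_A_mult[where K = 1]; use c in \<open>auto simp: indicator_def\<close>)+
  ultimately show ?thesis by simp
qed


definition prim :: "real \<Rightarrow> real" where "prim c = (\<integral>z. A z * indicator {..c} z \<partial>D)"

definition dens :: "real \<Rightarrow> real" where "dens c = (\<integral>z. B z * indicator {..c} z \<partial>D)"

lemma dens_meas [measurable]: "dens \<in> borel_measurable borel"
proof -
  have "(\<lambda>c. \<integral>z. (if z \<le> c then B z else 0) \<partial>D) \<in> borel_measurable borel" by measurable
  also have "(\<lambda>c. \<integral>z. (if z \<le> c then B z else 0) \<partial>D) = dens"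
    unfolding dens_def by (intro ext Bochner_Integration.integral_cong) (auto simp: indicator_def)
  finally show ?thesis .
qed

lemma prim_diff:
  assumes "0 < a" "a < 1" "0 < c" "c < 1"
  shows "prim c - prim a = - (\<integral>z. B z * (min z c - min z a) \<partial>D)"
proof -
  have "integrable D (\<lambda>z. B z * min z c)" "integrable D (\<lambda>z. B z * min z a)"
    by (rule integrable_A_mult[where K = 1]; use assms in auto)+
  then show ?thesis
    using stein_indicator[OF assms(1,2)] stein_indicator[OF assms(3,4)]
    by (simp add: prim_def right_diff_distrib)
qed

lemma prim_diff_eq:
  assumes "a \<le> c"
  shows "prim c - prim a = (\<integral>z. A z * indicator {a<..c} z \<partial>D)"
proof -
  have "integrable D (\<lambda>z. A z * indicator {..c} z)" "integrable D (\<lambda>z. A z * indicator {..a} z)"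
    by (rule integrable_A_mult[where K = 1]; auto simp: indicator_def)+
  then have "prim c - prim a = (\<integral>z. A z * indicator {..c} z - A z * indicator {..a} z \<partial>D)"
    by (simp add: prim_def)
  also have "\<dots> = (\<integral>z. A z * indicator {a<..c} z \<partial>D)"
    using assms by (intro Bochner_Integration.integral_cong) (auto simp: indicator_def)
  finally show ?thesis .
qed

lemma prim_mono: "a \<le> c \<Longrightarrow> prim a \<le> prim c"
proof -
  assume "a \<le> c"
  have "0 \<le> (\<integral>z. A z * indicator {a<..c} z \<partial>D)"
    using AE_unit by (intro integral_nonneg_AE, eventually_elim) (use A_pos in \<open>auto simp: less_imp_le\<close>)
  then show ?thesis using prim_diff_eq[OF \<open>a \<le> c\<close>] by simp
qed

text \<open>\<open>prim\<close> is Lipschitz with constant \<open>C\<close>, because truncations at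
  levels \<open>d\<close> apart differ by at most \<open>d\<close>. An atom at \<open>c\<close>
  would contribute \<open>A c * prob {c}\<close> to the increment over every interval ending at
  \<open>c\<close>.\<close>

lemma no_atoms:
  assumes c: "0 < c" "c < 1"
  shows "AE z in D. z \<noteq> c"
proof -
  have le: "A c * prob {c} \<le> C * d" if d: "0 < d" "d < c" for d
  proof -
    have int: "integrable D (\<lambda>z. A z * indicator S z)" if "S \<in> sets borel" for S
      by (rule integrable_A_mult(1)[where K = 1]) (use that in \<open>auto simp: indicator_def\<close>)
    have "A c * prob {c} = (\<integral>z. A z * indicator {c} z \<partial>D)"
    proof -
      have "(\<integral>z. A z * indicator {c} z \<partial>D) = (\<integral>z. A c * indicator {c} z \<partial>D)"
        by (intro Bochner_Integration.integral_cong) (auto simp: indicator_def)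
      then show ?thesis by simp
    qed
    also have "\<dots> \<le> (\<integral>z. A z * indicator {c - d<..c} z \<partial>D)"
    proof (rule integral_mono_AE[OF int int])
      show "AE z in D. A z * indicator {c} z \<le> A z * indicator {c - d<..c} z"
        using AE_unit
      proof eventually_elim
        case (elim z)
        then show ?case using A_pos[of z] d by (auto simp: indicator_def)
      qed
    qed auto
    also have "\<dots> = prim c - prim (c - d)" using d by (simp add: prim_diff_eq)
    also have "\<dots> = (\<integral>z. - (B z * (min z c - min z (c - d))) \<partial>D)" using prim_diff[of "c - d" c] d c by simp
    also have "\<dots> \<le> (\<integral>z. C * d \<partial>D)"
    proof (rule integral_mono_AE)
      have "integrable D (\<lambda>z. B z * (min z c - min z (c - d)))"
        by (rule integrable_A_mult(2)[where K = d]) (use d in auto)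
      then show "integrable D (\<lambda>z. - (B z * (min z c - min z (c - d))))" by simp
      show "AE z in D. - (B z * (min z c - min z (c - d))) \<le> C * d"
        using AE_unit
      proof eventually_elim
        case (elim z)
        have "\<bar>B z * (min z c - min z (c - d))\<bar> \<le> C * d"
          unfolding abs_mult using elim B_bound[of z] C_nonneg d by (intro mult_mono) auto
        then show ?case by linarith
      qed
    qed simp
    also have "\<dots> = C * d" using prob_space by simp
    finally show ?thesis .
  qed
  have "A c * prob {c} \<le> 0"
  proof (rule field_le_epsilon)
    fix e :: real assume "0 < e"
    \<comment> \<open>The first bound keeps \<open>c - d\<close> inside the unit interval, the
      second makes \<open>C * d\<close> at most \<open>e\<close> even when \<open>C\<close> is
      0.\<close>
    define d where "d = min (c / 2) (e / (C + 1))"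
    have "0 < d" "d < c" using c \<open>0 < e\<close> C_nonneg by (auto simp: d_def)
    have "C * d \<le> (C + 1) * d" using \<open>0 < d\<close> by (simp add: mult_right_mono)
    also have "\<dots> \<le> (C + 1) * (e / (C + 1))"
      using C_nonneg by (intro mult_left_mono) (auto simp: d_def)
    also have "\<dots> = e" using C_nonneg by simp
    finally show "A c * prob {c} \<le> 0 + e" using le[OF \<open>0 < d\<close> \<open>d < c\<close>] by linarith
  qed
  then have "prob {c} = 0"
    using A_pos[OF c] measure_nonneg[of D "{c}"] by (metis mult_pos_pos not_less order_le_less)
  then show ?thesis by (intro AE_I'[of "{c}"]) (auto simp: null_sets_def emeasure_eq_measure)
qed

lemma integral_B: "(\<integral>z. B z \<partial>D) = 0"
  using stein[of 0] by simp

text \<open>By \<open>stein_indicator\<close>, \<open>prim c\<close> is minus the expectation of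
  \<open>B\<close> times the truncation at \<open>c\<close>. The difference quotients of the
  truncation are bounded by 1 and tend to the indicator of \<open>{c<..}\<close> off the null event
  Z = c; since \<open>B\<close> has mean 0, minus the upper part equals the lower part
  \<open>dens c\<close>.\<close>

lemma prim_deriv:
  assumes c: "0 < c" "c < 1"
  shows "(prim has_real_derivative dens c) (at c)"
proof -
  have "((\<lambda>h. (prim (c + h) - prim c) / h) \<longlongrightarrow> dens c) (at 0 within {- c <..< 1 - c})"
    unfolding tendsto_at_iff_sequentially
  proof (intro allI impI)
    fix X :: "nat \<Rightarrow> real" assume X: "\<forall>i. X i \<in> {- c <..< 1 - c} - {0}" "X \<longlonglongrightarrow> 0"
    have "(\<lambda>i. \<integral>z. B z * ((min z (c + X i) - min z c) / X i) \<partial>D) \<longlonglongrightarrow> (\<integral>z. B z * indicator {c<..} z \<partial>D)"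
    proof (rule integral_dominated_convergence[where w = "\<lambda>z. C * 1"])
      show "AE z in D. (\<lambda>i. B z * ((min z (c + X i) - min z c) / X i)) \<longlonglongrightarrow> B z * indicator {c<..} z"
        using no_atoms[OF c]
      proof eventually_elim
        case (elim z)
        have "\<forall>\<^sub>F i in sequentially. \<bar>X i\<bar> < \<bar>z - c\<bar>"
          using order_tendstoD(2)[OF tendsto_rabs_zero[OF X(2)], of "\<bar>z - c\<bar>"] elim by simp
        then have "\<forall>\<^sub>F i in sequentially. (min z (c + X i) - min z c) / X i = indicator {c<..} z"
        proof eventually_elim
          case (elim i)
          have "X i \<noteq> 0" using X by auto
          then show ?case using elim by (cases "z < c") (auto simp: min_def indicator_def abs_if split: if_splits)
        qed
        then show ?case by (intro tendsto_mult tendsto_const tendsto_eventually)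
      qed
      show "AE z in D. norm (B z * ((min z (c + X i) - min z c) / X i)) \<le> C * 1" for i
        using AE_unit
      proof eventually_elim
        case (elim z)
        have "X i \<noteq> 0" using X by auto
        moreover have "\<bar>min z (c + X i) - min z c\<bar> \<le> \<bar>X i\<bar>" by (auto simp: min_def)
        ultimately have "\<bar>(min z (c + X i) - min z c) / X i\<bar> \<le> 1" by (simp add: abs_divide)
        then show ?case unfolding real_norm_def abs_mult using B_bound[of z] elim C_nonneg
          by (intro mult_mono) auto
      qed
    qed auto
    moreover have "(prim (c + X i) - prim c) / X i = - (\<integral>z. B z * ((min z (c + X i) - min z c) / X i) \<partial>D)" for i
    proof -
      have "0 < c + X i" "c + X i < 1" using X(1)[rule_format, of i] by auto
      then have "prim (c + X i) - prim c = - (\<integral>z. B z * (min z (c + X i) - min z c) \<partial>D)"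
        using prim_diff[OF c] by simp
      then show ?thesis by simp
    qed
    moreover have "- (\<integral>z. B z * indicator {c<..} z \<partial>D) = dens c"
    proof -
      have "integrable D (\<lambda>z. B z * indicator {c<..} z)" "integrable D (\<lambda>z. B z * indicator {..c} z)"
        by (rule integrable_A_mult[where K = 1]; auto simp: indicator_def)+
      then have "dens c + (\<integral>z. B z * indicator {c<..} z \<partial>D) = (\<integral>z. B z * indicator {..c} z + B z * indicator {c<..} z \<partial>D)"
        by (simp add: dens_def)
      also have "\<dots> = (\<integral>z. B z \<partial>D)"
        by (intro Bochner_Integration.integral_cong) (auto simp: indicator_def)
      finally show ?thesis using integral_B by simp
    qed
    ultimately show "((\<lambda>h. (prim (c + h) - prim c) / h) \<circ> X) \<longlonglongrightarrow> dens c"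
      using tendsto_minus by (fastforce simp: comp_def)
  qed
  moreover have "at 0 within {- c <..< 1 - c} = at 0"
    by (rule at_within_open) (use c in auto)
  ultimately show ?thesis by (simp add: DERIV_def)
qed

lemma dens_cont: "continuous_on {0<..<1} dens"
  unfolding continuous_on_sequentially
proof (intro allI ballI impI)
  fix X :: "nat \<Rightarrow> real" and c assume c: "c \<in> {0<..<1}" and X: "(\<forall>n. X n \<in> {0<..<1}) \<and> X \<longlonglongrightarrow> c"
  show "(dens \<circ> X) \<longlonglongrightarrow> dens c"
    unfolding comp_def dens_def
  proof (rule integral_dominated_convergence[where w = "\<lambda>z. C"])
    show "AE z in D. (\<lambda>i. B z * indicator {..X i} z) \<longlonglongrightarrow> B z * indicator {..c} z"
    proof -
      have "AE z in D. z \<noteq> c" using no_atoms[of c] c by simp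
      then show ?thesis
    proof eventually_elim
      case (elim z)
      have "\<forall>\<^sub>F i in sequentially. indicator {..X i} z = (indicator {..c} z :: real)"
      proof (cases "z < c")
        case True
        then have "\<forall>\<^sub>F i in sequentially. z < X i" using X order_tendstoD(1) by blast
        then show ?thesis by eventually_elim (use True in auto)
      next
        case False
        then have "\<forall>\<^sub>F i in sequentially. X i < z" using X elim order_tendstoD(2) by (metis linorder_neqE)
        then show ?thesis by eventually_elim (use False elim in auto)
      qed
      then show ?case by (intro tendsto_mult tendsto_const tendsto_eventually)
    qed
    qed
    show "AE z in D. norm (B z * indicator {..X i} z) \<le> C" for i
      using AE_unit by eventually_elim (use B_bound C_nonneg in \<open>auto simp: indicator_def\<close>)
  qed auto
qed

lemma dens_nonneg:
  assumes c: "0 < c" "c < 1" shows "0 \<le> dens c"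
proof (rule ccontr)
  assume "\<not> 0 \<le> dens c"
  then obtain d where "0 < d" "\<And>h. 0 < h \<Longrightarrow> h < d \<Longrightarrow> prim (c + h) < prim c"
    using DERIV_neg_dec_right[OF prim_deriv[OF c]] by auto
  then have "prim (c + d / 2) < prim c" by auto
  then show False using prim_mono[of c "c + d / 2"] \<open>0 < d\<close> by simp
qed

end

text \<open>The measures are compared only on intervals with both ends inside the open set
  \<open>J\<close>, as derivatives are known only there. Exhausting \<open>J\<close> from within
  recovers all rays.\<close>

lemma measure_eqI_Ioc_on:
  fixes M N :: "real measure" and a c :: "nat \<Rightarrow> real"
  assumes sets: "sets M = sets borel" "sets N = sets borel" and "finite_measure M"
    and null: "emeasure M (- J) = 0" "emeasure N (- J) = 0"
    and J: "J = (\<Union>n. {a n<..c n})" "decseq a" "incseq c" "\<And>n. a n \<le> c n" "\<And>n. {a n..c n} \<subseteq> J"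
    and eq: "\<And>x y. x \<in> J \<Longrightarrow> y \<in> J \<Longrightarrow> x \<le> y \<Longrightarrow> emeasure M {x<..y} = emeasure N {x<..y}"
  shows "M = N"
proof (rule measure_eqI_lessThan[OF sets])
  interpret finite_measure M by fact
  show "emeasure M {x<..} < \<infinity>" for x by (simp add: less_top[symmetric])
  show "emeasure M {x<..} = emeasure N {x<..}" for x
  proof -
    have *: "emeasure Q {x<..} = (SUP n. emeasure Q {max x (a n)<..c n})"
      if Q: "sets Q = sets borel" "emeasure Q (- J) = 0" for Q
    proof -
      have J_meas: "J \<in> sets Q" unfolding J(1) using Q(1) by auto
      have "emeasure Q {x<..} = emeasure Q ({x<..} \<inter> J)"
      proof (rule emeasure_eq_AE)
        have "- J \<in> null_sets Q" using Q J_meas sets.compl_sets[OF J_meas] sets_eq_imp_space_eq[OF Q(1)]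
          by (auto simp: null_sets_def Compl_eq_Diff_UNIV)
        then have "AE z in Q. z \<notin> - J" by (rule AE_not_in)
        then show "AE z in Q. (z \<in> {x<..}) = (z \<in> {x<..} \<inter> J)" by eventually_elim auto
        show "{x<..} \<in> sets Q" "{x<..} \<inter> J \<in> sets Q" using J_meas unfolding Q(1) by auto
      qed
      also have "{x<..} \<inter> J = (\<Union>n. {max x (a n)<..c n})" unfolding J(1) by auto
      also have "emeasure Q \<dots> = (SUP n. emeasure Q {max x (a n)<..c n})"
      proof (rule SUP_emeasure_incseq[symmetric])
        show "incseq (\<lambda>n. {max x (a n)<..c n})"
        proof (rule incseq_SucI)
          fix n show "{max x (a n)<..c n} \<subseteq> {max x (a (Suc n))<..c (Suc n)}"
            using decseq_SucD[OF J(2), of n] incseq_SucD[OF J(3), of n] by auto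
        qed
        show "range (\<lambda>n. {max x (a n)<..c n}) \<subseteq> sets Q" unfolding Q(1) by (simp add: image_subset_iff)
      qed
      finally show ?thesis .
    qed
    have "emeasure M {max x (a n)<..c n} = emeasure N {max x (a n)<..c n}" for n
    proof (cases "max x (a n) \<le> c n")
      case True
      then have "max x (a n) \<in> J" "c n \<in> J" using J(4,5)[of n] by auto
      then show ?thesis using eq True by blast
    next
      case False
      then have "{max x (a n)<..c n} = {}" by (intro greaterThanAtMost_empty) linarith
      then show ?thesis by (simp only: emeasure_empty)
    qed
    then show ?thesis using *[OF sets(1) null(1)] *[OF sets(2) null(2)] by simp
  qed
qed

context stein_law
begin

text \<open>\<open>A\<close> times the law has distribution function \<open>prim\<close>, whose
  derivative is \<open>dens\<close>; the fundamental theorem of calculus identifies it with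
  \<open>dens\<close> times Lebesgue measure, and positivity of \<open>A\<close> allows
  division.\<close>

lemma law_eq_dens: "D = density lborel (\<lambda>z. ennreal (dens z / A z * indicator {0<..<1} z))"
proof -
  let ?J = "{0<..<1::real}"
  have [simp]: "space D = UNIV" using sets_eq_imp_space_eq[OF sets_D] by simp
  define M1 where "M1 = density D (\<lambda>z. ennreal (A z * indicator ?J z))"
  define N1 where "N1 = density lborel (\<lambda>z. ennreal (dens z * indicator ?J z))"
  have [measurable]: "(\<lambda>z. A z * indicator S z) \<in> borel_measurable borel" if "S \<in> sets borel" for S
    using that by measurable
  have int: "integrable D (\<lambda>z. A z * indicator S z)" if "S \<in> sets borel" for S
    by (rule integrable_A_mult(1)[where K = 1]) (use that in \<open>auto simp: indicator_def\<close>)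
  have eq: "emeasure M1 {x<..y} = emeasure N1 {x<..y}" if xy: "x \<in> ?J" "y \<in> ?J" "x \<le> y" for x y
  proof -
    have "emeasure M1 {x<..y} = (\<integral>\<^sup>+z. ennreal (A z * indicator ?J z) * indicator {x<..y} z \<partial>D)"
      unfolding M1_def by (rule emeasure_density) auto
    also have "\<dots> = (\<integral>\<^sup>+z. ennreal (A z * indicator {x<..y} z) \<partial>D)"
      using xy by (intro nn_integral_cong) (auto simp: indicator_def)
    also have "\<dots> = ennreal (\<integral>z. A z * indicator {x<..y} z \<partial>D)"
      by (rule nn_integral_eq_integral[OF int])
        (use xy A_pos in \<open>auto simp: indicator_def less_imp_le intro!: AE_I2\<close>)
    also have "\<dots> = ennreal (prim y - prim x)" using xy by (simp add: prim_diff_eq)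
    also have "\<dots> = (\<integral>\<^sup>+z. ennreal (dens z * indicator ?J z) * indicator {x..y} z \<partial>lborel)"
    proof (rule nn_integral_FTC_Icc[symmetric])
      fix z assume z: "z \<in> {x..y}"
      then have z01: "0 < z" "z < 1" using xy by auto
      then show "0 \<le> dens z * indicator ?J z" using dens_nonneg by auto
      show "(prim has_real_derivative dens z * indicator ?J z) (at z)"
        using prim_deriv[OF z01] z01 by simp
    qed (use xy in auto)
    also have "\<dots> = (\<integral>\<^sup>+z. ennreal (dens z * indicator ?J z) * indicator {x<..y} z \<partial>lborel)"
    proof (rule nn_integral_cong_AE)
      show "AE z in lborel. ennreal (dens z * indicator ?J z) * indicator {x..y} z
          = ennreal (dens z * indicator ?J z) * indicator {x<..y} z"
        using AE_lborel_singleton[of x] by eventually_elim (auto simp: indicator_def)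
    qed
    also have "\<dots> = emeasure N1 {x<..y}"
      unfolding N1_def by (rule emeasure_density[symmetric]) auto
    finally show ?thesis .
  qed
  have "M1 = N1"
  \<comment> \<open>With \<open>n + 2\<close> the two ends are in the right order already for n = 0,
    where both are 1/2.\<close>
  proof (rule measure_eqI_Ioc_on[where J = ?J and a = "\<lambda>n. 1 / real (n + 2)" and c = "\<lambda>n. 1 - 1 / real (n + 2)"])
    show "finite_measure M1"
    proof (rule finite_measureI)
      have "emeasure M1 (space M1) = (\<integral>\<^sup>+z. ennreal (A z * indicator ?J z) * indicator (space D) z \<partial>D)"
        unfolding M1_def space_density by (rule emeasure_density) auto
      also have "\<dots> = (\<integral>\<^sup>+z. ennreal (A z * indicator ?J z) \<partial>D)"
        by (intro nn_integral_cong) simp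
      also have "\<dots> = ennreal (\<integral>z. A z * indicator ?J z \<partial>D)"
        by (rule nn_integral_eq_integral[OF int]) (use A_pos in \<open>auto simp: indicator_def less_imp_le\<close>)
      finally show "emeasure M1 (space M1) \<noteq> \<infinity>" by simp
    qed
    show "emeasure M1 (- ?J) = 0" "emeasure N1 (- ?J) = 0"
      unfolding M1_def N1_def by (subst emeasure_density; auto intro!: nn_integral_zero' AE_I2 simp: indicator_def)+
    have cover: "\<exists>n. z \<in> {1 / real (n + 2)<..1 - 1 / real (n + 2)}" if "0 < z" "z < 1" for z :: real
    proof -
      have "0 < min z (1 - z)" using that by simp
      then obtain n where n: "inverse (real (Suc n)) < min z (1 - z)"
        using reals_Archimedean by blast
      have "1 / real (n + 2) \<le> inverse (real (Suc n))" by (simp add: field_simps)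
      then show ?thesis using n by (intro exI[of _ n]) auto
    qed
    have "z \<in> ?J" if "z \<in> {1 / real (n + 2)<..1 - 1 / real (n + 2)}" for z n
    proof -
      have "0 < 1 / real (n + 2)" by simp
      with that show ?thesis unfolding greaterThanAtMost_iff greaterThanLessThan_iff by linarith
    qed
    moreover have "\<exists>n. z \<in> {1 / real (n + 2)<..1 - 1 / real (n + 2)}" if "z \<in> ?J" for z
      using cover[of z] that by simp
    ultimately show "?J = (\<Union>n. {1 / real (n + 2)<..1 - 1 / real (n + 2)})" by blast
    show "1 / real (n + 2) \<le> 1 - 1 / real (n + 2)" for n by (simp add: field_simps)
    show "{1 / real (n + 2)..1 - 1 / real (n + 2)} \<subseteq> ?J" for n
    proof
      fix z assume "z \<in> {1 / real (n + 2)..1 - 1 / real (n + 2)}"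
      moreover have "0 < 1 / real (n + 2)" by simp
      ultimately show "z \<in> ?J" unfolding atLeastAtMost_iff greaterThanLessThan_iff by linarith
    qed
    show "decseq (\<lambda>n. 1 / real (n + 2))" by (rule decseq_SucI) (simp add: field_simps)
    show "incseq (\<lambda>n. 1 - 1 / real (n + 2))" by (rule incseq_SucI) (simp add: field_simps)
  qed (use eq in \<open>auto simp: M1_def N1_def\<close>)
  have "D = density D (\<lambda>z. 1)" by (simp add: density_1)
  also have "\<dots> = density D (\<lambda>z. ennreal (A z * indicator ?J z) * ennreal (1 / A z))"
  proof (rule density_cong)
    show "AE z in D. 1 = ennreal (A z * indicator ?J z) * ennreal (1 / A z)"
      using AE_unit
    proof eventually_elim
      case (elim z)
      then have "0 < A z" using A_pos by auto
      then show ?case using elim by (simp add: ennreal_mult[symmetric])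
    qed
  qed auto
  also have "\<dots> = density M1 (\<lambda>z. ennreal (1 / A z))"
    unfolding M1_def by (rule density_density_eq[symmetric]) auto
  also have "\<dots> = density N1 (\<lambda>z. ennreal (1 / A z))" using \<open>M1 = N1\<close> by simp
  also have "\<dots> = density lborel (\<lambda>z. ennreal (dens z * indicator ?J z) * ennreal (1 / A z))"
    unfolding N1_def by (rule density_density_eq) auto
  also have "\<dots> = density lborel (\<lambda>z. ennreal (dens z / A z * indicator {0<..<1} z))"
  proof (rule density_cong)
    show "AE z in lborel. ennreal (dens z * indicator ?J z) * ennreal (1 / A z) = ennreal (dens z / A z * indicator {0<..<1} z)"
      using A_pos dens_nonneg by (intro AE_I2) (auto simp: indicator_def ennreal_mult[symmetric] less_imp_le)
  qed auto
  finally show ?thesis .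
qed

text \<open>Bootstrapping: the law now has the density \<open>dens / A\<close>, and inserting it
  into the definition of \<open>dens\<close> shows \<open>dens\<close> to be an integral of the
  continuous function \<open>B / A * dens\<close>.\<close>

lemma dens_deriv:
  assumes y: "0 < y" "y < 1"
  shows "(dens has_real_derivative B y / A y * dens y) (at y)"
proof -
  let ?f = "\<lambda>z. B z / A z * dens z"
  have contf: "continuous_on {0<..<1} ?f"
    using A_pos by (intro continuous_intros A_cont B_cont dens_cont) force
  have diff: "dens v - dens u = (\<integral>z. ?f z * indicator {u..v} z \<partial>lborel)" if uv: "0 < u" "u \<le> v" "v < 1" for u v
  proof -
    have "integrable D (\<lambda>z. B z * indicator {..v} z)" "integrable D (\<lambda>z. B z * indicator {..u} z)"
      by (rule integrable_A_mult[where K = 1]; auto simp: indicator_def)+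
    then have "dens v - dens u = (\<integral>z. B z * indicator {..v} z - B z * indicator {..u} z \<partial>D)"
      by (simp add: dens_def)
    also have "\<dots> = (\<integral>z. B z * indicator {u<..v} z \<partial>D)"
      using uv by (intro Bochner_Integration.integral_cong) (auto simp: indicator_def)
    also have "\<dots> = (\<integral>z. B z * indicator {u<..v} z \<partial>density lborel (\<lambda>z. ennreal (dens z / A z * indicator {0<..<1} z)))"
      using law_eq_dens by simp
    also have "\<dots> = (\<integral>z. (dens z / A z * indicator {0<..<1} z) *\<^sub>R (B z * indicator {u<..v} z) \<partial>lborel)"
      using A_pos dens_nonneg by (intro integral_density) (auto simp: indicator_def less_imp_le intro!: AE_I2)
    also have "\<dots> = (\<integral>z. ?f z * indicator {u..v} z \<partial>lborel)"
    proof (rule integral_cong_AE)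
      show "AE z in lborel. (dens z / A z * indicator {0<..<1} z) *\<^sub>R (B z * indicator {u<..v} z) = ?f z * indicator {u..v} z"
        using AE_lborel_singleton[of u] by eventually_elim (use uv in \<open>auto simp: indicator_def\<close>)
    qed auto
    finally show ?thesis .
  qed
  \<comment> \<open>The integrand is known to be continuous only on the open interval, so an
    antiderivative in the interior replaces an integral starting at 0.\<close>
  obtain F where F: "\<And>z. 0 < z \<Longrightarrow> z < 1 \<Longrightarrow> (F has_vector_derivative ?f z) (at z)"
  proof -
    have "\<exists>F. \<forall>z. ereal 0 < z \<longrightarrow> z < ereal 1 \<longrightarrow> (F has_vector_derivative ?f z) (at z)"
    proof (rule einterval_antiderivative)
      show "isCont ?f z" if "ereal 0 < ereal z" "ereal z < ereal 1" for z
        using contf that by (auto simp: continuous_on_eq_continuous_at)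
    qed simp
    then show ?thesis using that by auto
  qed
  have F': "(F has_real_derivative ?f z) (at z)" if "0 < z" "z < 1" for z
    using F[OF that] by (simp add: has_real_derivative_iff_has_vector_derivative)
  have const: "dens v - dens u = F v - F u" if uv: "0 < u" "u \<le> v" "v < 1" for u v
  proof -
    have "(\<integral>z. ?f z * indicator {u..v} z \<partial>lborel) = F v - F u"
    proof (rule integral_FTC_Icc_real)
      show "u \<le> v" by fact
      show "isCont ?f z" if "u \<le> z" "z \<le> v" for z
        using contf that uv by (auto simp: continuous_on_eq_continuous_at)
    qed (use F' uv in auto)
    then show ?thesis using diff[OF uv] by simp
  qed
  have "dens z = F z + (dens (1/2) - F (1/2))" if "z \<in> {0<..<1}" for z
    using const[of "1/2" z] const[of z "1/2"] that by (cases "z \<le> 1/2") auto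
  moreover have "((\<lambda>z. F z + (dens (1/2) - F (1/2))) has_real_derivative ?f y) (at y)"
    using F'[OF y] by (auto intro!: derivative_eq_intros)
  ultimately show ?thesis
    using has_field_derivative_transform_within_open[of _ "?f y" y "{0<..<1}" dens] y
    by (metis greaterThanLessThan_iff open_greaterThanLessThan)
qed

text \<open>\<open>dens\<close> and \<open>G\<close> solve the same linear differential equation, so
  their quotient is constant; the constant is not 0 because the total mass is 1.\<close>

theorem law_eq:
  assumes G: "\<And>z. 0 < z \<Longrightarrow> z < 1 \<Longrightarrow> 0 < G z"
    and G': "\<And>z. 0 < z \<Longrightarrow> z < 1 \<Longrightarrow> (G has_real_derivative B z / A z * G z) (at z)"
  shows "\<exists>\<kappa>>0. D = density lborel (\<lambda>z. ennreal (\<kappa> * (G z / A z) * indicator {0<..<1} z))"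
proof -
  have "\<exists>\<kappa>. \<forall>z\<in>{0<..<1::real}. dens z / G z = \<kappa>"
  proof (rule has_field_derivative_zero_constant)
    fix z assume z: "z \<in> {0<..<1::real}"
    then have z01: "0 < z" "z < 1" by auto
    have "((\<lambda>z. dens z / G z) has_real_derivative
        (B z / A z * dens z * G z - dens z * (B z / A z * G z)) / (G z * G z)) (at z)"
      using G[OF z01] by (intro DERIV_divide dens_deriv G' z01) auto
    then show "((\<lambda>z. dens z / G z) has_real_derivative 0) (at z within {0<..<1})"
      by (simp add: mult_ac has_field_derivative_at_within)
  qed simp
  then obtain \<kappa> where quot: "\<forall>z\<in>{0<..<1::real}. dens z / G z = \<kappa>" by blast
  have \<kappa>: "dens z = \<kappa> * G z" if "0 < z" "z < 1" for z
  proof -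
    have "dens z / G z = \<kappa>" using quot that by simp
    then show ?thesis using G[OF that] by (simp add: divide_eq_eq)
  qed
  have D: "D = density lborel (\<lambda>z. ennreal (\<kappa> * (G z / A z) * indicator {0<..<1} z))"
    by (subst law_eq_dens, rule arg_cong[where f = "density lborel"]) (use \<kappa> in \<open>auto simp: indicator_def fun_eq_iff\<close>)
  have "0 \<le> \<kappa>" using \<kappa>[of "1/2"] dens_nonneg[of "1/2"] G[of "1/2"] by (simp add: zero_le_mult_iff)
  moreover have "\<kappa> \<noteq> 0"
  proof
    assume "\<kappa> = 0"
    then have null: "D = density lborel (\<lambda>z. 0)" using D by simp
    have "emeasure D UNIV = 0" by (subst null) (simp add: emeasure_density)
    moreover have "space D = UNIV" using sets_eq_imp_space_eq[OF sets_D] by simp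
    ultimately show False using emeasure_space_1 by simp
  qed
  ultimately show ?thesis using D by (intro exI[of _ \<kappa>]) auto
qed

end

section \<open>Moment sequences along an edge\<close>

definition range_set :: "real \<Rightarrow> real set" where
  "range_set \<epsilon> = {x. 0 < x \<and> 0 < 1 + \<epsilon> * x}"

definition phi :: "real \<Rightarrow> real \<Rightarrow> real \<Rightarrow> real" where
  "phi \<epsilon> q x = (1 + \<epsilon> * x) / (1 + \<epsilon> * q * x)"

definition admissible_weight :: "real \<Rightarrow> real \<Rightarrow> bool" where
  "admissible_weight \<epsilon> q \<longleftrightarrow> \<epsilon> = -1 \<and> q < 1 \<or> \<epsilon> = 1 \<and> 0 \<le> q \<and> q \<noteq> 1"

text \<open>
  For \<open>\<epsilon> = 1\<close> the variables are unbounded; after tilting by \<open>(1 + x) ^ (-m)\<close> the moments of total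
  degree at most \<open>m\<close> exist. For \<open>\<epsilon> = -1\<close> all moments exist and only \<open>m = 0\<close> is needed.
\<close>

definition admissible_degree :: "real \<Rightarrow> nat \<Rightarrow> nat \<Rightarrow> bool" where
  "admissible_degree \<epsilon> m n \<longleftrightarrow> \<epsilon> = -1 \<and> m = 0 \<or> \<epsilon> = 1 \<and> n \<le> m"

lemma admissible_degree_mono: "admissible_degree \<epsilon> m n \<Longrightarrow> n' \<le> n \<Longrightarrow> admissible_degree \<epsilon> m n'"
  by (auto simp: admissible_degree_def)

lemma admissible_weightD: "admissible_weight \<epsilon> q \<Longrightarrow> \<epsilon> * \<epsilon> = 1" "admissible_weight \<epsilon> q \<Longrightarrow> q \<noteq> 1"
  by (auto simp: admissible_weight_def)

context
  fixes \<epsilon> q x :: real assumes q: "admissible_weight \<epsilon> q" and x: "x \<in> range_set \<epsilon>"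
begin

lemma weight_denominator_pos: "0 < 1 + \<epsilon> * q * x"
proof -
  consider "\<epsilon> = -1" "q < 1" | "\<epsilon> = 1" "0 \<le> q" using q by (auto simp: admissible_weight_def)
  then show ?thesis
  proof cases
    case 1
    then have "q * x < 1 * x" "x < 1" using x by (auto simp: range_set_def)
    then show ?thesis using 1 by simp
  next
    case 2
    then show ?thesis using x by (auto simp: range_set_def add_pos_nonneg)
  qed
qed

lemma phi_pos: "0 < phi \<epsilon> q x"
  using weight_denominator_pos x by (simp add: phi_def range_set_def)

lemma phi_relation: "1 + \<epsilon> * x - phi \<epsilon> q x - \<epsilon> * q * (x * phi \<epsilon> q x) = 0"
  using weight_denominator_pos by (simp add: phi_def field_simps)

lemma moment_integrand_pos: "0 < x ^ t * phi \<epsilon> q x ^ s / (1 + \<epsilon> * x) ^ m"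
  using phi_pos x by (simp add: range_set_def)

text \<open>For \<epsilon> = -1 both x and \<phi>(x) are at most 1. For \<epsilon> = 1 both are at
  most 1 + x, so the tilt absorbs any total degree up to \<open>m\<close>.\<close>

lemma moment_integrand_le_1:
  assumes "admissible_degree \<epsilon> m (t + s)"
  shows "x ^ t * phi \<epsilon> q x ^ s / (1 + \<epsilon> * x) ^ m \<le> 1"
proof -
  consider "\<epsilon> = -1" "q < 1" "m = 0" | "\<epsilon> = 1" "0 \<le> q" "t + s \<le> m"
    using q assms by (auto simp: admissible_weight_def admissible_degree_def)
  then show ?thesis
  proof cases
    case 1
    have x01: "0 < x" "x < 1" using x 1 by (auto simp: range_set_def)
    have "q * x \<le> 1 * x" using 1 x01 by (intro mult_right_mono) auto
    then have "phi \<epsilon> q x \<le> 1" using weight_denominator_pos 1 by (simp add: phi_def)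
    then show ?thesis using 1 x01 phi_pos by (simp add: mult_le_one power_le_one)
  next
    case 2
    have x0: "0 < x" using x by (auto simp: range_set_def)
    then have "(1 + x) / (1 + q * x) \<le> (1 + x) / 1" using 2 by (intro divide_left_mono) (auto simp: add_pos_nonneg)
    then have "phi \<epsilon> q x \<le> 1 + x" using 2 by (simp add: phi_def)
    then have "x ^ t * phi \<epsilon> q x ^ s \<le> (1 + x) ^ t * (1 + x) ^ s"
      using x0 phi_pos by (intro mult_mono power_mono) auto
    also have "\<dots> \<le> (1 + x) ^ m" unfolding power_add[symmetric] using 2 x0 by (intro power_increasing) auto
    finally show ?thesis using 2 x0 by simp
  qed
qed

end

text \<open>
  \<open>A0\<close>, \<open>A1\<close>, \<open>A2\<close> are instances of the relation between \<open>x\<close> and \<open>phi \<epsilon> q x\<close>, and \<open>C0\<close> to \<open>C3\<close> of the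
  contiguous relation below: the overdetermined system forces the increments to agree.
\<close>

lemma slope_identity:
  fixes \<epsilon> q :: real
  assumes e: "\<epsilon> * \<epsilon> = 1"
    and A0: "F + \<epsilon> * F1 - F2 - \<epsilon> * q * F12 = 0"
    and A1: "F1 + \<epsilon> * F11 - F12 - \<epsilon> * q * F112 = 0"
    and A2: "F2 + \<epsilon> * F12 - F22 - \<epsilon> * q * F122 = 0"
    and C0: "(x - y) * F + \<epsilon> * x * F1 - (1 - y) * F2 = 0"
    and C1: "(x' - y) * F1 + \<epsilon> * x' * F11 - (1 - y) * F12 = 0"
    and C2: "(x - y') * F2 + \<epsilon> * x * F12 - (1 - y') * F22 = 0"
    and C3: "(x' - y') * F12 + \<epsilon> * x' * F112 - (1 - y') * F122 = 0"
    and nz: "q \<noteq> 1" "F12 \<noteq> 0"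
  shows "x' - x = y' - y"
proof -
  \<comment> \<open>\<open>E1\<close> has lost \<open>F11\<close>, \<open>D2\<close> has lost
    \<open>F22\<close> and \<open>K\<close> has lost \<open>F\<close>. Inserting \<open>E1\<close>
    and \<open>D2\<close> into \<open>C3\<close> leaves \<open>F1\<close> and \<open>F2\<close>
    exactly in the combination of \<open>K\<close>, so that a multiple of \<open>F12\<close> alone
    remains.\<close>
  have E1: "\<epsilon> * q * x' * F112 = y * F1 + (1 - x' - y) * F12" using A1 C1 by algebra
  have D2: "\<epsilon> * q * (1 - y') * F122 = (1 - x) * F2 + \<epsilon> * (1 - x - y') * F12" using A2 C2 by algebra
  have K: "\<epsilon> * y * F1 - (1 - x) * F2 = \<epsilon> * q * (y - x) * F12" using A0 C0 by algebra
  have "(q - 1) * ((x' - x) - (y' - y)) * F12 = 0" using E1 D2 K C3 e by algebra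
  then show ?thesis using nz by simp
qed

locale range_rv = prob_space M for M :: "'a measure" +
  fixes \<epsilon> q :: real and X :: "'a \<Rightarrow> real"
  assumes q: "admissible_weight \<epsilon> q" and X_meas [measurable]: "X \<in> borel_measurable M"
    and X_range: "\<And>\<omega>. \<omega> \<in> space M \<Longrightarrow> X \<omega> \<in> range_set \<epsilon>"
begin

definition moment :: "nat \<Rightarrow> nat \<Rightarrow> nat \<Rightarrow> real" where
  "moment m t s = (\<integral>\<omega>. X \<omega> ^ t * phi \<epsilon> q (X \<omega>) ^ s / (1 + \<epsilon> * X \<omega>) ^ m \<partial>M)"

lemma phi_meas [measurable]: "phi \<epsilon> q \<in> borel_measurable borel"
  unfolding phi_def by measurable

lemma eps_sq: "\<epsilon> * \<epsilon> = 1"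
  using admissible_weightD(1)[OF q] .

lemma integrable_moment:
  assumes "admissible_degree \<epsilon> m (t + s)"
  shows "integrable M (\<lambda>\<omega>. X \<omega> ^ t * phi \<epsilon> q (X \<omega>) ^ s / (1 + \<epsilon> * X \<omega>) ^ m)"
proof (rule integrable_const_bound[where B = 1])
  show "AE \<omega> in M. norm (X \<omega> ^ t * phi \<epsilon> q (X \<omega>) ^ s / (1 + \<epsilon> * X \<omega>) ^ m) \<le> 1"
  proof (rule AE_I2)
    fix \<omega> assume "\<omega> \<in> space M"
    then show "norm (X \<omega> ^ t * phi \<epsilon> q (X \<omega>) ^ s / (1 + \<epsilon> * X \<omega>) ^ m) \<le> 1"
      using moment_integrand_le_1[OF q X_range assms, of \<omega>] moment_integrand_pos[OF q X_range, of \<omega> t s m]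
      by (simp only: real_norm_def abs_of_pos)
  qed
qed measurable

lemma integral_pos:
  fixes f :: "'a \<Rightarrow> real"
  assumes "integrable M f" "\<And>\<omega>. \<omega> \<in> space M \<Longrightarrow> 0 < f \<omega>"
  shows "0 < (\<integral>\<omega>. f \<omega> \<partial>M)"
proof -
  have "0 \<le> (\<integral>\<omega>. f \<omega> \<partial>M)" using assms(2) by (intro integral_nonneg_AE AE_I2) (simp add: less_imp_le)
  moreover have "(\<integral>\<omega>. f \<omega> \<partial>M) \<noteq> 0"
  proof
    assume "(\<integral>\<omega>. f \<omega> \<partial>M) = 0"
    then have "AE \<omega> in M. f \<omega> = 0"
      using integral_nonneg_eq_0_iff_AE[OF assms(1)] assms(2) by (simp add: less_imp_le AE_I2)
    then have "AE \<omega> in M. False" using AE_space by eventually_elim (use assms(2) in force)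
    then show False by simp
  qed
  ultimately show ?thesis by simp
qed

lemma moment_pos: "admissible_degree \<epsilon> m (t + s) \<Longrightarrow> 0 < moment m t s"
  unfolding moment_def using moment_integrand_pos[OF q X_range]
  by (intro integral_pos integrable_moment) auto

lemma moment_linear:
  assumes "admissible_degree \<epsilon> m (t + s + 1)"
  shows "\<alpha> * moment m t s + \<beta> * moment m (Suc t) s + \<gamma> * moment m t (Suc s)
    = (\<integral>\<omega>. X \<omega> ^ t * phi \<epsilon> q (X \<omega>) ^ s / (1 + \<epsilon> * X \<omega>) ^ m * (\<alpha> + \<beta> * X \<omega> + \<gamma> * phi \<epsilon> q (X \<omega>)) \<partial>M)"
proof -
  define f where "f = (\<lambda>t s \<omega>. X \<omega> ^ t * phi \<epsilon> q (X \<omega>) ^ s / (1 + \<epsilon> * X \<omega>) ^ m)"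
  have int: "integrable M (f t s)" "integrable M (f (Suc t) s)" "integrable M (f t (Suc s))"
    unfolding f_def by (rule integrable_moment, rule admissible_degree_mono[OF assms], simp)+
  have mom: "moment m t s = (\<integral>\<omega>. f t s \<omega> \<partial>M)" for t s by (simp add: moment_def f_def)
  have "(\<integral>\<omega>. f t s \<omega> * (\<alpha> + \<beta> * X \<omega> + \<gamma> * phi \<epsilon> q (X \<omega>)) \<partial>M)
      = (\<integral>\<omega>. \<alpha> * f t s \<omega> + \<beta> * f (Suc t) s \<omega> + \<gamma> * f t (Suc s) \<omega> \<partial>M)"
    by (intro Bochner_Integration.integral_cong) (simp_all add: f_def algebra_simps add_divide_distrib)
  also have "\<dots> = \<alpha> * moment m t s + \<beta> * moment m (Suc t) s + \<gamma> * moment m t (Suc s)"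
    using int unfolding mom by simp
  finally show ?thesis by (simp add: f_def)
qed

lemma moment_relation:
  assumes "admissible_degree \<epsilon> m (t + s + 2)"
  shows "moment m t s + \<epsilon> * moment m (Suc t) s - moment m t (Suc s) - \<epsilon> * q * moment m (Suc t) (Suc s) = 0"
proof -
  define f where "f = (\<lambda>t s \<omega>. X \<omega> ^ t * phi \<epsilon> q (X \<omega>) ^ s / (1 + \<epsilon> * X \<omega>) ^ m)"
  have mom: "moment m t s = (\<integral>\<omega>. f t s \<omega> \<partial>M)" for t s by (simp add: moment_def f_def)
  have int: "integrable M (f t s)" "integrable M (f (Suc t) s)" "integrable M (f t (Suc s))"
    "integrable M (f (Suc t) (Suc s))"
    unfolding f_def by (rule integrable_moment, rule admissible_degree_mono[OF assms], simp)+
  have "moment m t s + \<epsilon> * moment m (Suc t) s - moment m t (Suc s) - \<epsilon> * q * moment m (Suc t) (Suc s)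
      = (\<integral>\<omega>. f t s \<omega> + \<epsilon> * f (Suc t) s \<omega> - f t (Suc s) \<omega> - \<epsilon> * q * f (Suc t) (Suc s) \<omega> \<partial>M)"
    using int unfolding mom by simp
  also have "\<dots> = (\<integral>\<omega>. 0 \<partial>M)"
  proof (intro Bochner_Integration.integral_cong refl)
    fix \<omega> assume "\<omega> \<in> space M"
    have "f t s \<omega> + \<epsilon> * f (Suc t) s \<omega> - f t (Suc s) \<omega> - \<epsilon> * q * f (Suc t) (Suc s) \<omega>
      = f t s \<omega> * (1 + \<epsilon> * X \<omega> - phi \<epsilon> q (X \<omega>) - \<epsilon> * q * (X \<omega> * phi \<epsilon> q (X \<omega>)))"
      by (simp add: f_def algebra_simps add_divide_distrib diff_divide_distrib)
    then show "f t s \<omega> + \<epsilon> * f (Suc t) s \<omega> - f t (Suc s) \<omega> - \<epsilon> * q * f (Suc t) (Suc s) \<omega> = 0"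
      using phi_relation[OF q X_range[OF \<open>\<omega> \<in> space M\<close>]] by simp
  qed
  finally show ?thesis by simp
qed

text \<open>Multiplication by (1 + X) / (1 + X) connects consecutive tilts.\<close>

lemma moment_level:
  assumes "admissible_degree \<epsilon> m (t + s)" "\<epsilon> = 1"
  shows "moment m t s = moment (Suc m) t s + moment (Suc m) (Suc t) s"
proof -
  have "moment m t s = (\<integral>\<omega>. X \<omega> ^ t * phi \<epsilon> q (X \<omega>) ^ s / (1 + \<epsilon> * X \<omega>) ^ Suc m
      + X \<omega> ^ Suc t * phi \<epsilon> q (X \<omega>) ^ s / (1 + \<epsilon> * X \<omega>) ^ Suc m \<partial>M)"
    unfolding moment_def
  proof (intro Bochner_Integration.integral_cong refl)
    fix \<omega> assume "\<omega> \<in> space M"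
    then have "1 + \<epsilon> * X \<omega> \<noteq> 0" using X_range[of \<omega>] by (simp add: range_set_def)
    then show "X \<omega> ^ t * phi \<epsilon> q (X \<omega>) ^ s / (1 + \<epsilon> * X \<omega>) ^ m
      = X \<omega> ^ t * phi \<epsilon> q (X \<omega>) ^ s / (1 + \<epsilon> * X \<omega>) ^ Suc m + X \<omega> ^ Suc t * phi \<epsilon> q (X \<omega>) ^ s / (1 + \<epsilon> * X \<omega>) ^ Suc m"
    proof -
      let ?a = "X \<omega> ^ t * phi \<epsilon> q (X \<omega>) ^ s" and ?b = "1 + \<epsilon> * X \<omega>"
      have "?a / ?b ^ Suc m + X \<omega> ^ Suc t * phi \<epsilon> q (X \<omega>) ^ s / ?b ^ Suc m = ?b * ?a / (?b * ?b ^ m)"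
        using assms(2) by (simp add: add_divide_distrib[symmetric] algebra_simps)
      then show ?thesis using \<open>?b \<noteq> 0\<close> by simp
    qed
  qed
  also have "\<dots> = moment (Suc m) t s + moment (Suc m) (Suc t) s"
    unfolding moment_def using assms
    by (intro Bochner_Integration.integral_add integrable_moment) (auto simp: admissible_degree_def)
  finally show ?thesis .
qed

lemma moment_decreasing:
  assumes e: "\<epsilon> = -1"
  shows "moment 0 (Suc t) 0 < moment 0 t 0"
proof -
  have ad: "admissible_degree \<epsilon> 0 n" for n using e by (simp add: admissible_degree_def)
  have lin: "moment 0 t 0 - moment 0 (Suc t) 0 = (\<integral>\<omega>. X \<omega> ^ t * (1 - X \<omega>) \<partial>M)"
    using moment_linear[OF ad, of 1 t 0 "-1" 0] by simp
  have "integrable M (\<lambda>\<omega>. X \<omega> ^ t * (1 - X \<omega>))"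
    using Bochner_Integration.integrable_diff[OF integrable_moment[OF ad, of t 0] integrable_moment[OF ad, of "Suc t" 0]]
    by (simp add: algebra_simps)
  then have "0 < (\<integral>\<omega>. X \<omega> ^ t * (1 - X \<omega>) \<partial>M)"
    by (rule integral_pos) (use X_range e in \<open>auto simp: range_set_def\<close>)
  then show ?thesis using lin by simp
qed

end

definition ratio :: "(nat \<Rightarrow> real) \<Rightarrow> nat \<Rightarrow> real" where
  "ratio R t = R (Suc t) / R t"

text \<open>
  Along an edge both \<open>lin\<close> sequences turn out to be affine with the same slope, and \<open>a\<close> and \<open>\<beta>\<close> are
  read off from initial value and slope. For a beta law and \<open>\<epsilon> = -1\<close>, \<open>ratio R t = (a + t) / (a + \<beta> + t)\<close>.
\<close>

definition lin :: "real \<Rightarrow> (nat \<Rightarrow> real) \<Rightarrow> nat \<Rightarrow> real" where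
  "lin \<epsilon> R t = 1 / (1 + \<epsilon> * ratio R t)"

text \<open>\<open>X\<close> and \<open>U\<close> stand for the two messages across an edge,
  \<open>R\<close> and \<open>S\<close> for the sequences attached to its two ends. The first index
  is the tilting power.\<close>

locale edge_pair = X: range_rv M \<epsilon> q X + U: range_rv M \<epsilon> q U
  for M :: "'a measure" and \<epsilon> q X U +
  fixes R S :: "nat \<Rightarrow> nat \<Rightarrow> real"
  assumes R_pos: "\<And>m t. admissible_degree \<epsilon> m t \<Longrightarrow> 0 < R m t"
    and S_pos: "\<And>m s. admissible_degree \<epsilon> m s \<Longrightarrow> 0 < S m s"
    and reversal: "\<And>m t s. admissible_degree \<epsilon> m (t + s) \<Longrightarrow> X.moment m t s * S m s = U.moment m s t * R m t"
begin

text \<open>Reversal rewrites the relation for \<open>U\<close> as a second linear equation in the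
  same four moments of \<open>X\<close>. Subtracting \<open>ratio (S m) s\<close> times the relation
  for \<open>X\<close> removes the moment with both indices raised.\<close>

lemma contiguous:
  assumes "admissible_degree \<epsilon> m (t + s + 2)"
  shows "(ratio (R m) t - ratio (S m) s) * X.moment m t s
    - (1 + \<epsilon> * ratio (S m) s) * X.moment m (Suc t) s
    + ratio (S m) s * (1 + \<epsilon> * ratio (R m) t) * X.moment m t (Suc s) = 0"
proof -
  note mono = admissible_degree_mono[OF assms]
  have pos: "0 < R m t" "0 < R m (Suc t)" "0 < S m s" "0 < S m (Suc s)"
    by (rule R_pos S_pos, rule mono, simp)+
  define F F1 F2 F12 where "F = X.moment m t s" and "F1 = X.moment m (Suc t) s"
    and "F2 = X.moment m t (Suc s)" and "F12 = X.moment m (Suc t) (Suc s)"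
  have ad: "admissible_degree \<epsilon> m (t + s)" "admissible_degree \<epsilon> m (Suc t + s)"
    "admissible_degree \<epsilon> m (t + Suc s)" "admissible_degree \<epsilon> m (Suc t + Suc s)"
    by (rule mono, simp)+
  have rev: "U.moment m s t = F * S m s / R m t" "U.moment m s (Suc t) = F1 * S m s / R m (Suc t)"
    "U.moment m (Suc s) t = F2 * S m (Suc s) / R m t"
    "U.moment m (Suc s) (Suc t) = F12 * S m (Suc s) / R m (Suc t)"
    using reversal[OF ad(1)] reversal[OF ad(2)] reversal[OF ad(3)] reversal[OF ad(4)] pos
    by (simp_all add: F_def F1_def F2_def F12_def nonzero_eq_divide_eq)
  have "admissible_degree \<epsilon> m (s + t + 2)" by (rule mono) simp
  note eq = U.moment_relation[OF this, unfolded rev]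
  then have eq: "F * S m s / R m t + \<epsilon> * (F2 * S m (Suc s) / R m t) - F1 * S m s / R m (Suc t)
    - \<epsilon> * q * (F12 * S m (Suc s) / R m (Suc t)) = 0" by simp
  define \<rho> \<sigma> where "\<rho> = ratio (R m) t" and "\<sigma> = ratio (S m) s"
  have RS: "R m (Suc t) = \<rho> * R m t" "S m (Suc s) = \<sigma> * S m s" and "0 < \<rho>"
    using pos by (simp_all add: \<rho>_def \<sigma>_def ratio_def)
  have "(\<rho> * F + \<epsilon> * \<rho> * \<sigma> * F2 - F1 - \<epsilon> * q * \<sigma> * F12) * (S m s / (\<rho> * R m t)) = 0"
  proof -
    define c where "c = S m s / (\<rho> * R m t)"
    have "F * S m s / R m t = \<rho> * F * c" "F2 * (\<sigma> * S m s) / R m t = \<rho> * \<sigma> * F2 * c"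
      "F1 * S m s / (\<rho> * R m t) = F1 * c" "F12 * (\<sigma> * S m s) / (\<rho> * R m t) = \<sigma> * F12 * c"
      using \<open>0 < \<rho>\<close> by (simp_all add: c_def)
    then show ?thesis using eq unfolding RS c_def[symmetric] by algebra
  qed
  then have "ratio (R m) t * F + \<epsilon> * ratio (R m) t * ratio (S m) s * F2 - F1 - \<epsilon> * q * ratio (S m) s * F12 = 0"
    using pos \<open>0 < \<rho>\<close> by (simp add: \<rho>_def \<sigma>_def)
  moreover have "F + \<epsilon> * F1 - F2 - \<epsilon> * q * F12 = 0"
    using X.moment_relation[OF assms] by (simp add: F_def F1_def F2_def F12_def)
  ultimately show ?thesis unfolding F_def[symmetric] F1_def[symmetric] F2_def[symmetric] by algebra
qed

text \<open>Carries the bound across an edge. If the ratio of \<open>R 0\<close> were at least 1,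
  then F1 < F and F2 \<le> F would make the left side of \<open>contiguous\<close> positive.\<close>

lemma ratio_less_1:
  assumes "\<epsilon> = -1" "ratio (S 0) 0 < 1"
  shows "ratio (R 0) t < 1"
proof (rule ccontr)
  assume "\<not> ratio (R 0) t < 1"
  have ad: "admissible_degree \<epsilon> 0 n" for n using assms by (simp add: admissible_degree_def)
  define \<rho> \<sigma> F F1 F2 where "\<rho> = ratio (R 0) t" and "\<sigma> = ratio (S 0) 0"
    and "F = X.moment 0 t 0" and "F1 = X.moment 0 (Suc t) 0" and "F2 = X.moment 0 t (Suc 0)"
  have C: "(\<rho> - \<sigma>) * F - (1 - \<sigma>) * F1 + \<sigma> * (1 - \<rho>) * F2 = 0"
    using contiguous[OF ad, of t 0] assms by (simp add: \<rho>_def \<sigma>_def F_def F1_def F2_def)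
  have "0 < S 0 0" "0 < S 0 (Suc 0)" using S_pos ad by auto
  then have \<sigma>: "0 < \<sigma>" "\<sigma> < 1" using assms by (auto simp: \<sigma>_def ratio_def)
  have \<rho>: "1 \<le> \<rho>" using \<open>\<not> _\<close> by (simp add: \<rho>_def)
  have "0 < F2" using X.moment_pos ad by (simp add: F2_def)
  have "0 < F - F1" using X.moment_decreasing[OF assms(1), of t] by (simp add: F_def F1_def)
  have "F2 \<le> F"
  proof -
    have "F - F2 = (\<integral>\<omega>. X \<omega> ^ t * (1 - phi \<epsilon> q (X \<omega>)) \<partial>M)"
      using X.moment_linear[OF ad, of 1 t 0 0 "-1"] by (simp add: F_def F2_def)
    also have "\<dots> \<ge> 0"
    proof (intro integral_nonneg_AE AE_I2)
      fix \<omega> assume "\<omega> \<in> space M"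
      note X.X_range[OF this]
      then show "0 \<le> X \<omega> ^ t * (1 - phi \<epsilon> q (X \<omega>))"
        using moment_integrand_le_1[OF X.q \<open>X \<omega> \<in> _\<close> ad, of 0 1] by (auto simp: range_set_def)
    qed
    finally show ?thesis by simp
  qed
  have "\<sigma> * (\<rho> - 1) * F2 \<le> \<sigma> * (\<rho> - 1) * F" using \<sigma> \<rho> \<open>F2 \<le> F\<close> by (intro mult_left_mono) auto
  moreover have "(1 - \<sigma>) * F1 < (1 - \<sigma>) * F" using \<sigma> \<open>0 < F - F1\<close> by simp
  moreover have "(\<rho> - \<sigma>) * F - (1 - \<sigma>) * F - \<sigma> * (\<rho> - 1) * F = (1 - \<sigma>) * (\<rho> - 1) * F"
    by (simp add: algebra_simps)
  moreover have "0 \<le> (1 - \<sigma>) * (\<rho> - 1) * F" using \<sigma> \<rho> X.moment_pos[OF ad, of t 0] by (simp add: F_def)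
  ultimately show False using C by (simp add: algebra_simps)
qed

end

locale regular_edge_pair = edge_pair +
  assumes R_less_1: "\<And>t. \<epsilon> = -1 \<Longrightarrow> ratio (R 0) t < 1" and S_less_1: "\<And>s. \<epsilon> = -1 \<Longrightarrow> ratio (S 0) s < 1"
    and non_const: "\<not> (\<exists>c. AE \<omega> in M. X \<omega> = c)"
begin

lemma lin_denominator:
  assumes "admissible_degree \<epsilon> m (Suc t)"
  shows "0 < 1 + \<epsilon> * ratio (R m) t" "0 < 1 + \<epsilon> * ratio (S m) t"
proof -
  have "0 < R m t" "0 < R m (Suc t)" "0 < S m t" "0 < S m (Suc t)"
    using R_pos S_pos assms admissible_degree_mono[OF assms, of t] by auto
  then show "0 < 1 + \<epsilon> * ratio (R m) t" "0 < 1 + \<epsilon> * ratio (S m) t"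
    using assms R_less_1[of t] S_less_1[of t] by (auto simp: admissible_degree_def ratio_def add_pos_pos)
qed

text \<open>This is \<open>contiguous\<close> multiplied by -\<epsilon> x y, where x and y are the
  two values of \<open>lin\<close>. The coefficients become affine in x and y, which is the reason
  for introducing \<open>lin\<close>.\<close>

lemma lin_contiguous:
  assumes "admissible_degree \<epsilon> m (t + s + 2)"
  shows "(lin \<epsilon> (R m) t - lin \<epsilon> (S m) s) * X.moment m t s + \<epsilon> * lin \<epsilon> (R m) t * X.moment m (Suc t) s
    - (1 - lin \<epsilon> (S m) s) * X.moment m t (Suc s) = 0"
proof -
  define \<rho> \<sigma> x y where "\<rho> = ratio (R m) t" and "\<sigma> = ratio (S m) s"
    and "x = lin \<epsilon> (R m) t" and "y = lin \<epsilon> (S m) s"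
  have "0 < 1 + \<epsilon> * \<rho>" "0 < 1 + \<epsilon> * \<sigma>"
    unfolding \<rho>_def \<sigma>_def by (rule lin_denominator, rule admissible_degree_mono[OF assms], simp)+
  then have xy: "x * (1 + \<epsilon> * \<rho>) = 1" "y * (1 + \<epsilon> * \<sigma>) = 1"
    by (simp_all add: x_def y_def lin_def \<rho>_def \<sigma>_def)
  have "(\<rho> - \<sigma>) * X.moment m t s - (1 + \<epsilon> * \<sigma>) * X.moment m (Suc t) s
      + \<sigma> * (1 + \<epsilon> * \<rho>) * X.moment m t (Suc s) = 0"
    using contiguous[OF assms] by (simp add: \<rho>_def \<sigma>_def)
  then have "(x - y) * X.moment m t s + \<epsilon> * x * X.moment m (Suc t) s - (1 - y) * X.moment m t (Suc s) = 0"
    using xy X.eps_sq by algebra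
  then show ?thesis by (simp add: x_def y_def)
qed

text \<open>The left side depends on \<open>t\<close> alone and the right side on \<open>s\<close>
  alone, so both increments are constant. Degree 4 is what the contiguous relation at
  \<open>(Suc t, Suc s)\<close> consumes.\<close>

lemma lin_slope:
  assumes "admissible_degree \<epsilon> m (t + s + 4)"
  shows "lin \<epsilon> (R m) (Suc t) - lin \<epsilon> (R m) t = lin \<epsilon> (S m) (Suc s) - lin \<epsilon> (S m) s"
proof -
  note mono = admissible_degree_mono[OF assms]
  have "X.moment m (Suc t) (Suc s) \<noteq> 0"
    using X.moment_pos[of m "Suc t" "Suc s"] mono[of "Suc t + Suc s"] by simp
  then show ?thesis
    using slope_identity[OF X.eps_sq X.moment_relation[OF mono, of t s] X.moment_relation[OF mono, of "Suc t" s]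
       X.moment_relation[OF mono, of t "Suc s"] lin_contiguous[OF mono, of t s] lin_contiguous[OF mono, of "Suc t" s]
       lin_contiguous[OF mono, of t "Suc s"] lin_contiguous[OF mono, of "Suc t" "Suc s"] admissible_weightD(2)[OF X.q]]
    by simp
qed

lemma lin_bounds:
  assumes "admissible_degree \<epsilon> m (Suc t)"
  shows "\<epsilon> * (1 - lin \<epsilon> (R m) t) > 0" "\<epsilon> * (1 - lin \<epsilon> (S m) t) > 0" "0 < lin \<epsilon> (R m) t" "0 < lin \<epsilon> (S m) t"
proof -
  have pos: "0 < R m t" "0 < R m (Suc t)" "0 < S m t" "0 < S m (Suc t)"
    using R_pos S_pos assms admissible_degree_mono[OF assms, of t] by auto
  note d = lin_denominator[OF assms]
  have "\<epsilon> * (1 - lin \<epsilon> (R m) t) = (\<epsilon> * \<epsilon>) * ratio (R m) t / (1 + \<epsilon> * ratio (R m) t)"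
    "\<epsilon> * (1 - lin \<epsilon> (S m) t) = (\<epsilon> * \<epsilon>) * ratio (S m) t / (1 + \<epsilon> * ratio (S m) t)"
    using d by (simp_all add: lin_def field_simps)
  then show "\<epsilon> * (1 - lin \<epsilon> (R m) t) > 0" "\<epsilon> * (1 - lin \<epsilon> (S m) t) > 0"
    unfolding X.eps_sq using d pos by (simp_all add: ratio_def)
  show "0 < lin \<epsilon> (R m) t" "0 < lin \<epsilon> (S m) t" using d by (simp_all add: lin_def)
qed

text \<open>Vanishing slope would make \<open>X\<close> a root of an equation with only one solution.\<close>

lemma root_unique:
  assumes r: "r \<in> range_set \<epsilon>" "r' \<in> range_set \<epsilon>" and xy: "\<epsilon> * (1 - x) > 0" "\<epsilon> * (1 - y) > 0" "0 < x" "0 < y"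
    and eq: "(x - y) + \<epsilon> * x * r - (1 - y) * phi \<epsilon> q r = 0" "(x - y) + \<epsilon> * x * r' - (1 - y) * phi \<epsilon> q r' = 0"
  shows "r = r'"
proof -
  have *: False if r: "r \<in> range_set \<epsilon>" "r' \<in> range_set \<epsilon>" and "r < r'"
    and eq: "(x - y) + \<epsilon> * x * r - (1 - y) * phi \<epsilon> q r = 0" "(x - y) + \<epsilon> * x * r' - (1 - y) * phi \<epsilon> q r' = 0"
  for r r'
  proof -
    note d = weight_denominator_pos[OF X.q r(1)] weight_denominator_pos[OF X.q r(2)]
    have r0: "0 < r" "0 < r'" using r by (auto simp: range_set_def)
    have poly: "(x - y) * (1 + \<epsilon> * q * t) + \<epsilon> * x * t * (1 + \<epsilon> * q * t) - (1 - y) * (1 + \<epsilon> * t) = 0"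
      if "(x - y) + \<epsilon> * x * t - (1 - y) * phi \<epsilon> q t = 0" "0 < 1 + \<epsilon> * q * t" for t
    proof -
      have "phi \<epsilon> q t * (1 + \<epsilon> * q * t) = 1 + \<epsilon> * t" using that by (simp add: phi_def)
      then show ?thesis using that(1) by algebra
    qed
    show False
    proof (cases "\<epsilon> = 1")
      case True
      then have "0 \<le> q" using X.q by (auto simp: admissible_weight_def)
      let ?\<beta> = "q * (x - y) + x - (1 - y)"
      have "q * x * r ^ 2 + ?\<beta> * r = 1 - x" "q * x * r' ^ 2 + ?\<beta> * r' = 1 - x"
        using poly[OF eq(1) d(1)] poly[OF eq(2) d(2)] True by algebra+
      \<comment> \<open>Both points solve one quadratic equation; eliminating its linear coefficient
        shows that two positive roots cannot coexist.\<close>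
      then have "(1 - x) * (r' - r) + q * x * (r * r') * (r' - r) = 0" by algebra
      moreover have "0 < (1 - x) * (r' - r)" using xy True \<open>r < r'\<close> by simp
      moreover have "0 \<le> q * x * (r * r') * (r' - r)"
        using \<open>0 \<le> q\<close> xy r0 \<open>r < r'\<close> by (intro mult_nonneg_nonneg) auto
      ultimately show False by linarith
    next
      case False
      then have e: "\<epsilon> = -1" "q < 1" using X.q by (auto simp: admissible_weight_def)
      \<comment> \<open>For \<epsilon> = -1 the function \<phi> is strictly decreasing and y > 1, so
        the equation equates a strictly decreasing function of r to 0.\<close>
      have "phi \<epsilon> q r - phi \<epsilon> q r' = (1 - q) * (r' - r) / ((1 + \<epsilon> * q * r) * (1 + \<epsilon> * q * r'))"
        using d e by (simp add: phi_def field_simps)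
      then have "0 < phi \<epsilon> q r - phi \<epsilon> q r'" using d e \<open>r < r'\<close> by simp
      then have "0 < (y - 1) * (phi \<epsilon> q r - phi \<epsilon> q r')" using xy e by simp
      moreover have "0 < x * (r' - r)" using xy \<open>r < r'\<close> by simp
      moreover have "x * (r' - r) + (y - 1) * (phi \<epsilon> q r - phi \<epsilon> q r') = 0" using eq e by algebra
      ultimately show False by linarith
    qed
  qed
  show ?thesis using *[OF r _ eq] *[OF r(2,1) _ eq(2,1)] by (meson linorder_neqE)
qed

text \<open>With slope 0 the relations at (0, 0), (1, 0) and (0, 1) share the coefficients of one
  form g in 1, X and \<phi>(X). Combining the three relations with these same coefficients yields a
  vanishing tilted expectation of the square of g, so g vanishes almost surely and
  \<open>root_unique\<close> makes X constant.\<close>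

lemma slope_nonzero:
  assumes ad: "admissible_degree \<epsilon> m 4"
  shows "lin \<epsilon> (R m) (Suc 0) \<noteq> lin \<epsilon> (R m) 0"
proof
  assume eq: "lin \<epsilon> (R m) (Suc 0) = lin \<epsilon> (R m) 0"
  note mono = admissible_degree_mono[OF ad]
  define x y where "x = lin \<epsilon> (R m) 0" and "y = lin \<epsilon> (S m) 0"
  have eq': "lin \<epsilon> (S m) (Suc 0) = y" using lin_slope[of m 0 0] ad eq by (simp add: y_def)
  let ?f = "\<lambda>t s \<omega>. X \<omega> ^ t * phi \<epsilon> q (X \<omega>) ^ s / (1 + \<epsilon> * X \<omega>) ^ m"
  let ?g = "\<lambda>\<omega>. (x - y) + \<epsilon> * x * X \<omega> + (- (1 - y)) * phi \<epsilon> q (X \<omega>)"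
  have zero: "(\<integral>\<omega>. ?f t s \<omega> * ?g \<omega> \<partial>M) = 0"
    if "lin \<epsilon> (R m) t = x" "lin \<epsilon> (S m) s = y" "t + s \<le> 1" for t s
  proof -
    have "admissible_degree \<epsilon> m (t + s + 1)" "admissible_degree \<epsilon> m (t + s + 2)"
      using mono that(3) by auto
    have "(\<integral>\<omega>. ?f t s \<omega> * ?g \<omega> \<partial>M) = (x - y) * X.moment m t s + \<epsilon> * x * X.moment m (Suc t) s
        + (- (1 - y)) * X.moment m t (Suc s)"
      by (rule X.moment_linear[symmetric]) fact
    also have "\<dots> = 0"
      using lin_contiguous[OF \<open>admissible_degree \<epsilon> m (t + s + 2)\<close>] that(1,2) by (simp add: algebra_simps)
    finally show ?thesis .
  qed
  have int: "integrable M (\<lambda>\<omega>. ?f t s \<omega> * ?g \<omega>)" if "t + s \<le> 1" for t s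
  proof -
    have "integrable M (\<lambda>\<omega>. (x - y) * ?f t s \<omega> + \<epsilon> * x * ?f (Suc t) s \<omega> + (- (1 - y)) * ?f t (Suc s) \<omega>)"
      using that by (intro Bochner_Integration.integrable_add integrable_mult_right X.integrable_moment mono) auto
    then show ?thesis
      by (rule Bochner_Integration.integrable_cong[THEN iffD1, rotated -1]) (simp_all add: algebra_simps add_divide_distrib diff_divide_distrib)
  qed
  define h where "h = (\<lambda>t s \<omega>. ?f t s \<omega> * ?g \<omega>)"
  have h: "integrable M (h 0 0)" "integrable M (h (Suc 0) 0)" "integrable M (h 0 (Suc 0))"
    "(\<integral>\<omega>. h 0 0 \<omega> \<partial>M) = 0" "(\<integral>\<omega>. h (Suc 0) 0 \<omega> \<partial>M) = 0" "(\<integral>\<omega>. h 0 (Suc 0) \<omega> \<partial>M) = 0"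
    unfolding h_def using eq eq' by (intro int zero; simp add: x_def y_def)+
  \<comment> \<open>One factor of the square is expanded, the other is kept inside
    \<open>h\<close>.\<close>
  have sq: "?g \<omega> ^ 2 / (1 + \<epsilon> * X \<omega>) ^ m
      = (x - y) * h 0 0 \<omega> + \<epsilon> * x * h (Suc 0) 0 \<omega> + (- (1 - y)) * h 0 (Suc 0) \<omega>" for \<omega>
    by (simp add: h_def power2_eq_square algebra_simps add_divide_distrib diff_divide_distrib)
  have isq: "integrable M (\<lambda>\<omega>. ?g \<omega> ^ 2 / (1 + \<epsilon> * X \<omega>) ^ m)"
    unfolding sq using h(1-3) by simp
  have "(\<integral>\<omega>. ?g \<omega> ^ 2 / (1 + \<epsilon> * X \<omega>) ^ m \<partial>M) = 0"
    unfolding sq using h by simp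
  then have "AE \<omega> in M. ?g \<omega> ^ 2 / (1 + \<epsilon> * X \<omega>) ^ m = 0"
    using integral_nonneg_eq_0_iff_AE[OF isq] X.X_range by (auto simp: range_set_def less_imp_le)
  then have AE0: "AE \<omega> in M. ?g \<omega> = 0 \<and> X \<omega> \<in> range_set \<epsilon>"
    using AE_space
  proof eventually_elim
    case (elim \<omega>)
    then have "0 < 1 + \<epsilon> * X \<omega>" using X.X_range by (auto simp: range_set_def)
    then show ?case using elim X.X_range by simp
  qed
  then obtain \<omega>\<^sub>0 where \<omega>0: "?g \<omega>\<^sub>0 = 0" "X \<omega>\<^sub>0 \<in> range_set \<epsilon>"
    using eventually_happens[OF AE0] X.ae_filter_bot by auto
  have b: "admissible_degree \<epsilon> m (Suc 0)" by (rule mono) simp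
  have "AE \<omega> in M. X \<omega> = X \<omega>\<^sub>0"
    using AE0
  proof eventually_elim
    case (elim \<omega>)
    show ?case
    proof (rule root_unique)
      show "X \<omega> \<in> range_set \<epsilon>" "X \<omega>\<^sub>0 \<in> range_set \<epsilon>" using elim \<omega>0 by auto
      show "0 < \<epsilon> * (1 - x)" "0 < \<epsilon> * (1 - y)" "0 < x" "0 < y"
        using lin_bounds[OF b] by (simp_all add: x_def y_def)
      show "x - y + \<epsilon> * x * X \<omega> - (1 - y) * phi \<epsilon> q (X \<omega>) = 0"
        "x - y + \<epsilon> * x * X \<omega>\<^sub>0 - (1 - y) * phi \<epsilon> q (X \<omega>\<^sub>0) = 0"
        using elim \<omega>0(1) by linarith+
    qed
  qed
  then show False using non_const by blast
qed

lemma lin_linear: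
  assumes "admissible_degree \<epsilon> m (t + 3)" "admissible_degree \<epsilon> m 4"
  shows "lin \<epsilon> (R m) t = lin \<epsilon> (R m) 0 + (lin \<epsilon> (R m) (Suc 0) - lin \<epsilon> (R m) 0) * real t"
  using assms(1)
proof (induction t)
  case (Suc t)
  have "admissible_degree \<epsilon> m (t + 3)" by (rule admissible_degree_mono[OF Suc.prems]) simp
  moreover have "lin \<epsilon> (R m) (Suc t) - lin \<epsilon> (R m) t = lin \<epsilon> (S m) (Suc 0) - lin \<epsilon> (S m) 0"
    using lin_slope[of m t 0] Suc.prems by (simp add: add.commute)
  moreover have "lin \<epsilon> (R m) (Suc 0) - lin \<epsilon> (R m) 0 = lin \<epsilon> (S m) (Suc 0) - lin \<epsilon> (S m) 0"
    using lin_slope[of m 0 0] assms(2) by simp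
  ultimately have "lin \<epsilon> (R m) (Suc t) = lin \<epsilon> (R m) t + (lin \<epsilon> (R m) (Suc 0) - lin \<epsilon> (R m) 0)"
    "lin \<epsilon> (R m) t = lin \<epsilon> (R m) 0 + (lin \<epsilon> (R m) (Suc 0) - lin \<epsilon> (R m) 0) * real t"
    using Suc.IH by (linarith, blast)
  then show ?case by (simp add: distrib_left)
qed simp

end

section \<open>Laws determined by Stein equations\<close>

text \<open>Unnormalized density of a message: \<open>a\<close> belongs to the sending vertex,
  \<open>b\<close> to the receiving one, and \<beta> is the parameter called \<open>shift\<close>
  later on. A tilt by m merely raises \<beta> by m.\<close>

definition edge_density :: "real \<Rightarrow> real \<Rightarrow> real \<Rightarrow> real \<Rightarrow> real \<Rightarrow> real \<Rightarrow> real" where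
  "edge_density \<epsilon> q a b \<beta> x =
     indicator (range_set \<epsilon>) x * (x powr (a - 1) * (1 + \<epsilon> * x) powr (- \<beta> - 1) * phi \<epsilon> q x powr b)"

lemma range_set_eq: "range_set (-1) = {0<..<1}" "range_set 1 = {0<..}"
  by (auto simp: range_set_def)

lemma range_set_meas [measurable]: "range_set \<epsilon> \<in> sets borel"
proof -
  have "range_set \<epsilon> = {x \<in> space borel. 0 < x \<and> 0 < 1 + \<epsilon> * x}" by (simp add: range_set_def)
  also have "\<dots> \<in> sets borel" by measurable
  finally show ?thesis .
qed

lemma edge_density_meas [measurable]: "edge_density \<epsilon> q a b \<beta> \<in> borel_measurable borel"
  unfolding edge_density_def phi_def by measurable

lemma edge_density_nonneg: "0 \<le> edge_density \<epsilon> q a b \<beta> x"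
  by (simp add: edge_density_def indicator_def)

context range_rv
begin

text \<open>Integration by parts against \<open>edge_density\<close>: up to sign, the integrand is
  the derivative of x^(a+t) (1+\<epsilon>x)^(-\<beta>-m) \<phi>(x)^b, with the derivative of \<phi>
  simplified by \<open>phi_relation\<close>.\<close>

definition stein_identity :: "real \<Rightarrow> real \<Rightarrow> real \<Rightarrow> nat \<Rightarrow> nat \<Rightarrow> bool" where
  "stein_identity a b \<beta> m t \<longleftrightarrow> (b - a - real t) * moment m t 0
     + \<epsilon> * (\<beta> + real m - a - real t) * moment m (Suc t) 0 - b * moment m t (Suc 0) = 0"

lemma stein_identityD:
  assumes "stein_identity a b \<beta> m t" "admissible_degree \<epsilon> m (t + 1)"
  shows "(\<integral>\<omega>. X \<omega> ^ t / (1 + \<epsilon> * X \<omega>) ^ m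
    * ((a - b + real t) - \<epsilon> * (\<beta> + real m - a - real t) * X \<omega> + b * phi \<epsilon> q (X \<omega>)) \<partial>M) = 0"
  using moment_linear[of m t 0 "a - b + real t" "- (\<epsilon> * (\<beta> + real m - a - real t))" b] assms
  by (simp add: stein_identity_def algebra_simps)

text \<open>Without tilt the identities for all \<open>t\<close> are the Stein equations of
  \<open>stein_law\<close> with A(z) = z (1 - z).\<close>

lemma law_eps_minus:
  assumes e: "\<epsilon> = -1" and st: "\<And>t. stein_identity a b \<beta> 0 t"
  shows "\<exists>\<kappa>>0. distr M borel X = density lborel (\<lambda>x. ennreal (\<kappa> * edge_density \<epsilon> q a b \<beta> x))"
proof -
  have q1: "q < 1" using q e by (auto simp: admissible_weight_def)
  let ?D = "distr M borel X"
  let ?A = "\<lambda>z::real. z * (1 - z)"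
  let ?B = "\<lambda>z. (a - b) + (\<beta> - a) * z + b * phi \<epsilon> q z"
  have rng: "z \<in> range_set \<epsilon>" if "0 < z" "z < 1" for z using that e by (simp add: range_set_def)
  have phi: "0 < phi \<epsilon> q z" "phi \<epsilon> q z \<le> 1" if "0 < z" "z < 1" for z
    using phi_pos[OF q rng[OF that]] moment_integrand_le_1[OF q rng[OF that], of 0 0 1] e
    by (auto simp: admissible_degree_def)
  have den: "0 < 1 - q * z" if "0 < z" "z < 1" for z
    using weight_denominator_pos[OF q rng[OF that]] e by simp
  interpret D: prob_space ?D by (rule prob_space_distr) measurable
  interpret D: stein_law ?D ?A ?B "1 + \<bar>a - b\<bar> + \<bar>\<beta> - a\<bar> + \<bar>b\<bar>"
  proof
    show "AE z in ?D. 0 < z \<and> z < 1"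
      by (subst AE_distr_iff) (use X_range e in \<open>auto simp: range_set_def intro!: AE_I2\<close>)
    fix z :: real assume z: "0 < z" "z < 1"
    have "\<bar>z * (1 - z)\<bar> \<le> 1" using z by (simp add: abs_mult mult_le_one)
    then show "\<bar>?A z\<bar> \<le> 1 + \<bar>a - b\<bar> + \<bar>\<beta> - a\<bar> + \<bar>b\<bar>" by linarith
    have "\<bar>(\<beta> - a) * z\<bar> \<le> \<bar>\<beta> - a\<bar> * 1" unfolding abs_mult using z by (intro mult_left_mono) auto
    moreover have "\<bar>b * phi \<epsilon> q z\<bar> \<le> \<bar>b\<bar> * 1" unfolding abs_mult using phi[OF z] by (intro mult_left_mono) auto
    moreover have "\<bar>r\<bar> \<le> r' * 1 \<Longrightarrow> \<bar>s\<bar> \<le> s' * 1 \<Longrightarrow> \<bar>p + r + s\<bar> \<le> 1 + \<bar>p\<bar> + r' + s'" for p r r' s s' :: real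
      by linarith
    ultimately show "\<bar>?B z\<bar> \<le> 1 + \<bar>a - b\<bar> + \<bar>\<beta> - a\<bar> + \<bar>b\<bar>" by blast
    show "0 < ?A z" using z by simp
  next
    show "continuous_on {0<..<1} ?B"
      unfolding phi_def using den e by (intro continuous_intros) force
    fix n
    have "(\<integral>z. ?A z * (real n * z ^ (n - 1)) + ?B z * z ^ n \<partial>?D)
        = (\<integral>\<omega>. ?A (X \<omega>) * (real n * X \<omega> ^ (n - 1)) + ?B (X \<omega>) * X \<omega> ^ n \<partial>M)"
      by (rule integral_distr) auto
    also have "\<dots> = (\<integral>\<omega>. X \<omega> ^ n / (1 + \<epsilon> * X \<omega>) ^ 0
        * ((a - b + real n) - \<epsilon> * (\<beta> + real 0 - a - real n) * X \<omega> + b * phi \<epsilon> q (X \<omega>)) \<partial>M)"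
      by (intro Bochner_Integration.integral_cong refl; cases n) (simp_all add: e algebra_simps)
    also have "\<dots> = 0" by (rule stein_identityD[OF st]) (simp add: e admissible_degree_def)
    finally show "(\<integral>z. ?A z * (real n * z ^ (n - 1)) + ?B z * z ^ n \<partial>?D) = 0" .
  qed (auto intro!: continuous_intros)
  \<comment> \<open>\<open>G\<close> is \<open>A\<close> times the expected density, hence the
    positive solution of G' / G = B / A.\<close>
  define G where "G z = exp (a * ln z - \<beta> * ln (1 - z) + b * (ln (1 - z) - ln (1 - q * z)))" for z
  have "\<exists>\<kappa>>0. ?D = density lborel (\<lambda>z. ennreal (\<kappa> * (G z / ?A z) * indicator {0<..<1} z))"
  proof (rule D.law_eq)
    fix z :: real assume z: "0 < z" "z < 1"
    show "0 < G z" by (simp add: G_def)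
    have "(G has_real_derivative G z * (a / z + \<beta> / (1 - z) + b * (- 1 / (1 - z) + q / (1 - q * z)))) (at z)"
      unfolding G_def using z den[OF z] by (auto intro!: derivative_eq_intros simp: divide_inverse algebra_simps)
    moreover have "a / z + \<beta> / (1 - z) + b * (- 1 / (1 - z) + q / (1 - q * z)) = ?B z / ?A z"
      using z den[OF z] e by (simp add: phi_def divide_simps) (simp add: algebra_simps)
    ultimately show "(G has_real_derivative ?B z / ?A z * G z) (at z)" by (simp add: mult.commute)
  qed
  then obtain \<kappa> where \<kappa>: "\<kappa> > 0" "?D = density lborel (\<lambda>z. ennreal (\<kappa> * (G z / ?A z) * indicator {0<..<1} z))"
    by blast
  have "\<kappa> * (G z / ?A z) * indicator {0<..<1} z = \<kappa> * edge_density \<epsilon> q a b \<beta> z" for z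
  proof (cases "0 < z \<and> z < 1")
    case True
    have "edge_density \<epsilon> q a b \<beta> z = exp ((a - 1) * ln z + (- \<beta> - 1) * ln (1 - z) + b * (ln (1 - z) - ln (1 - q * z)))"
      using True den[of z] phi[of z] rng[of z] e
      by (simp add: edge_density_def powr_def exp_add phi_def ln_div)
    also have "\<dots> = exp (a * ln z - \<beta> * ln (1 - z) + b * (ln (1 - z) - ln (1 - q * z)) - ln z - ln (1 - z))"
      by (simp add: algebra_simps)
    also have "\<dots> = G z / ?A z" using True by (simp add: exp_diff G_def)
    finally show ?thesis using True by simp
  qed (use e in \<open>auto simp: edge_density_def range_set_def indicator_def\<close>)
  then show ?thesis using \<kappa> by auto
qed

text \<open>Under z = x / (1 + x) the quantity x^n / (1 + x)^(n+3) becomes z^n (1 - z)^3. The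
  identities with t = n and m = n + 3 therefore form a Stein equation on the unit interval, at the
  price of an additional factor (1 - z)^2 in both \<open>A\<close> and \<open>B\<close>.\<close>

lemma law_eps_plus:
  assumes e: "\<epsilon> = 1" and st: "\<And>m t. 4 \<le> m \<Longrightarrow> t + 3 \<le> m \<Longrightarrow> stein_identity a b \<beta> m t"
  shows "\<exists>\<kappa>>0. distr M borel X = density lborel (\<lambda>x. ennreal (\<kappa> * edge_density \<epsilon> q a b \<beta> x))"
proof -
  have q0: "0 \<le> q" using q e by (auto simp: admissible_weight_def)
  define Z where "Z \<omega> = X \<omega> / (1 + X \<omega>)" for \<omega>
  have [measurable]: "Z \<in> borel_measurable M" unfolding Z_def by measurable
  let ?D = "distr M borel Z"
  let ?w = "\<lambda>z. (1 - z) + q * z"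
  let ?A = "\<lambda>z::real. z * (1 - z) ^ 3"
  let ?B = "\<lambda>z. (1 - z)\<^sup>2 * ((a - b) * (1 - z) - (\<beta> - a + 3) * z + b * ((1 - z) / ?w z))"
  have w: "0 < ?w z" "0 \<le> (1 - z) / ?w z" "(1 - z) / ?w z \<le> 1" if "0 < z" "z < 1" for z
  proof -
    show "0 < ?w z" using that q0 by (simp add: add_pos_nonneg)
    then show "0 \<le> (1 - z) / ?w z" "(1 - z) / ?w z \<le> 1" using that q0 by simp_all
  qed
  have X0: "0 < X \<omega>" if "\<omega> \<in> space M" for \<omega> using X_range[OF that] by (simp add: range_set_def)
  have Z01: "0 < Z \<omega>" "Z \<omega> < 1" if "\<omega> \<in> space M" for \<omega> using X0[OF that] by (simp_all add: Z_def)
  have Zs: "1 - Z \<omega> = 1 / (1 + X \<omega>)" "(1 - Z \<omega>) / ?w (Z \<omega>) = phi \<epsilon> q (X \<omega>) / (1 + X \<omega>)"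
    if "\<omega> \<in> space M" for \<omega>
  proof -
    show *: "1 - Z \<omega> = 1 / (1 + X \<omega>)" using X0[OF that] by (simp add: Z_def field_simps)
    have "?w (Z \<omega>) = (1 + q * X \<omega>) / (1 + X \<omega>)" unfolding * using X0[OF that] by (simp add: Z_def add_divide_distrib)
    moreover have "0 < 1 + q * X \<omega>" using X0[OF that] q0 by (simp add: add_pos_nonneg)
    ultimately show "(1 - Z \<omega>) / ?w (Z \<omega>) = phi \<epsilon> q (X \<omega>) / (1 + X \<omega>)"
      unfolding * using X0[OF that] by (simp add: phi_def e)
  qed
  interpret D: prob_space ?D by (rule prob_space_distr) measurable
  have A_meas: "?A \<in> borel_measurable borel" and B_meas: "?B \<in> borel_measurable borel" by measurable
  define C where "C = 1 + \<bar>a - b\<bar> + \<bar>\<beta> - a + 3\<bar> + \<bar>b\<bar>"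
  have A_bound: "\<bar>?A z\<bar> \<le> C" if z: "0 < z" "z < 1" for z
  proof -
    have "\<bar>?A z\<bar> \<le> 1 * 1" unfolding abs_mult using z by (intro mult_mono) (auto simp: power_le_one)
    then show ?thesis unfolding C_def by linarith
  qed
  have B_bound: "\<bar>?B z\<bar> \<le> C" if z: "0 < z" "z < 1" for z
  proof -
    let ?I = "(a - b) * (1 - z) - (\<beta> - a + 3) * z + b * ((1 - z) / ?w z)"
    have "\<bar>(a - b) * (1 - z)\<bar> \<le> \<bar>a - b\<bar> * 1" "\<bar>(\<beta> - a + 3) * z\<bar> \<le> \<bar>\<beta> - a + 3\<bar> * 1"
      "\<bar>b * ((1 - z) / ?w z)\<bar> \<le> \<bar>b\<bar> * 1"
      unfolding abs_mult using z w[OF z] by (intro mult_left_mono; simp)+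
    moreover have "\<bar>p\<bar> \<le> p' * 1 \<Longrightarrow> \<bar>r\<bar> \<le> r' * 1 \<Longrightarrow> \<bar>s\<bar> \<le> s' * 1 \<Longrightarrow> \<bar>p - r + s\<bar> \<le> 1 + p' + r' + s'"
      for p p' r r' s s' :: real by linarith
    ultimately have "\<bar>?I\<bar> \<le> C" unfolding C_def by blast
    moreover have "\<bar>?B z\<bar> \<le> 1 * \<bar>?I\<bar>" unfolding abs_mult using z by (intro mult_right_mono) (auto simp: power_le_one)
    ultimately show ?thesis unfolding mult_1_left by (rule order_trans[rotated])
  qed
  have int: "integrable M (\<lambda>\<omega>. f (Z \<omega>))" if "f \<in> borel_measurable borel" "\<And>z. 0 < z \<Longrightarrow> z < 1 \<Longrightarrow> \<bar>f z\<bar> \<le> K" for f :: "real \<Rightarrow> real" and K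
    by (rule integrable_const_bound[where B = K]) (use that Z01 in \<open>auto intro!: AE_I2\<close>)
  have st': "(\<integral>\<omega>. X \<omega> ^ t / (1 + X \<omega>) ^ m
    * ((a - b + real t) - (\<beta> + real m - a - real t) * X \<omega> + b * phi \<epsilon> q (X \<omega>)) \<partial>M) = 0"
    if "4 \<le> m" "t + 3 \<le> m" for m t
    using stein_identityD[OF st[OF that]] that by (simp add: e admissible_degree_def)
  have s1: "(\<integral>\<omega>. ?A (Z \<omega>) * (real n * Z \<omega> ^ (n - 1)) + ?B (Z \<omega>) * Z \<omega> ^ n \<partial>M) = 0" if "1 \<le> n" for n
  proof -
    obtain k where n: "n = Suc k" using \<open>1 \<le> n\<close> by (cases n) auto
    have "(\<integral>\<omega>. ?A (Z \<omega>) * (real n * Z \<omega> ^ (n - 1)) + ?B (Z \<omega>) * Z \<omega> ^ n \<partial>M)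
      = (\<integral>\<omega>. X \<omega> ^ n / (1 + X \<omega>) ^ (n + 3)
        * ((a - b + real n) - (\<beta> + real (n + 3) - a - real n) * X \<omega> + b * phi \<epsilon> q (X \<omega>)) \<partial>M)"
    proof (intro Bochner_Integration.integral_cong refl)
      fix \<omega> assume om: "\<omega> \<in> space M"
      note Z = Zs[OF om]
      have x: "1 + X \<omega> \<noteq> 0" using X0[OF om] by simp
      have "?A (Z \<omega>) * (real n * Z \<omega> ^ (n - 1)) + ?B (Z \<omega>) * Z \<omega> ^ n
        = Z \<omega> ^ n * (1 - Z \<omega>) ^ 2 * ((a - b + real n) * (1 - Z \<omega>) - (\<beta> - a + 3) * Z \<omega> + b * ((1 - Z \<omega>) / ?w (Z \<omega>)))"
      proof -
        have *: "z * (1 - z) ^ 3 * (real n * z ^ (n - 1)) + (1 - z)\<^sup>2 * ((a - b) * (1 - z) - (\<beta> - a + 3) * z + b * v) * z ^ n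
          = z ^ n * (1 - z)\<^sup>2 * ((a - b + real n) * (1 - z) - (\<beta> - a + 3) * z + b * v)" for z v :: real
          by (simp add: n power2_eq_square power3_eq_cube algebra_simps)
        show ?thesis by (rule *)
      qed
      also have "\<dots> = Z \<omega> ^ n * (1 / (1 + X \<omega>)) ^ 2 *
         ((a - b + real n) * (1 / (1 + X \<omega>)) - (\<beta> - a + 3) * (X \<omega> / (1 + X \<omega>)) + b * (phi \<epsilon> q (X \<omega>) / (1 + X \<omega>)))"
        unfolding Z(2) unfolding Z(1) by (simp add: Z_def)
      also have "\<dots> = X \<omega> ^ n / (1 + X \<omega>) ^ n * (1 / (1 + X \<omega>)) ^ 2 *
         (((a - b + real n) - (\<beta> - a + 3) * X \<omega> + b * phi \<epsilon> q (X \<omega>)) / (1 + X \<omega>))"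
        by (simp add: Z_def power_divide add_divide_distrib diff_divide_distrib)
      also have "\<dots> = X \<omega> ^ n / (1 + X \<omega>) ^ (n + 3) * ((a - b + real n) - (\<beta> - a + 3) * X \<omega> + b * phi \<epsilon> q (X \<omega>))"
        using x by (simp add: power_add power2_eq_square power3_eq_cube power_one_over)
      finally show "?A (Z \<omega>) * (real n * Z \<omega> ^ (n - 1)) + ?B (Z \<omega>) * Z \<omega> ^ n = X \<omega> ^ n / (1 + X \<omega>) ^ (n + 3)
        * ((a - b + real n) - (\<beta> + real (n + 3) - a - real n) * X \<omega> + b * phi \<epsilon> q (X \<omega>))"
        by simp
    qed
    also have "\<dots> = 0" by (rule st') (use that in auto)
    finally show ?thesis .
  qed
  \<comment> \<open>The case n = 0 would need m = 3, below the available tilts. The identity at m =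
    4, t = 0 says that B (1 - Z) - A has mean 0, and n = 1 says the same of A + B Z; the sum is
    \<open>B\<close>.\<close>
  have s0: "(\<integral>\<omega>. ?B (Z \<omega>) \<partial>M) = 0"
  proof -
    let ?g = "\<lambda>\<omega>. X \<omega> ^ 0 / (1 + X \<omega>) ^ 4 * ((a - b + real 0) - (\<beta> + real 4 - a - real 0) * X \<omega> + b * phi \<epsilon> q (X \<omega>))"
    have "integrable M (\<lambda>\<omega>. ?A (Z \<omega>) + ?B (Z \<omega>) * Z \<omega>)"
    proof (rule int[of _ "C + C * 1"])
      fix z :: real assume z: "0 < z" "z < 1"
      have "\<bar>?B z * z\<bar> \<le> C * 1"
        unfolding abs_mult[of "?B z"] using B_bound[OF z] z by (intro mult_mono) auto
      from add_mono[OF A_bound[OF z] this] show "\<bar>?A z + ?B z * z\<bar> \<le> C + C * 1"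
        by (rule order_trans[OF abs_triangle_ineq])
    qed measurable
    moreover have "integrable M (\<lambda>\<omega>. ?B (Z \<omega>))" by (rule int[OF B_meas B_bound])
    moreover have "?g \<omega> = ?B (Z \<omega>) - (?A (Z \<omega>) + ?B (Z \<omega>) * Z \<omega>)" if om: "\<omega> \<in> space M" for \<omega>
    proof -
      note Z = Zs[OF om]
      have x: "1 + X \<omega> \<noteq> 0" using X0[OF om] by simp
      have "?B (Z \<omega>) - (?A (Z \<omega>) + ?B (Z \<omega>) * Z \<omega>)
        = (1 - Z \<omega>) ^ 3 * ((a - b) * (1 - Z \<omega>) - (\<beta> - a + 4) * Z \<omega> + b * ((1 - Z \<omega>) / ?w (Z \<omega>)))"
      proof -
        have *: "(1 - z)\<^sup>2 * ((a - b) * (1 - z) - (\<beta> - a + 3) * z + b * v)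
          - (z * (1 - z) ^ 3 + (1 - z)\<^sup>2 * ((a - b) * (1 - z) - (\<beta> - a + 3) * z + b * v) * z)
          = (1 - z) ^ 3 * ((a - b) * (1 - z) - (\<beta> - a + 4) * z + b * v)" for z v :: real
          by (simp add: power2_eq_square power3_eq_cube algebra_simps)
        show ?thesis by (rule *)
      qed
      also have "\<dots> = (1 / (1 + X \<omega>)) ^ 3 *
         ((a - b) * (1 / (1 + X \<omega>)) - (\<beta> - a + 4) * (X \<omega> / (1 + X \<omega>)) + b * (phi \<epsilon> q (X \<omega>) / (1 + X \<omega>)))"
        unfolding Z(2) unfolding Z(1) by (simp add: Z_def)
      also have "\<dots> = (1 / (1 + X \<omega>)) ^ 3 *
         (((a - b) - (\<beta> - a + 4) * X \<omega> + b * phi \<epsilon> q (X \<omega>)) / (1 + X \<omega>))"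
        by (simp add: add_divide_distrib diff_divide_distrib)
      also have "\<dots> = ?g \<omega>" using x by (simp add: power_one_over power3_eq_cube power4_eq_xxxx)
      finally show ?thesis by simp
    qed
    then have "(\<integral>\<omega>. ?g \<omega> \<partial>M) = (\<integral>\<omega>. ?B (Z \<omega>) - (?A (Z \<omega>) + ?B (Z \<omega>) * Z \<omega>) \<partial>M)"
      by (intro Bochner_Integration.integral_cong) auto
    moreover have "(\<integral>\<omega>. ?g \<omega> \<partial>M) = 0" by (rule st') auto
    moreover have "(\<integral>\<omega>. ?A (Z \<omega>) + ?B (Z \<omega>) * Z \<omega> \<partial>M) = 0" using s1[of 1] by simp
    ultimately show ?thesis
      using Bochner_Integration.integral_diff[of M "\<lambda>\<omega>. ?B (Z \<omega>)" "\<lambda>\<omega>. ?A (Z \<omega>) + ?B (Z \<omega>) * Z \<omega>"] by linarith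
  qed
  interpret D: stein_law ?D ?A ?B C
  proof
    show "AE z in ?D. 0 < z \<and> z < 1" by (subst AE_distr_iff) (use Z01 in auto)
    show "continuous_on {0<..<1} ?B" using w(1) by (intro continuous_intros) force
    fix n
    have "(\<integral>z. ?A z * (real n * z ^ (n - 1)) + ?B z * z ^ n \<partial>?D)
        = (\<integral>\<omega>. ?A (Z \<omega>) * (real n * Z \<omega> ^ (n - 1)) + ?B (Z \<omega>) * Z \<omega> ^ n \<partial>M)"
      by (rule integral_distr) auto
    also have "\<dots> = 0" using s1[of n] s0 by (cases "n = 0") simp_all
    finally show "(\<integral>z. ?A z * (real n * z ^ (n - 1)) + ?B z * z ^ n \<partial>?D) = 0" .
  qed (use A_meas B_meas A_bound B_bound in \<open>auto intro!: continuous_intros\<close>)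
  \<comment> \<open>Again \<open>A\<close> times the expected density, now written in z; the
    exponent 3 comes from the cube in \<open>A\<close>.\<close>
  define G where "G z = exp (a * ln z + (\<beta> - a + 3) * ln (1 - z) - b * ln (?w z))" for z
  have "\<exists>\<kappa>>0. ?D = density lborel (\<lambda>z. ennreal (\<kappa> * (G z / ?A z) * indicator {0<..<1} z))"
  proof (rule D.law_eq)
    fix z :: real assume z: "0 < z" "z < 1"
    show "0 < G z" by (simp add: G_def)
    have "(G has_real_derivative G z * (a / z - (\<beta> - a + 3) / (1 - z) - b * ((q - 1) / ?w z))) (at z)"
      unfolding G_def using z w(1)[OF z] by (auto intro!: derivative_eq_intros simp: divide_inverse algebra_simps)
    moreover have "a / z - (\<beta> - a + 3) / (1 - z) - b * ((q - 1) / ?w z) = ?B z / ?A z"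
    proof -
      have "?B z / ?A z = ((a - b) * (1 - z) - (\<beta> - a + 3) * z + b * ((1 - z) / ?w z)) / (z * (1 - z))"
        using z by (simp add: power2_eq_square power3_eq_cube)
      also have "\<dots> = a / z - (\<beta> - a + 3) / (1 - z) - (b - b / ?w z) / z"
        using z w(1)[OF z] by (simp add: divide_simps) (simp add: algebra_simps)
      also have "(b - b / ?w z) / z = b * ((q - 1) / ?w z)"
      proof -
        define W where "W = ?w z"
        have "W \<noteq> 0" "W - 1 = (q - 1) * z" using w(1)[OF z] by (simp_all add: W_def algebra_simps)
        have "b - b / W = b * (W - 1) / W" using \<open>W \<noteq> 0\<close> by (simp add: field_simps)
        then have "b - b / W = b * ((q - 1) * z) / W" unfolding \<open>W - 1 = (q - 1) * z\<close> .
        then show ?thesis using z by (simp add: W_def)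
      qed
      finally show ?thesis by simp
    qed
    ultimately show "(G has_real_derivative ?B z / ?A z * G z) (at z)" by (simp add: mult.commute)
  qed
  then obtain \<kappa> where \<kappa>: "\<kappa> > 0" "?D = density lborel (\<lambda>z. ennreal (\<kappa> * (G z / ?A z) * indicator {0<..<1} z))"
    by blast
  have [measurable]: "G \<in> borel_measurable borel" unfolding G_def by measurable
  let ?N = "density lborel (\<lambda>x. ennreal (\<kappa> * edge_density \<epsilon> q a b \<beta> x))"
  \<comment> \<open>Back to the original variable: 1 / (1 + t)^2 is the derivative of t / (1 +
    t).\<close>
  have transform: "\<kappa> * (G (t / (1 + t)) / ?A (t / (1 + t))) * (1 / (1 + t)\<^sup>2) = \<kappa> * edge_density \<epsilon> q a b \<beta> t"
    if t: "0 < t" for t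
  proof -
    have t1: "0 < 1 + t" "0 < 1 + q * t" using t q0 by (simp_all add: add_pos_nonneg)
    have om: "1 - t / (1 + t) = 1 / (1 + t)" using t1 by (simp add: field_simps)
    have ww: "?w (t / (1 + t)) = (1 + q * t) / (1 + t)" unfolding om using t1 by (simp add: add_divide_distrib)
    have A: "?A (t / (1 + t)) * (1 + t)\<^sup>2 = t / (1 + t)\<^sup>2"
    proof -
      have "c \<noteq> 0 \<Longrightarrow> t / c * (1 / c) ^ 3 * c\<^sup>2 = t / c\<^sup>2" for c :: real
        by (simp add: power2_eq_square power3_eq_cube)
      then show ?thesis unfolding om using t1 by simp
    qed
    have ln1: "ln (t / (1 + t)) = ln t - ln (1 + t)" using t t1 by (simp add: ln_div)
    have ln2: "ln (1 - t / (1 + t)) = - ln (1 + t)" unfolding om using t1 by (simp add: ln_div)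
    have ln3: "ln (?w (t / (1 + t))) = ln (1 + q * t) - ln (1 + t)" unfolding ww using t1 by (simp add: ln_div)
    have ex: "exp (ln t - (ln (1 + t) + ln (1 + t))) = t / (1 + t)\<^sup>2"
      unfolding exp_diff exp_add using t t1 by (simp only: exp_ln power2_eq_square)
    have "G (t / (1 + t)) = exp (a * (ln t - ln (1 + t)) + (\<beta> - a + 3) * (- ln (1 + t)) - b * (ln (1 + q * t) - ln (1 + t)))"
      unfolding G_def ln1 ln2 ln3 ..
    also have "\<dots> = exp ((a - 1) * ln t + (- \<beta> - 1) * ln (1 + t) + b * (ln (1 + t) - ln (1 + q * t)) + (ln t - (ln (1 + t) + ln (1 + t))))"
      by (simp add: algebra_simps)
    also have "\<dots> = exp ((a - 1) * ln t + (- \<beta> - 1) * ln (1 + t) + b * (ln (1 + t) - ln (1 + q * t))) * (t / (1 + t)\<^sup>2)"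
      unfolding exp_add[of _ "ln t - (ln (1 + t) + ln (1 + t))"] ex ..
    also have "exp ((a - 1) * ln t + (- \<beta> - 1) * ln (1 + t) + b * (ln (1 + t) - ln (1 + q * t))) = edge_density \<epsilon> q a b \<beta> t"
      using t t1 by (simp add: edge_density_def e range_set_eq powr_def exp_add phi_def ln_div)
    finally have G: "G (t / (1 + t)) = edge_density \<epsilon> q a b \<beta> t * (t / (1 + t)\<^sup>2)" .
    have "G (t / (1 + t)) / ?A (t / (1 + t)) * (1 / (1 + t)\<^sup>2) = G (t / (1 + t)) / (?A (t / (1 + t)) * (1 + t)\<^sup>2)"
      by simp
    also have "\<dots> = edge_density \<epsilon> q a b \<beta> t" unfolding A G using t t1 by simp
    finally have *: "G (t / (1 + t)) / ?A (t / (1 + t)) * (1 / (1 + t)\<^sup>2) = edge_density \<epsilon> q a b \<beta> t" .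
    show ?thesis by (simp only: mult.assoc[of \<kappa>] *)
  qed
  have eq: "emeasure (distr M borel X) {x<..y} = emeasure ?N {x<..y}" if xy: "x \<in> {0<..}" "x \<le> y" for x y :: real
  proof -
    let ?z = "\<lambda>t::real. t / (1 + t)"
    have mono: "?z s < ?z t \<longleftrightarrow> s < t" "?z s \<le> ?z t \<longleftrightarrow> s \<le> t" if "0 < s" "0 < t" for s t
      using that by (auto simp: field_simps)
    let ?f = "\<lambda>z. \<kappa> * (G z / ?A z)"
    have "emeasure (distr M borel X) {x<..y} = emeasure M (X -` {x<..y} \<inter> space M)"
      by (rule emeasure_distr) auto
    also have "X -` {x<..y} \<inter> space M = Z -` {?z x<..?z y} \<inter> space M"
      using mono X0 xy by (auto simp: Z_def)
    also have "emeasure M \<dots> = emeasure ?D {?z x<..?z y}"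
      by (rule emeasure_distr[symmetric]) auto
    also have "\<dots> = (\<integral>\<^sup>+z. ennreal (?f z * indicator {0<..<1} z) * indicator {?z x<..?z y} z \<partial>lborel)"
      by (subst \<kappa>(2), subst emeasure_density) auto
    also have "\<dots> = (\<integral>\<^sup>+z. ennreal (?f z * indicator {?z x..?z y} z) \<partial>lborel)"
    proof (rule nn_integral_cong_AE)
      have z: "0 < ?z x" "?z y < 1" using xy by simp_all
      show "AE z in lborel. ennreal (?f z * indicator {0<..<1} z) * indicator {?z x<..?z y} z
        = ennreal (?f z * indicator {?z x..?z y} z)"
        using AE_lborel_singleton[of "?z x"] by eventually_elim (use z in \<open>auto simp: indicator_def\<close>)
    qed
    also have "\<dots> = (\<integral>\<^sup>+t. ennreal (?f (?z t) * (1 / (1 + t)\<^sup>2) * indicator {x..y} t) \<partial>lborel)"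
    proof (rule nn_integral_substitution)
      show "(?z has_real_derivative 1 / (1 + t)\<^sup>2) (at t)" if "t \<in> {x..y}" for t
        using that xy by (auto intro!: derivative_eq_intros simp: power2_eq_square)
      show "continuous_on {x..y} (\<lambda>t. 1 / (1 + t)\<^sup>2)" using xy by (intro continuous_intros) auto
    qed (use xy in \<open>auto simp: set_borel_measurable_def\<close>)
    also have "\<dots> = (\<integral>\<^sup>+t. ennreal (\<kappa> * edge_density \<epsilon> q a b \<beta> t) * indicator {x<..y} t \<partial>lborel)"
    proof (rule nn_integral_cong_AE)
      show "AE t in lborel. ennreal (?f (?z t) * (1 / (1 + t)\<^sup>2) * indicator {x..y} t)
         = ennreal (\<kappa> * edge_density \<epsilon> q a b \<beta> t) * indicator {x<..y} t"
        using AE_lborel_singleton[of x]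
      proof eventually_elim
        case (elim t)
        then show ?case using transform[of t] xy by (cases "t \<in> {x..y}") (auto simp: indicator_def)
      qed
    qed
    also have "\<dots> = emeasure ?N {x<..y}" by (rule emeasure_density[symmetric]) auto
    finally show ?thesis .
  qed
  have "distr M borel X = ?N"
  proof (rule measure_eqI_Ioc_on[where J = "{0<..}" and a = "\<lambda>n. 1 / real (n + 1)" and c = "\<lambda>n. real (n + 1)"])
    show "finite_measure (distr M borel X)" by (rule finite_measure_distr) simp
    have "X -` (- {0<..}) \<inter> space M = {}" using X0 by (auto simp: not_less[symmetric])
    then show "emeasure (distr M borel X) (- {0<..}) = 0" by (subst emeasure_distr) auto
    show "emeasure ?N (- {0<..}) = 0"
      by (subst emeasure_density) (auto intro!: nn_integral_zero' AE_I2 simp: indicator_def edge_density_def range_set_def)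
    have "\<exists>n. z \<in> {1 / real (n + 1)<..real (n + 1)}" if "0 < z" for z :: real
    proof -
      obtain n where "inverse (real (Suc n)) < z" using reals_Archimedean[OF \<open>0 < z\<close>] by blast
      moreover obtain k where "z < real k" using reals_Archimedean2 by blast
      moreover have "1 / real (max n k + 1) \<le> inverse (real (Suc n))" by (simp add: field_simps)
      ultimately have "1 / real (max n k + 1) < z" "z \<le> real (max n k + 1)" by linarith+
      then show ?thesis by (metis greaterThanAtMost_iff)
    qed
    moreover have "z \<in> {0<..}" if "z \<in> {1 / real (n + 1)<..real (n + 1)}" for z n
    proof -
      have "0 < 1 / real (n + 1)" by simp
      with that show ?thesis unfolding greaterThanAtMost_iff greaterThan_iff by linarith
    qed
    ultimately show "{0<..} = (\<Union>n. {1 / real (n + 1)<..real (n + 1)})" by blast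
    show "1 / real (n + 1) \<le> real (n + 1)" for n
      using mult_mono[of 1 "real (n + 1)" 1 "real (n + 1)"] by (simp add: field_simps)
    show "{1 / real (n + 1)..real (n + 1)} \<subseteq> {0<..}" for n
    proof
      fix z assume "z \<in> {1 / real (n + 1)..real (n + 1)}"
      moreover have "0 < 1 / real (n + 1)" by simp
      ultimately show "z \<in> {0<..}" unfolding atLeastAtMost_iff greaterThan_iff by linarith
    qed
    show "decseq (\<lambda>n. 1 / real (n + 1))" by (rule decseq_SucI) (simp add: field_simps)
    show "incseq (\<lambda>n. real (n + 1))" by (rule incseq_SucI) simp
  qed (use eq in auto)
  then show ?thesis using \<kappa>(1) by auto
qed

end


section \<open>Parameters of an edge and their independence of the tilt\<close>

definition base_level :: "real \<Rightarrow> nat" where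
  "base_level \<epsilon> = (if \<epsilon> = 1 then 4 else 0)"

definition slope :: "real \<Rightarrow> (nat \<Rightarrow> nat \<Rightarrow> real) \<Rightarrow> nat \<Rightarrow> real" where
  "slope \<epsilon> R m = lin \<epsilon> (R m) (Suc 0) - lin \<epsilon> (R m) 0"

text \<open>This and \<open>exponent_param\<close> solve lin(t) = (\<beta> + m - a - t) / (\<beta> +
  m) for \<beta> and a: the slope is -1 / (\<beta> + m), and lin(0) - 1 is a times the slope. They
  are read off at \<open>base_level\<close>, which for \<epsilon> = 1 is 4, the first degree at
  which a slope is available.\<close>

definition shift_param :: "real \<Rightarrow> (nat \<Rightarrow> nat \<Rightarrow> real) \<Rightarrow> real" where
  "shift_param \<epsilon> R = - 1 / slope \<epsilon> R (base_level \<epsilon>) - real (base_level \<epsilon>)"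

definition exponent_param :: "real \<Rightarrow> (nat \<Rightarrow> nat \<Rightarrow> real) \<Rightarrow> real" where
  "exponent_param \<epsilon> R = (lin \<epsilon> (R (base_level \<epsilon>)) 0 - 1) / slope \<epsilon> R (base_level \<epsilon>)"

text \<open>The indices at which \<open>lin_linear\<close> applies.\<close>

definition relevant_index :: "real \<Rightarrow> nat \<Rightarrow> nat \<Rightarrow> bool" where
  "relevant_index \<epsilon> m t \<longleftrightarrow> \<epsilon> = -1 \<and> m = 0 \<or> \<epsilon> = 1 \<and> 4 \<le> m \<and> t + 3 \<le> m"

lemma relevant_index_degree:
  "relevant_index \<epsilon> m t \<Longrightarrow> admissible_degree \<epsilon> m (t + 3) \<and> admissible_degree \<epsilon> m 4"
  by (auto simp: relevant_index_def admissible_degree_def)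

theorem (in range_rv) law_of_stein_identities:
  assumes "\<And>m t. relevant_index \<epsilon> m t \<Longrightarrow> stein_identity a b \<beta> m t"
  shows "\<exists>\<kappa>>0. distr M borel X = density lborel (\<lambda>x. ennreal (\<kappa> * edge_density \<epsilon> q a b \<beta> x))"
  using law_eps_minus[of a b \<beta>] law_eps_plus[of a b \<beta>] assms q
  by (auto simp: admissible_weight_def relevant_index_def)

context edge_pair
begin

text \<open>This link between consecutive tilting exponents makes the parameters independent of \<open>m\<close>.\<close>

lemma level_step:
  assumes e: "\<epsilon> = 1"
  shows "\<exists>d>0. \<forall>t. t + 1 \<le> m \<longrightarrow> R m t = d * (R (Suc m) t + R (Suc m) (Suc t))"
proof (cases "m = 0")
  case False
  have ad: "admissible_degree \<epsilon> n k" if "k \<le> n" for n k using that e by (simp add: admissible_degree_def)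
  define S0 S1 where "S0 = S (Suc m) 0" and "S1 = S (Suc m) (Suc 0)"
  have S: "0 < S0" "0 < S1" "0 < S m 0" using False by (auto simp: S0_def S1_def intro!: S_pos ad)
  \<comment> \<open>Only s = 0 is used, so the proportionality factor involves \<open>S\<close>
    alone and is the same for every \<open>t\<close>.\<close>
  have "R m t = S m 0 / (S0 + S1) * (R (Suc m) t + R (Suc m) (Suc t))" if t: "t + 1 \<le> m" for t
  proof -
    define R0 R1 where "R0 = R (Suc m) t" and "R1 = R (Suc m) (Suc t)"
    define F F1 F2 where "F = X.moment (Suc m) t 0" and "F1 = X.moment (Suc m) (Suc t) 0"
      and "F2 = X.moment (Suc m) t (Suc 0)"
    define U0 U1 where "U0 = U.moment (Suc m) 0 t" and "U1 = U.moment (Suc m) (Suc 0) t"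
    have pos: "0 < R0" "0 < R1" "0 < F" "0 < F1"
      unfolding R0_def R1_def F_def F1_def using t by (auto intro!: R_pos X.moment_pos ad)
    define \<rho> \<sigma> where "\<rho> = R1 / R0" and "\<sigma> = S1 / S0"
    have "(\<rho> - \<sigma>) * F - (1 + \<sigma>) * F1 + \<sigma> * (1 + \<rho>) * F2 = 0"
      using contiguous[OF ad, of t 0 "Suc m"] t e
      by (simp add: ratio_def \<rho>_def \<sigma>_def R0_def R1_def S0_def S1_def F_def F1_def F2_def)
    moreover have "R1 = \<rho> * R0" "S1 = \<sigma> * S0" using pos S by (simp_all add: \<rho>_def \<sigma>_def)
    ultimately have C: "(R1 * S0 - S1 * R0) * F - (S0 + S1) * R0 * F1 + S1 * (R0 + R1) * F2 = 0"
      by algebra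
    have "(F + F1) * S m 0 = (U0 + U1) * R m t"
      using reversal[OF ad, of t 0 m] X.moment_level[OF ad e, of t 0 m] U.moment_level[OF ad e, of 0 t m] t
      by (simp add: F_def F1_def U0_def U1_def)
    moreover have "F * S0 = U0 * R0" "F2 * S1 = U1 * R0"
      using reversal[OF ad, of t 0 "Suc m"] reversal[OF ad, of t "Suc 0" "Suc m"] t
      by (simp_all add: F_def F2_def U0_def U1_def S0_def S1_def R0_def)
    ultimately have "(F + F1) * R0 * (R m t * (S0 + S1) - S m 0 * (R0 + R1)) = 0" using C by algebra
    then have "R m t * (S0 + S1) = S m 0 * (R0 + R1)" using pos by simp
    then show ?thesis using S by (simp add: R0_def R1_def field_simps)
  qed
  then show ?thesis using S by (intro exI[of _ "S m 0 / (S0 + S1)"]) auto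
qed (auto intro: exI[of _ 1])

end

context regular_edge_pair
begin

text \<open>For \<epsilon> = 1, \<open>lin\<close> is r / (r + r') for consecutive values r, r' of
  the sequence. By \<open>level_step\<close> the values at tilt \<open>m\<close> are sums of
  neighbouring values at tilt \<open>Suc m\<close>, and the common factor cancels.\<close>

lemma lin_level_step:
  assumes e: "\<epsilon> = 1" and i: "i + 2 \<le> m"
  shows "lin \<epsilon> (R m) i = lin \<epsilon> (R (Suc m)) (Suc i) / (1 + lin \<epsilon> (R (Suc m)) (Suc i) - lin \<epsilon> (R (Suc m)) i)"
proof -
  define r0 r1 r2 where "r0 = R (Suc m) i" and "r1 = R (Suc m) (Suc i)" and "r2 = R (Suc m) (Suc (Suc i))"
  have pos: "0 < r0" "0 < r1" "0 < r2"
    unfolding r0_def r1_def r2_def using e i by (auto intro!: R_pos simp: admissible_degree_def)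
  obtain d where d: "0 < d" "\<And>t. t + 1 \<le> m \<Longrightarrow> R m t = d * (R (Suc m) t + R (Suc m) (Suc t))"
    using level_step[OF e, of m] by blast
  have "R m i = d * (r0 + r1)" "R m (Suc i) = d * (r1 + r2)"
    using d(2)[of i] d(2)[of "Suc i"] i by (simp_all add: r0_def r1_def r2_def)
  then have L: "lin \<epsilon> (R m) i = (r0 + r1) / ((r0 + r1) + (r1 + r2))"
    using d(1) pos e by (simp add: lin_def ratio_def divide_simps)
  have X: "lin \<epsilon> (R (Suc m)) i = r0 / (r0 + r1)" "lin \<epsilon> (R (Suc m)) (Suc i) = r1 / (r1 + r2)"
    using pos e by (simp_all add: lin_def ratio_def r0_def r1_def r2_def divide_simps)
  have "1 + r1 / (r1 + r2) - r0 / (r0 + r1) = r1 * ((r0 + r1) + (r1 + r2)) / ((r1 + r2) * (r0 + r1))"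
    using pos by (simp add: divide_simps) (simp add: algebra_simps)
  then show ?thesis unfolding L X using pos by simp
qed

text \<open>The second equation says that -1 / slope drops by exactly 1 from \<open>Suc m\<close> to
  \<open>m\<close>; the third says that the quotient of \<open>lin\<close> at 0 minus 1 by the slope
  stays the same. Hence both parameters are independent of the tilt.\<close>

lemma slope_level_step:
  assumes e: "\<epsilon> = 1" and m: "4 \<le> m"
  defines "c \<equiv> slope \<epsilon> R (Suc m)"
  shows "0 < 1 + c" "slope \<epsilon> R m = c / (1 + c)" "1 - lin \<epsilon> (R m) 0 = (1 - lin \<epsilon> (R (Suc m)) 0) / (1 + c)"
proof -
  define x where "x = lin \<epsilon> (R (Suc m))"
  have ad: "admissible_degree \<epsilon> (Suc m) (Suc 0 + 3)" "admissible_degree \<epsilon> (Suc m) (Suc (Suc 0) + 3)"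
    "admissible_degree \<epsilon> (Suc m) 4" "admissible_degree \<epsilon> (Suc m) (Suc 0)" "admissible_degree \<epsilon> (Suc m) (Suc (Suc 0))"
    using e m by (auto simp: admissible_degree_def)
  have x1: "x 1 = x 0 + c" "x 2 = x 0 + 2 * c"
    using lin_linear[OF ad(1,3)] lin_linear[OF ad(2,3)] by (simp_all add: x_def c_def slope_def numeral_2_eq_2)
  have "0 < x 1" "x 0 < 1" using lin_bounds[OF ad(4)] lin_bounds[OF ad(5)] e by (auto simp: x_def)
  then show "0 < 1 + c" using x1 by simp
  have "lin \<epsilon> (R m) 0 = x 1 / (1 + c)" "lin \<epsilon> (R m) (Suc 0) = x 2 / (1 + c)"
    using lin_level_step[OF e, of 0 m] lin_level_step[OF e, of "Suc 0" m] m x1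
    by (simp_all add: x_def numeral_2_eq_2)
  then show "slope \<epsilon> R m = c / (1 + c)" "1 - lin \<epsilon> (R m) 0 = (1 - lin \<epsilon> (R (Suc m)) 0) / (1 + c)"
    using x1 \<open>0 < 1 + c\<close> by (simp_all add: slope_def x_def[symmetric] diff_divide_distrib[symmetric] field_simps)
qed

lemma slope_nz: "admissible_degree \<epsilon> m 4 \<Longrightarrow> slope \<epsilon> R m \<noteq> 0"
  using slope_nonzero by (simp add: slope_def)

lemma slope_swap: "admissible_degree \<epsilon> m 4 \<Longrightarrow> slope \<epsilon> R m = slope \<epsilon> S m"
  using lin_slope[of m 0 0] by (simp add: slope_def)

lemma shift_param_swap: "shift_param \<epsilon> R = shift_param \<epsilon> S"
proof -
  have "admissible_degree \<epsilon> (base_level \<epsilon>) 4"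
    using X.q by (auto simp: admissible_weight_def admissible_degree_def base_level_def)
  then show ?thesis by (simp add: shift_param_def slope_swap)
qed

lemma params_level:
  assumes "relevant_index \<epsilon> m 0"
  shows "shift_param \<epsilon> R + real m = - 1 / slope \<epsilon> R m \<and> exponent_param \<epsilon> R = (lin \<epsilon> (R m) 0 - 1) / slope \<epsilon> R m"
proof (cases "\<epsilon> = 1")
  case True
  then have "4 \<le> m" using assms by (auto simp: relevant_index_def)
  then show ?thesis
  proof (induction m rule: nat_induct_at_least)
    case base
    then show ?case using True by (simp add: shift_param_def exponent_param_def base_level_def)
  next
    case (Suc m)
    note st = slope_level_step[OF True \<open>4 \<le> m\<close>]
    have nz: "slope \<epsilon> R (Suc m) \<noteq> 0" using True Suc.hyps by (intro slope_nz) (simp add: admissible_degree_def)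
    have "lin \<epsilon> (R m) 0 - 1 = (lin \<epsilon> (R (Suc m)) 0 - 1) / (1 + slope \<epsilon> R (Suc m))"
      using st(3) by (simp add: minus_divide_left[symmetric] minus_diff_eq[symmetric, of 1] del: minus_diff_eq)
    then show ?case using Suc.IH st(1) nz unfolding st(2) by (simp add: field_simps)
  qed
next
  case False
  then have "m = 0" using assms by (auto simp: relevant_index_def)
  then show ?thesis using False by (simp add: shift_param_def exponent_param_def base_level_def)
qed

lemma lin_params:
  assumes "relevant_index \<epsilon> m t"
  shows "lin \<epsilon> (R m) t * (shift_param \<epsilon> R + real m) = shift_param \<epsilon> R + real m - exponent_param \<epsilon> R - real t"
    "shift_param \<epsilon> R + real m \<noteq> 0"
proof -
  have ad: "admissible_degree \<epsilon> m (t + 3)" "admissible_degree \<epsilon> m 4"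
    using relevant_index_degree[OF assms] by auto
  have "relevant_index \<epsilon> m 0" using assms by (auto simp: relevant_index_def)
  note P = params_level[OF this]
  define c where "c = slope \<epsilon> R m"
  have c: "c \<noteq> 0" using slope_nz[OF ad(2)] by (simp add: c_def)
  have l: "lin \<epsilon> (R m) t = lin \<epsilon> (R m) 0 + c * real t" using lin_linear[OF ad] by (simp add: c_def slope_def)
  have u: "shift_param \<epsilon> R + real m = - 1 / c" "exponent_param \<epsilon> R = (lin \<epsilon> (R m) 0 - 1) / c"
    using P by (simp_all add: c_def)
  show "lin \<epsilon> (R m) t * (shift_param \<epsilon> R + real m) = shift_param \<epsilon> R + real m - exponent_param \<epsilon> R - real t"
    unfolding l u using c by (simp add: field_simps)
  show "shift_param \<epsilon> R + real m \<noteq> 0" unfolding u using c by simp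
qed

text \<open>This is \<open>lin_contiguous\<close> at s = 0, multiplied by \<beta> + m so that the
  affine values of \<open>lin\<close> can be inserted.\<close>

lemma edge_stein_identity:
  assumes "relevant_index \<epsilon> m t"
    and b: "lin \<epsilon> (S m) 0 * (shift_param \<epsilon> R + real m) = shift_param \<epsilon> R + real m - b"
  shows "X.stein_identity (exponent_param \<epsilon> R) b (shift_param \<epsilon> R) m t"
proof -
  have "admissible_degree \<epsilon> m (t + 0 + 2)"
    using relevant_index_degree[OF assms(1)] by (auto intro: admissible_degree_mono)
  note C = lin_contiguous[OF this]
  define u where "u = shift_param \<epsilon> R + real m"
  have "lin \<epsilon> (R m) t * u = u - exponent_param \<epsilon> R - real t" "lin \<epsilon> (S m) 0 * u = u - b"
    using lin_params(1)[OF assms(1)] b by (simp_all add: u_def)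
  then have "(b - exponent_param \<epsilon> R - real t) * X.moment m t 0
     + \<epsilon> * (u - exponent_param \<epsilon> R - real t) * X.moment m (Suc t) 0 - b * X.moment m t (Suc 0) = 0"
    using C by algebra
  then show ?thesis by (simp add: X.stein_identity_def u_def)
qed

text \<open>For \<epsilon> = -1 all values of \<open>lin\<close> exceed 1, which an affine sequence
  of negative slope cannot maintain; slope 0 is excluded already.\<close>

lemma param_signs: "0 < exponent_param \<epsilon> R" "\<epsilon> = -1 \<Longrightarrow> shift_param \<epsilon> R < 0"
proof -
  have minus: "0 < exponent_param \<epsilon> R \<and> shift_param \<epsilon> R < 0" if e: "\<epsilon> = -1"
  proof -
    define c where "c = slope \<epsilon> R 0"
    have ad: "admissible_degree \<epsilon> 0 n" for n using e by (simp add: admissible_degree_def)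
    have gt: "1 < lin \<epsilon> (R 0) t" for t using lin_bounds(1)[OF ad, of t] e by simp
    have l: "lin \<epsilon> (R 0) t = lin \<epsilon> (R 0) 0 + c * real t" for t
      unfolding c_def slope_def by (rule lin_linear[OF ad ad])
    have "0 \<le> c"
    proof (rule ccontr)
      assume "\<not> 0 \<le> c"
      obtain n where "(lin \<epsilon> (R 0) 0 - 1) / (- c) < real n" using reals_Archimedean2 by blast
      moreover have "0 < - c" using \<open>\<not> 0 \<le> c\<close> by simp
      ultimately have "lin \<epsilon> (R 0) 0 - 1 < real n * (- c)" using pos_divide_less_eq by blast
      then have "lin \<epsilon> (R 0) 0 + c * real n < 1" by (simp add: algebra_simps)
      then show False using gt[of n] unfolding l[of n] by linarith
    qed
    moreover have "c \<noteq> 0" using slope_nz[OF ad] by (simp add: c_def)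
    ultimately have "0 < c" by simp
    moreover have "base_level \<epsilon> = 0" using e by (simp add: base_level_def)
    ultimately have "exponent_param \<epsilon> R = (lin \<epsilon> (R 0) 0 - 1) / c" "shift_param \<epsilon> R = - 1 / c"
      by (simp_all add: exponent_param_def shift_param_def c_def)
    then show ?thesis using gt[of 0] \<open>0 < c\<close> by simp
  qed
  then show "\<epsilon> = -1 \<Longrightarrow> shift_param \<epsilon> R < 0" by blast
  show "0 < exponent_param \<epsilon> R"
  proof (cases "\<epsilon> = 1")
    case True
    \<comment> \<open>For \<epsilon> = 1 the sign of the shift is not known, so the sign of the
      exponent is read off at a tilt large enough to make
      \<open>shift_param \<epsilon> R + real m\<close> positive.\<close>
    obtain n where n: "- shift_param \<epsilon> R < real n" using reals_Archimedean2 by blast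
    define m where "m = max 4 n"
    have m: "relevant_index \<epsilon> m 0" "0 < shift_param \<epsilon> R + real m" "admissible_degree \<epsilon> m (Suc 0)"
      using n True by (auto simp: relevant_index_def m_def admissible_degree_def)
    have "lin \<epsilon> (R m) 0 < 1" using lin_bounds(1)[OF m(3)] True by simp
    moreover have "exponent_param \<epsilon> R = (1 - lin \<epsilon> (R m) 0) * (shift_param \<epsilon> R + real m)"
      using lin_params(1)[OF m(1)] by (simp add: algebra_simps)
    ultimately show ?thesis using m(2) by simp
  next
    case False
    then show ?thesis using minus X.q by (auto simp: admissible_weight_def)
  qed
qed

end

text \<open>The root message has no receiving vertex, which amounts to b = 0. Its own moments have
  the ratios of \<open>R\<close>, so the formula for \<open>lin\<close> already is the Stein
  identity.\<close>

lemma (in range_rv) root_stein_identity: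
  assumes R: "\<And>t. admissible_degree \<epsilon> m t \<Longrightarrow> R t = moment m t 0 / moment m 0 0"
    and l: "lin \<epsilon> R t * (\<beta> + real m) = \<beta> + real m - a - real t" "1 + \<epsilon> * ratio R t \<noteq> 0"
    and ad: "admissible_degree \<epsilon> m (Suc t)"
  shows "stein_identity a 0 \<beta> m t"
proof -
  note mono = admissible_degree_mono[OF ad]
  define F F1 where "F = moment m t 0" and "F1 = moment m (Suc t) 0"
  have pos: "0 < F" "0 < moment m 0 0" unfolding F_def by (auto intro!: moment_pos mono)
  have "R (Suc t) = F1 / moment m 0 0" "R t = F / moment m 0 0"
    using R[OF ad] R[OF mono, of t] by (simp_all add: F_def F1_def)
  then have r: "ratio R t * F = F1" using pos by (simp add: ratio_def)
  define u where "u = \<beta> + real m"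
  have "lin \<epsilon> R t * (1 + \<epsilon> * ratio R t) = 1" using l(2) by (simp add: lin_def)
  moreover have "lin \<epsilon> R t * u = u - a - real t" using l(1) by (simp add: u_def)
  ultimately have "(- a - real t) * F + \<epsilon> * (u - a - real t) * F1 = 0" using r by algebra
  then show ?thesis by (simp add: stein_identity_def F_def F1_def u_def)
qed

section \<open>Triangular change of variables\<close>

text \<open>Fubini isolates the coordinate \<open>w\<close>; the factor \<open>c x\<close> is
  constant along it, so the inner integral only undergoes a linear substitution.\<close>

lemma scale_coordinate:
  fixes c :: "('v \<Rightarrow> real) \<Rightarrow> real" and F :: "('v \<Rightarrow> real) \<Rightarrow> ennreal"
  assumes "finite V" "w \<in> V"
    and c_meas: "c \<in> borel_measurable (\<Pi>\<^sub>M v\<in>V. lborel)" and c_pos: "\<And>x. 0 < c x"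
    and c_upd: "\<And>x y. c (x(w := y)) = c x"
    and F: "F \<in> borel_measurable (\<Pi>\<^sub>M v\<in>V. lborel)"
  shows "(\<integral>\<^sup>+x. F (x(w := x w * c x)) * ennreal (c x) \<partial>(\<Pi>\<^sub>M v\<in>V. lborel)) = (\<integral>\<^sup>+x. F x \<partial>(\<Pi>\<^sub>M v\<in>V. lborel))"
proof -
  interpret product_sigma_finite "\<lambda>_::'v. lborel :: real measure" by standard
  define I where "I = V - {w}"
  have V: "V = insert w I" "w \<notin> I" "finite I" using assms by (auto simp: I_def)
  let ?L = "\<lambda>_::'v. lborel :: real measure"
  have upd: "(\<lambda>x. x(w := x w * c x)) \<in> measurable (Pi\<^sub>M V ?L) (Pi\<^sub>M V ?L)"
  proof (rule measurable_PiM_single')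
    fix i assume "i \<in> V"
    show "(\<lambda>x. (x(w := x w * c x)) i) \<in> measurable (Pi\<^sub>M V ?L) lborel"
    proof (cases "i = w")
      case True
      have "(\<lambda>x. x w) \<in> borel_measurable (Pi\<^sub>M V ?L)"
        using measurable_component_singleton[OF assms(2), of ?L] by simp
      then show ?thesis using c_meas True by simp
    next
      case False
      then show ?thesis using measurable_component_singleton[OF \<open>i \<in> V\<close>, of ?L] by simp
    qed
  qed (use assms(2) in \<open>auto simp: space_PiM PiE_iff extensional_def\<close>)
  have "(\<lambda>x. F (x(w := x w * c x))) \<in> borel_measurable (Pi\<^sub>M V ?L)"
    using measurable_compose[OF upd F] .
  then have G: "(\<lambda>x. F (x(w := x w * c x)) * ennreal (c x)) \<in> borel_measurable (Pi\<^sub>M V ?L)"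
    using c_meas by simp
  have "(\<integral>\<^sup>+x. F (x(w := x w * c x)) * ennreal (c x) \<partial>Pi\<^sub>M V ?L)
    = (\<integral>\<^sup>+x. (\<integral>\<^sup>+y. F ((x(w := y))(w := (x(w := y)) w * c (x(w := y)))) * ennreal (c (x(w := y))) \<partial>lborel) \<partial>Pi\<^sub>M I ?L)"
    using G unfolding V(1) by (rule product_nn_integral_insert[OF V(3,2)])
  also have "\<dots> = (\<integral>\<^sup>+x. (\<integral>\<^sup>+y. F (x(w := y)) \<partial>lborel) \<partial>Pi\<^sub>M I ?L)"
  proof (rule nn_integral_cong)
    fix x assume x: "x \<in> space (Pi\<^sub>M I ?L)"
    have m: "(\<lambda>y. F (x(w := y))) \<in> borel_measurable borel"
    proof -
      have "(\<lambda>y. x(w := y)) \<in> measurable lborel (Pi\<^sub>M V ?L)"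
        unfolding V(1) by (rule measurable_component_update[OF x V(2)])
      from measurable_compose[OF this F] show ?thesis by simp
    qed
    have "(\<integral>\<^sup>+y. F ((x(w := y))(w := (x(w := y)) w * c (x(w := y)))) * ennreal (c (x(w := y))) \<partial>lborel)
      = (\<integral>\<^sup>+y. ennreal (c x) * F (x(w := 0 + c x * y)) \<partial>lborel)"
      by (simp add: c_upd mult.commute)
    also have "\<dots> = ennreal (c x) * (\<integral>\<^sup>+y. F (x(w := 0 + c x * y)) \<partial>lborel)"
      using measurable_compose[OF _ m, of "\<lambda>y. 0 + c x * y" borel] by (intro nn_integral_cmult) simp
    also have "\<dots> = (\<integral>\<^sup>+y. F (x(w := y)) \<partial>lborel)"
      using nn_integral_real_affine[OF m, of "c x" 0] c_pos[of x] by simp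
    finally show "(\<integral>\<^sup>+y. F ((x(w := y))(w := (x(w := y)) w * c (x(w := y)))) * ennreal (c (x(w := y))) \<partial>lborel)
      = (\<integral>\<^sup>+y. F (x(w := y)) \<partial>lborel)" .
  qed
  also have "\<dots> = (\<integral>\<^sup>+x. F x \<partial>Pi\<^sub>M V ?L)"
    using F unfolding V(1) by (rule product_nn_integral_insert[OF V(3,2), symmetric])
  finally show ?thesis .
qed

text \<open>
  The scaling factor of a coordinate may depend on the coordinates of smaller rank only, so the
  map is a composition of single-coordinate scalings and its Jacobian is the product of the factors.
\<close>

lemma triangular_scaling:
  fixes c :: "'v \<Rightarrow> ('v \<Rightarrow> real) \<Rightarrow> real" and rank :: "'v \<Rightarrow> nat" and F :: "('v \<Rightarrow> real) \<Rightarrow> ennreal"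
  assumes "finite V"
    and c_meas: "\<And>v. v \<in> V \<Longrightarrow> c v \<in> borel_measurable (\<Pi>\<^sub>M v\<in>V. lborel)"
    and c_pos: "\<And>v x. v \<in> V \<Longrightarrow> 0 < c v x"
    and c_upd: "\<And>v u x y. v \<in> V \<Longrightarrow> rank v \<le> rank u \<Longrightarrow> c v (x(u := y)) = c v x"
    and F: "F \<in> borel_measurable (\<Pi>\<^sub>M v\<in>V. lborel)"
  shows "(\<integral>\<^sup>+x. F (\<lambda>v\<in>V. x v * c v x) * (\<Prod>v\<in>V. ennreal (c v x)) \<partial>(\<Pi>\<^sub>M v\<in>V. lborel))
       = (\<integral>\<^sup>+x. F x \<partial>(\<Pi>\<^sub>M v\<in>V. lborel))"
proof -
  let ?P = "\<Pi>\<^sub>M v\<in>V. (lborel :: real measure)"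
  define T where "T I x = (\<lambda>v\<in>V. if v \<in> I then x v * c v x else x v)" for I x
  have T_meas: "T I \<in> measurable ?P ?P" for I
    unfolding T_def
  proof (rule measurable_restrict)
    fix v assume v: "v \<in> V"
    have "(\<lambda>x. x v) \<in> borel_measurable ?P"
      using measurable_component_singleton[OF v, of "\<lambda>_. lborel :: real measure"] by simp
    then show "(\<lambda>x. if v \<in> I then x v * c v x else x v) \<in> measurable ?P lborel"
      using c_meas[OF v] by simp
  qed
  have "I \<subseteq> V \<longrightarrow> (\<integral>\<^sup>+x. F (T I x) * (\<Prod>v\<in>I. ennreal (c v x)) \<partial>?P) = (\<integral>\<^sup>+x. F x \<partial>?P)" if "finite I" for I
    using that
  \<comment> \<open>The new \<open>w\<close> has the largest rank so far. The factors of the old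
    coordinates are therefore unaffected by rescaling \<open>w\<close> first, and
    \<open>T (insert w I)\<close> is \<open>T I\<close> after that rescaling.\<close>
  proof (induction I rule: finite_ranking_induct[where f = rank])
    case empty
    have "T {} x = x" if "x \<in> space ?P" for x
      using that by (auto simp: T_def space_PiM PiE_iff extensional_def restrict_def)
    then show ?case by (auto intro!: nn_integral_cong)
  next
    case (insert w I)
    show ?case
    proof (cases "w \<in> I")
      case True
      then show ?thesis using insert.IH by (simp add: insert_absorb)
    next
      case False
      show ?thesis
      proof
        assume sub: "insert w I \<subseteq> V"
        define G where "G x = F (T I x) * (\<Prod>v\<in>I. ennreal (c v x))" for x
        have G: "G \<in> borel_measurable ?P"
          unfolding G_def
        proof (intro borel_measurable_times_ennreal borel_measurable_prod_ennreal)
          show "(\<lambda>x. F (T I x)) \<in> borel_measurable ?P" by (rule measurable_compose[OF T_meas F])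
          show "(\<lambda>x. ennreal (c v x)) \<in> borel_measurable ?P" if "v \<in> I" for v
            using sub that by (intro measurable_compose[OF c_meas measurable_ennreal]) auto
        qed
        have "(\<integral>\<^sup>+x. F (T (insert w I) x) * (\<Prod>v\<in>insert w I. ennreal (c v x)) \<partial>?P)
          = (\<integral>\<^sup>+x. G (x(w := x w * c w x)) * ennreal (c w x) \<partial>?P)"
        proof (rule nn_integral_cong)
          fix x
          have c: "c v (x(w := x w * c w x)) = c v x" if "v \<in> I" for v
            using c_upd[of v w] insert.hyps(2)[OF that] that sub by blast
          have "T (insert w I) x = T I (x(w := x w * c w x))"
          proof
            fix v show "T (insert w I) x v = T I (x(w := x w * c w x)) v"
              using c[of v] False sub by (cases "v = w"; cases "v \<in> I") (auto simp: T_def restrict_def)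
          qed
          moreover have "(\<Prod>v\<in>insert w I. ennreal (c v x))
              = (\<Prod>v\<in>I. ennreal (c v (x(w := x w * c w x)))) * ennreal (c w x)"
            using False insert.hyps(1) c by (simp add: mult.commute)
          ultimately show "F (T (insert w I) x) * (\<Prod>v\<in>insert w I. ennreal (c v x))
              = G (x(w := x w * c w x)) * ennreal (c w x)"
            by (simp add: G_def mult_ac)
        qed
        also have "\<dots> = (\<integral>\<^sup>+x. G x \<partial>?P)"
          by (rule scale_coordinate[OF assms(1) _ c_meas c_pos c_upd G]) (use sub in auto)
        also have "\<dots> = (\<integral>\<^sup>+x. F x \<partial>?P)"
          using insert.IH sub by (auto simp: G_def)
        finally show "(\<integral>\<^sup>+x. F (T (insert w I) x) * (\<Prod>v\<in>insert w I. ennreal (c v x)) \<partial>?P) = (\<integral>\<^sup>+x. F x \<partial>?P)" .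
      qed
    qed
  qed
  from this[OF assms(1)] have "(\<integral>\<^sup>+x. F (T V x) * (\<Prod>v\<in>V. ennreal (c v x)) \<partial>?P) = (\<integral>\<^sup>+x. F x \<partial>?P)" by simp
  moreover have "T V x = (\<lambda>v\<in>V. x v * c v x)" for x by (auto simp: T_def)
  ultimately show ?thesis by simp
qed

lemma PiM_density:
  fixes p :: "'v \<Rightarrow> real \<Rightarrow> ennreal"
  assumes "finite V" and N: "\<And>v. prob_space (N v)" and p: "\<And>v. v \<in> V \<Longrightarrow> p v \<in> borel_measurable borel"
    and eq: "\<And>v. v \<in> V \<Longrightarrow> N v = density lborel (p v)"
  shows "Pi\<^sub>M V N = density (\<Pi>\<^sub>M v\<in>V. lborel) (\<lambda>x. \<Prod>v\<in>V. p v (x v))"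
proof -
  interpret L: product_sigma_finite "\<lambda>_::'v. lborel :: real measure" by standard
  interpret N: product_sigma_finite N
    unfolding product_sigma_finite_def using prob_space_imp_sigma_finite[OF N] by blast
  let ?P = "\<Pi>\<^sub>M v\<in>V. (lborel :: real measure)"
  have pm: "(\<lambda>x. p v (x v)) \<in> borel_measurable ?P" if "v \<in> V" for v
    using measurable_compose[OF measurable_component_singleton[OF that, of "\<lambda>_. lborel :: real measure"]] p[OF that] by simp
  then have prodm: "(\<lambda>x. \<Prod>v\<in>V. p v (x v)) \<in> borel_measurable ?P" by (intro borel_measurable_prod_ennreal)
  have "density ?P (\<lambda>x. \<Prod>v\<in>V. p v (x v)) = Pi\<^sub>M V N"
  proof (rule N.PiM_eqI[OF assms(1)])
    show "sets (density ?P (\<lambda>x. \<Prod>v\<in>V. p v (x v))) = sets (Pi\<^sub>M V N)"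
      by (simp, rule sets_PiM_cong) (use eq in auto)
    fix A assume A: "\<And>i. i \<in> V \<Longrightarrow> A i \<in> sets (N i)"
    then have A': "\<And>i. i \<in> V \<Longrightarrow> A i \<in> sets borel" using eq by auto
    then have AP: "Pi\<^sub>E V A \<in> sets ?P" using assms(1) by (intro sets_PiM_I_finite) auto
    have "emeasure (density ?P (\<lambda>x. \<Prod>v\<in>V. p v (x v))) (Pi\<^sub>E V A)
      = (\<integral>\<^sup>+x. (\<Prod>v\<in>V. p v (x v)) * indicator (Pi\<^sub>E V A) x \<partial>?P)"
      by (rule emeasure_density[OF prodm AP])
    also have "\<dots> = (\<integral>\<^sup>+x. (\<Prod>v\<in>V. p v (x v) * indicator (A v) (x v)) \<partial>?P)"
    proof (rule nn_integral_cong)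
      fix x assume x: "x \<in> space ?P"
      have "indicator (Pi\<^sub>E V A) x = (\<Prod>v\<in>V. indicator (A v) (x v) :: ennreal)"
      proof (cases "x \<in> Pi\<^sub>E V A")
        case True
        then show ?thesis by (auto simp: PiE_iff intro!: prod.neutral[symmetric])
      next
        case False
        then obtain v where "v \<in> V" "x v \<notin> A v" using x by (auto simp: space_PiM PiE_iff)
        then have "(\<Prod>v\<in>V. indicator (A v) (x v) :: ennreal) = 0"
          using assms(1) by (intro prod_zero bexI[of _ v]) auto
        then show ?thesis using False by simp
      qed
      then show "(\<Prod>v\<in>V. p v (x v)) * indicator (Pi\<^sub>E V A) x = (\<Prod>v\<in>V. p v (x v) * indicator (A v) (x v))"
        by (simp add: prod.distrib)
    qed
    also have "\<dots> = (\<Prod>v\<in>V. \<integral>\<^sup>+y. p v y * indicator (A v) y \<partial>lborel)"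
      by (rule L.product_nn_integral_prod[OF assms(1)]) (use p A' in auto)
    also have "\<dots> = (\<Prod>v\<in>V. emeasure (N v) (A v))"
      using p A' eq by (intro prod.cong refl) (simp add: emeasure_density)
    finally show "emeasure (density ?P (\<lambda>x. \<Prod>v\<in>V. p v (x v))) (Pi\<^sub>E V A) = (\<Prod>v\<in>V. emeasure (N v) (A v))" .
  qed
  then show ?thesis by simp
qed

section \<open>Messages in a tree\<close>

text \<open>Common form of the two domains. For \<epsilon> = -1 the bound \<open>k v < 1\<close> is
  the condition at U = {v}; for \<epsilon> = 1 and nonnegative weights the polynomial conditions
  hold automatically.\<close>

definition signed_domain :: "'v set \<Rightarrow> 'v set set \<Rightarrow> ('v set \<Rightarrow> real) \<Rightarrow> real \<Rightarrow> ('v \<Rightarrow> real) set" where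
  "signed_domain V E q \<epsilon> = {k \<in> (\<Pi>\<^sub>E v\<in>V. {0<..}). \<forall>U\<subseteq>V. 0 < graph_delta E q U (\<lambda>v. \<epsilon> * k v)}"

lemma ratio_scale: "k \<noteq> 0 \<Longrightarrow> ratio (\<lambda>t. f t * k) = ratio f"
  by (simp add: ratio_def fun_eq_iff)

lemma lin_scale: "k \<noteq> 0 \<Longrightarrow> lin \<epsilon> (\<lambda>t. f t * k) = lin \<epsilon> f"
  by (simp add: lin_def fun_eq_iff ratio_scale)

lemma params_scale:
  assumes "k (base_level \<epsilon>) \<noteq> 0"
  shows "shift_param \<epsilon> (\<lambda>m t. R m t * k m) = shift_param \<epsilon> R"
    "exponent_param \<epsilon> (\<lambda>m t. R m t * k m) = exponent_param \<epsilon> R"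
  using assms by (simp_all add: shift_param_def exponent_param_def slope_def lin_scale)

locale tree_law = finite_tree V E + prob_space M
  for V :: "'v set" and E :: "'v set set" and M :: "'a measure" +
  fixes \<epsilon> :: real and q :: "'v set \<Rightarrow> real" and K :: "'a \<Rightarrow> 'v \<Rightarrow> real"
  assumes weight: "\<And>e. e \<in> E \<Longrightarrow> admissible_weight \<epsilon> (q e)"
    and K_meas [measurable]: "K \<in> measurable M (\<Pi>\<^sub>M v\<in>V. borel)"
    and K_dom: "\<And>\<omega>. \<omega> \<in> space M \<Longrightarrow> K \<omega> \<in> signed_domain V E q \<epsilon>"
    and indep_messages: "\<And>l. l \<in> graph_leaves V E \<Longrightarrow>
      indep_vars (\<lambda>_. borel) (\<lambda>v \<omega>. \<epsilon> * branch_ratio q (\<lambda>u. \<epsilon> * K \<omega> u) (subtree l v) v) V"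
    and non_const_messages: "\<And>l v. l \<in> graph_leaves V E \<Longrightarrow> v \<in> V \<Longrightarrow>
      \<not> (\<exists>c. AE \<omega> in M. \<epsilon> * branch_ratio q (\<lambda>u. \<epsilon> * K \<omega> u) (subtree l v) v = c)"
begin

text \<open>
  \<open>message (subtree r v) v k\<close> is \<open>\<Psi>\<^sup>(\<^sup>r\<^sup>)\<^sub>v(k)\<close> for \<open>\<epsilon> = -1\<close> and \<open>\<psi>\<^sup>(\<^sup>r\<^sup>)\<^sub>v(k)\<close> for \<open>\<epsilon> = 1\<close>. It depends on \<open>r\<close> only
  through the parent of \<open>v\<close>.
\<close>

definition message :: "'v set \<Rightarrow> 'v \<Rightarrow> ('v \<Rightarrow> real) \<Rightarrow> real" where
  "message U v k = \<epsilon> * branch_ratio q (\<lambda>u. \<epsilon> * k u) U v"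

lemma exists_edge: "\<exists>v w. {v, w} \<in> E"
proof -
  have "V \<noteq> {}" using card_V by auto
  then show ?thesis using exists_neighbour by (auto simp: neighbours_def)
qed

lemma eps_sq: "\<epsilon> * \<epsilon> = 1"
  using exists_edge weight admissible_weightD(1) by blast

lemma eps_cases: "\<epsilon> = 1 \<or> \<epsilon> = -1"
  using exists_edge weight by (auto simp: admissible_weight_def)

lemma weight_0: "admissible_weight \<epsilon> 0"
  using eps_cases by (auto simp: admissible_weight_def)

lemma leaf_in_V: "l \<in> graph_leaves V E \<Longrightarrow> l \<in> V"
  by (simp add: graph_leaves_def)

lemma delta_pos:
  "k \<in> signed_domain V E q \<epsilon> \<Longrightarrow> U \<subseteq> V \<Longrightarrow> 0 < graph_delta E q U (\<lambda>v. \<epsilon> * k v)"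
  by (simp add: signed_domain_def)

lemma one_plus_message:
  "1 + \<epsilon> * message U v k = graph_delta E q U (\<lambda>v. \<epsilon> * k v) / graph_delta E q (U - {v}) (\<lambda>v. \<epsilon> * k v)"
  using eps_sq by (simp add: message_def branch_ratio_def mult.assoc[symmetric])

lemma child_weight: "c \<in> children r v \<Longrightarrow> admissible_weight \<epsilon> (q {v, c})"
  by (rule weight) (simp add: children_def neighbours_def)

context
  fixes k r assumes k: "k \<in> signed_domain V E q \<epsilon>" and r: "r \<in> V"
begin

lemma one_plus_message_pos: "v \<in> V \<Longrightarrow> 0 < 1 + \<epsilon> * message (subtree r v) v k"
  unfolding one_plus_message using subtree_subset[OF r]
  by (intro divide_pos_pos delta_pos[OF k]) auto

lemma message_subtree:
  assumes "v \<in> V"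
  shows "message (subtree r v) v k
    = k v * (\<Prod>c\<in>children r v. inverse (phi \<epsilon> (q {v, c}) (message (subtree r c) c k)))"
proof -
  have nz: "graph_delta E q U (\<lambda>v. \<epsilon> * k v) \<noteq> 0" if "U \<subseteq> V" for U
    using delta_pos[OF k that] by simp
  have br: "branch_ratio q (\<lambda>u. \<epsilon> * k u) U u = \<epsilon> * message U u k" for U u
    using eps_sq by (simp add: message_def mult.assoc[symmetric])
  have "message (subtree r v) v k = \<epsilon> * (\<epsilon> * k v * (\<Prod>c\<in>children r v.
      (1 + q {v, c} * branch_ratio q (\<lambda>u. \<epsilon> * k u) (subtree r c) c)
      / (1 + branch_ratio q (\<lambda>u. \<epsilon> * k u) (subtree r c) c)))"
    unfolding message_def using branch_ratio_subtree[OF r assms nz] by simp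
  also have "\<dots> = k v * (\<Prod>c\<in>children r v. inverse (phi \<epsilon> (q {v, c}) (message (subtree r c) c k)))"
  proof -
    have "(1 + q {v, c} * (\<epsilon> * x)) / (1 + \<epsilon> * x) = inverse (phi \<epsilon> (q {v, c}) x)" for c x
      by (simp add: phi_def mult.assoc mult.left_commute[of _ \<epsilon>])
    moreover have "\<epsilon> * (\<epsilon> * y * z) = y * z" for y z
      by (simp only: mult.assoc[symmetric] eps_sq mult_1_left)
    ultimately show ?thesis unfolding br by (simp only:)
  qed
  finally show ?thesis .
qed

text \<open>Positivity climbs from the children through the recursion, while 1 + \<epsilon> times
  the message is a quotient of two positive values of the polynomial.\<close>

lemma message_range:
  assumes "v \<in> V" shows "message (subtree r v) v k \<in> range_set \<epsilon>"
  using r assms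
proof (induction v rule: tree_induct[consumes 2, case_names step])
  case (step v)
  have "0 < k v" using k step(1) by (auto simp: signed_domain_def PiE_iff)
  moreover have "0 < inverse (phi \<epsilon> (q {v, c}) (message (subtree r c) c k))" if "c \<in> children r v" for c
    using phi_pos[OF child_weight[OF that] step.IH[OF that]] by simp
  ultimately have "0 < message (subtree r v) v k"
    unfolding message_subtree[OF step(1)] by (intro mult_pos_pos prod_pos) auto
  then show ?case using one_plus_message_pos[OF step(1)] by (simp add: range_set_def)
qed

lemma coordinate_eq:
  assumes "v \<in> V"
  shows "k v = message (subtree r v) v k * (\<Prod>c\<in>children r v. phi \<epsilon> (q {v, c}) (message (subtree r c) c k))"
proof -
  have "phi \<epsilon> (q {v, c}) (message (subtree r c) c k) \<noteq> 0" if "c \<in> children r v" for c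
    using phi_pos[OF child_weight[OF that] message_range] that children_subset[OF r] by fastforce
  then have "(\<Prod>c\<in>children r v. inverse (phi \<epsilon> (q {v, c}) (message (subtree r c) c k)))
     * (\<Prod>c\<in>children r v. phi \<epsilon> (q {v, c}) (message (subtree r c) c k)) = 1"
    unfolding prod.distrib[symmetric] by (intro prod.neutral) auto
  then show ?thesis unfolding message_subtree[OF assms] by simp
qed

lemma delta_eq_prod: "graph_delta E q V (\<lambda>v. \<epsilon> * k v) = (\<Prod>u\<in>V. 1 + \<epsilon> * message (subtree r u) u k)"
proof -
  have nz: "graph_delta E q U (\<lambda>v. \<epsilon> * k v) \<noteq> 0" if "U \<subseteq> V" for U
    using delta_pos[OF k that] by simp
  have br: "branch_ratio q (\<lambda>u. \<epsilon> * k u) U u = \<epsilon> * message U u k" for U u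
    using eps_sq by (simp add: message_def mult.assoc[symmetric])
  have "subtree r r = V" by (simp add: subtree_def)
  then show ?thesis using graph_delta_eq_prod_ratio[OF r r nz] by (simp add: br)
qed

end

lemma delta_meas:
  assumes "U \<subseteq> V"
  shows "(\<lambda>k. graph_delta E q U (\<lambda>v. \<epsilon> * k v)) \<in> borel_measurable (\<Pi>\<^sub>M v\<in>V. borel)"
  unfolding graph_delta_def
proof (intro borel_measurable_sum borel_measurable_times borel_measurable_prod borel_measurable_const)
  fix W v assume "W \<in> Pow U" "v \<in> W"
  then have "v \<in> V" using assms by auto
  then show "(\<lambda>k. k v) \<in> borel_measurable (\<Pi>\<^sub>M v\<in>V. borel)"
    using measurable_component_singleton[of v V "\<lambda>_. borel :: real measure"] by simp
qed

lemma message_meas: "U \<subseteq> V \<Longrightarrow> message U v \<in> borel_measurable (\<Pi>\<^sub>M v\<in>V. borel)"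
  unfolding message_def branch_ratio_def
  by (intro borel_measurable_times borel_measurable_const borel_measurable_diff borel_measurable_divide delta_meas) auto

text \<open>The message sent by \<open>v\<close> across the edge to \<open>w\<close>. No root is
  involved, so the same variable occurs for every leaf lying beyond \<open>w\<close>, whereas
  \<open>Y l u\<close> is tied to the root \<open>l\<close>.\<close>

definition X :: "'v \<Rightarrow> 'v \<Rightarrow> 'a \<Rightarrow> real" where
  "X v w \<omega> = message (branch E v w) v (K \<omega>)"

definition Y :: "'v \<Rightarrow> 'v \<Rightarrow> 'a \<Rightarrow> real" where
  "Y l u \<omega> = message (subtree l u) u (K \<omega>)"

lemma Y_nonroot: "u \<noteq> l \<Longrightarrow> Y l u = X u (parent l u)"
  by (simp add: Y_def X_def subtree_def fun_eq_iff)

lemma Y_rv: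
  assumes "l \<in> V" "u \<in> V" "admissible_weight \<epsilon> p"
  shows "range_rv M \<epsilon> p (Y l u)"
proof
  show "Y l u \<in> borel_measurable M"
    unfolding Y_def using measurable_compose[OF K_meas message_meas[OF subtree_subset[OF assms(1,2)]]] .
  show "Y l u \<omega> \<in> range_set \<epsilon>" if "\<omega> \<in> space M" for \<omega>
    unfolding Y_def by (rule message_range[OF K_dom[OF that] assms(1,2)])
qed fact

lemma parent_edge: "{v, w} \<in> E \<Longrightarrow> v \<in> V \<and> w \<in> V \<and> v \<noteq> w \<and> parent w v = w"
  using parent_eqI(2)[of w v w] edgeD[of v w] by (simp add: neighbours_def)

lemma X_rv: "{v, w} \<in> E \<Longrightarrow> range_rv M \<epsilon> (q {v, w}) (X v w)"
  using Y_rv[of w v "q {v, w}"] Y_nonroot[of v w] parent_edge[of v w] weight by simp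

definition F :: "'v \<Rightarrow> 'v \<Rightarrow> nat \<Rightarrow> nat \<Rightarrow> nat \<Rightarrow> real" where
  "F v w m t s = range_rv.moment M \<epsilon> (q {v, w}) (X v w) m t s"

text \<open>The factor of vertex \<open>u\<close> in a mixed moment, with \<open>t\<close> the power
  of its own coordinate and \<open>s\<close> that of its parent's. At the root \<phi> occurs with
  exponent 0, and weight 0 serves as an admissible default.\<close>

definition G :: "'v \<Rightarrow> nat \<Rightarrow> nat \<Rightarrow> nat \<Rightarrow> 'v \<Rightarrow> real" where
  "G l m t s u = (if u = l then range_rv.moment M \<epsilon> 0 (Y l l) m t 0 else F u (parent l u) m t s)"

lemma F_pos: "{v, w} \<in> E \<Longrightarrow> admissible_degree \<epsilon> m (t + s) \<Longrightarrow> 0 < F v w m t s"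
  unfolding F_def by (rule range_rv.moment_pos[OF X_rv])

lemma parent_edge': "l \<in> V \<Longrightarrow> u \<in> V \<Longrightarrow> u \<noteq> l \<Longrightarrow> {u, parent l u} \<in> E"
  using parent(1)[of l u] by (simp add: neighbours_def)

lemma G_pos:
  assumes "l \<in> V" "u \<in> V" "admissible_degree \<epsilon> m (t + s)"
  shows "0 < G l m t s u"
proof (cases "u = l")
  case True
  then show ?thesis
    using range_rv.moment_pos[OF Y_rv[OF assms(1,1) weight_0], of m t 0] admissible_degree_mono[OF assms(3), of t]
    by (simp add: G_def)
next
  case False
  then show ?thesis using F_pos[OF parent_edge'[OF assms(1,2) False] assms(3)] by (simp add: G_def)
qed

text \<open>
  Tilting by a power of \<open>\<delta>\<close> keeps the messages independent for every leaf, because \<open>\<delta>\<close> is the product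
  of the factors \<open>1 + \<epsilon> * message\<close>.
\<close>

definition joint :: "nat \<Rightarrow> ('v \<Rightarrow> nat) \<Rightarrow> real" where
  "joint m \<alpha> = (\<integral>\<omega>. (\<Prod>v\<in>V. K \<omega> v ^ \<alpha> v) / graph_delta E q V (\<lambda>v. \<epsilon> * K \<omega> v) ^ m \<partial>M)"

text \<open>After substitution of \<open>coordinate_eq\<close> and \<open>delta_eq_prod\<close>,
  each message collects one power from its own coordinate, a power of \<phi> from the coordinate of
  its parent and one factor of the tilt. Independence then splits the expectation.\<close>

lemma joint_eq:
  assumes l: "l \<in> graph_leaves V E"
    and ad: "\<And>u. u \<in> V \<Longrightarrow> admissible_degree \<epsilon> m (\<alpha> u + (if u = l then 0 else \<alpha> (parent l u)))"
  shows "joint m \<alpha> = (\<Prod>u\<in>V. G l m (\<alpha> u) (\<alpha> (parent l u)) u)"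
proof -
  note lV = leaf_in_V[OF l]
  define p where "p u = (if u = l then 0 else q {u, parent l u})" for u
  define \<kappa> where "\<kappa> u = (if u = l then 0 else \<alpha> (parent l u))" for u
  define g where "g u x = x ^ \<alpha> u * phi \<epsilon> (p u) x ^ \<kappa> u / (1 + \<epsilon> * x) ^ m" for u x
  have rv: "range_rv M \<epsilon> (p u) (Y l u)" if "u \<in> V" for u
    unfolding p_def using weight_0 weight[OF parent_edge'[OF lV that]] by (intro Y_rv[OF lV that]) auto
  have "joint m \<alpha> = (\<integral>\<omega>. (\<Prod>u\<in>V. g u (Y l u \<omega>)) \<partial>M)"
    unfolding joint_def
  proof (intro Bochner_Integration.integral_cong refl)
    fix \<omega> assume om: "\<omega> \<in> space M"
    let ?y = "\<lambda>u. message (subtree l u) u (K \<omega>)"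
    have "(\<Prod>v\<in>V. K \<omega> v ^ \<alpha> v) = (\<Prod>v\<in>V. ?y v ^ \<alpha> v * (\<Prod>c\<in>children l v. phi \<epsilon> (q {v, c}) (?y c) ^ \<alpha> v))"
    proof (rule prod.cong[OF refl])
      fix v assume "v \<in> V"
      show "K \<omega> v ^ \<alpha> v = ?y v ^ \<alpha> v * (\<Prod>c\<in>children l v. phi \<epsilon> (q {v, c}) (?y c) ^ \<alpha> v)"
        by (subst coordinate_eq[OF K_dom[OF om] lV \<open>v \<in> V\<close>]) (simp add: power_mult_distrib prod_power_distrib)
    qed
    also have "\<dots> = (\<Prod>v\<in>V. ?y v ^ \<alpha> v) * (\<Prod>c\<in>V - {l}. phi \<epsilon> (q {parent l c, c}) (?y c) ^ \<alpha> (parent l c))"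
      unfolding prod.distrib prod_children[OF lV] ..
    also have "(\<Prod>c\<in>V - {l}. phi \<epsilon> (q {parent l c, c}) (?y c) ^ \<alpha> (parent l c)) = (\<Prod>u\<in>V. phi \<epsilon> (p u) (?y u) ^ \<kappa> u)"
      using finite_V lV by (intro prod.mono_neutral_cong_left) (auto simp: p_def \<kappa>_def insert_commute)
    finally show "(\<Prod>v\<in>V. K \<omega> v ^ \<alpha> v) / graph_delta E q V (\<lambda>v. \<epsilon> * K \<omega> v) ^ m = (\<Prod>u\<in>V. g u (Y l u \<omega>))"
      unfolding delta_eq_prod[OF K_dom[OF om] lV] g_def Y_def
      by (simp add: prod.distrib prod_dividef prod_power_distrib)
  qed
  also have "\<dots> = (\<Prod>u\<in>V. \<integral>\<omega>. g u (Y l u \<omega>) \<partial>M)"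
  proof (rule indep_vars_lebesgue_integral[OF finite_V])
    show "indep_vars (\<lambda>_. borel) (\<lambda>u \<omega>. g u (Y l u \<omega>)) V"
      unfolding Y_def message_def
      by (rule indep_vars_compose2[OF indep_messages[OF l]]) (auto simp: g_def phi_def)
    show "integrable M (\<lambda>\<omega>. g u (Y l u \<omega>))" if "u \<in> V" for u
      unfolding g_def using range_rv.integrable_moment[OF rv[OF that], of m "\<alpha> u" "\<kappa> u"] ad[OF that]
      by (simp add: \<kappa>_def)
  qed
  also have "\<dots> = (\<Prod>u\<in>V. G l m (\<alpha> u) (\<alpha> (parent l u)) u)"
  proof (rule prod.cong[OF refl])
    fix u assume "u \<in> V"
    have "(\<integral>\<omega>. g u (Y l u \<omega>) \<partial>M) = range_rv.moment M \<epsilon> (p u) (Y l u) m (\<alpha> u) (\<kappa> u)"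
      unfolding g_def range_rv.moment_def[OF rv[OF \<open>u \<in> V\<close>]] ..
    then show "(\<integral>\<omega>. g u (Y l u \<omega>) \<partial>M) = G l m (\<alpha> u) (\<alpha> (parent l u)) u"
      by (simp add: G_def F_def p_def \<kappa>_def Y_nonroot)
  qed
  finally show ?thesis .
qed

text \<open>Normalization at exponents (0, 0) makes every vertex with both exponents zero contribute
  1, so only the neighbourhood of the chosen vertices survives in the products.\<close>

definition nF :: "'v \<Rightarrow> 'v \<Rightarrow> nat \<Rightarrow> nat \<Rightarrow> nat \<Rightarrow> real" where
  "nF v w m t s = F v w m t s / F v w m 0 0"

definition nG :: "'v \<Rightarrow> nat \<Rightarrow> nat \<Rightarrow> nat \<Rightarrow> 'v \<Rightarrow> real" where
  "nG l m t s u = G l m t s u / G l m 0 0 u"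

definition njoint :: "nat \<Rightarrow> ('v \<Rightarrow> nat) \<Rightarrow> real" where
  "njoint m \<alpha> = joint m \<alpha> / joint m (\<lambda>_. 0)"

lemma njoint_eq:
  assumes l: "l \<in> graph_leaves V E"
    and ad: "\<And>u. u \<in> V \<Longrightarrow> admissible_degree \<epsilon> m (\<alpha> u + (if u = l then 0 else \<alpha> (parent l u)))"
  shows "njoint m \<alpha> = (\<Prod>u\<in>V. nG l m (\<alpha> u) (\<alpha> (parent l u)) u)"
proof -
  have ad0: "admissible_degree \<epsilon> m (0 + (if u = l then 0 else 0))" if "u \<in> V" for u
    using admissible_degree_mono[OF ad[OF that], of 0] by simp
  have "joint m (\<lambda>_. 0) = (\<Prod>u\<in>V. G l m 0 0 u)"
    using joint_eq[OF l, of m "\<lambda>_. 0"] ad0 by simp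
  then show ?thesis using joint_eq[OF l ad] by (simp add: njoint_def nG_def prod_dividef)
qed

definition single :: "'v \<Rightarrow> nat \<Rightarrow> 'v \<Rightarrow> nat" where
  "single v t u = (if u = v then t else 0)"

definition double :: "'v \<Rightarrow> nat \<Rightarrow> 'v \<Rightarrow> nat \<Rightarrow> 'v \<Rightarrow> nat" where
  "double v t w s u = (if u = v then t else if u = w then s else 0)"

lemma double_swap: "v \<noteq> w \<Longrightarrow> double v t w s = double w s v t"
  by (auto simp: double_def fun_eq_iff)

lemma nG_nonroot: "u \<noteq> l \<Longrightarrow> nG l m t s u = nF u (parent l u) m t s"
  by (simp add: nG_def nF_def G_def)

lemma nG_root: "nG l m t s l = nG l m t s' l"
  by (simp add: nG_def G_def)

lemma parent_neq: "l \<in> V \<Longrightarrow> u \<in> V \<Longrightarrow> u \<noteq> l \<Longrightarrow> parent l u \<noteq> u"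
  using parent_edge'[of l u] edgeD[of u "parent l u"] by auto

text \<open>Seen from a leaf beyond \<open>w\<close>, raising the coordinate of \<open>v\<close> to
  the power \<open>t\<close> changes only the factors of \<open>v\<close> and of its children; all
  others agree with those of the moment of \<open>w\<close> alone. The factor
  \<open>nF v w m 0 s\<close> compensates for the one that \<open>v\<close> contributes
  there.\<close>

lemma edge_factorization:
  assumes l: "l \<in> graph_leaves V E" and v: "v \<in> V" "v \<noteq> l" "parent l v = w"
    and ad: "admissible_degree \<epsilon> m (t + s)"
  shows "njoint m (double v t w s) * nF v w m 0 s
    = nF v w m t s * (\<Prod>c\<in>neighbours E v - {w}. nF c v m 0 t) * njoint m (single w s)"
proof -
  note lV = leaf_in_V[OF l]
  note mono = admissible_degree_mono[OF ad]
  have e: "{v, w} \<in> E" using parent_edge'[OF lV v(1,2)] v(3) by simp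
  have vw: "v \<noteq> w" using edgeD[OF e] by simp
  have ch: "children l v = neighbours E v - {w}" using children_nonroot[OF lV v(1,2)] v(3) by simp
  have adQ: "admissible_degree \<epsilon> m (double v t w s u + (if u = l then 0 else double v t w s (parent l u)))"
    if "u \<in> V" for u
    by (rule mono) (use parent_neq[OF lV that] vw in \<open>auto simp: double_def\<close>)
  have adP: "admissible_degree \<epsilon> m (single w s u + (if u = l then 0 else single w s (parent l u)))"
    if "u \<in> V" for u
    by (rule mono) (use parent_neq[OF lV that] in \<open>auto simp: single_def\<close>)
  have termwise: "nG l m (double v t w s u) (double v t w s (parent l u)) u * (if u = v then nF v w m 0 s else 1)
     = (if u = v then nF v w m t s else 1) * (if u \<in> children l v then nF u v m 0 t else 1)
       * nG l m (single w s u) (single w s (parent l u)) u" if u: "u \<in> V" for u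
  proof -
    consider "u = v" | "u \<noteq> v" "u = l" | "u \<noteq> v" "u \<noteq> l" "parent l u = v" | "u \<noteq> v" "u \<noteq> l" "parent l u \<noteq> v"
      by blast
    then show ?thesis
    proof cases
      case 1
      have "v \<notin> children l v" using children_iff[OF lV v(1)] v(3) vw by simp
      then show ?thesis using 1 v vw by (simp add: nG_nonroot double_def single_def)
    next
      case 2
      have "l \<notin> children l v" using children_iff[OF lV v(1)] by simp
      then show ?thesis using 2 nG_root[of l m "single w s l" "double v t w s (parent l l)" "single w s (parent l l)"]
        by (simp add: double_def single_def)
    next
      case 3
      then have c: "u \<in> children l v" using children_iff[OF lV v(1)] u by simp
      then have "u \<noteq> w" unfolding ch by simp
      moreover have "{u, v} \<in> E" using parent_edge'[OF lV u 3(2)] 3(3) by simp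
      then have "nF u v m 0 0 = 1" using F_pos[of u v m 0 0] mono[of 0] by (simp add: nF_def)
      ultimately show ?thesis using 3 c vw by (simp add: nG_nonroot double_def single_def)
    next
      case 4
      then have "u \<notin> children l v" using children_iff[OF lV v(1)] by simp
      then show ?thesis using 4 by (simp add: double_def single_def)
    qed
  qed
  have "njoint m (double v t w s) * nF v w m 0 s
    = (\<Prod>u\<in>V. nG l m (double v t w s u) (double v t w s (parent l u)) u) * (\<Prod>u\<in>V. if u = v then nF v w m 0 s else 1)"
    using njoint_eq[OF l adQ] finite_V v(1) by simp
  also have "\<dots> = (\<Prod>u\<in>V. (if u = v then nF v w m t s else 1) * (if u \<in> children l v then nF u v m 0 t else 1)
       * nG l m (single w s u) (single w s (parent l u)) u)"
    unfolding prod.distrib[symmetric] by (rule prod.cong[OF refl termwise])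
  also have "\<dots> = nF v w m t s * (\<Prod>u\<in>V. if u \<in> children l v then nF u v m 0 t else 1) * njoint m (single w s)"
    unfolding prod.distrib using njoint_eq[OF l adP] finite_V v(1) by simp
  also have "(\<Prod>u\<in>V. if u \<in> children l v then nF u v m 0 t else 1) = (\<Prod>c\<in>neighbours E v - {w}. nF c v m 0 t)"
    unfolding ch[symmetric] using finite_V children_subset[OF lV]
    by (intro prod.mono_neutral_cong_right) auto
  finally show ?thesis .
qed

text \<open>
  The quotient of the two message transforms along an edge \<open>{v, w}\<close> separates into \<open>R v\<close> and \<open>R w\<close>.
  Since \<open>R v\<close> does not involve \<open>w\<close>, the parameter of \<open>v\<close> is the same for all edges at \<open>v\<close>.
\<close>

definition R :: "'v \<Rightarrow> nat \<Rightarrow> nat \<Rightarrow> real" where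
  "R v m t = njoint m (single v t) / (\<Prod>c\<in>neighbours E v. nF c v m 0 t)"

lemma nF_pos: "{v, w} \<in> E \<Longrightarrow> admissible_degree \<epsilon> m (t + s) \<Longrightarrow> 0 < nF v w m t s"
  unfolding nF_def using F_pos admissible_degree_mono[of \<epsilon> m "t + s" 0] by simp

lemma neighbour_prod_pos:
  "admissible_degree \<epsilon> m t \<Longrightarrow> 0 < (\<Prod>c\<in>neighbours E v. nF c v m 0 t)"
  by (rule prod_pos) (auto simp: neighbours_def insert_commute intro!: nF_pos)

lemma exists_leaf_with_parent:
  assumes "{v, w} \<in> E"
  shows "\<exists>l\<in>graph_leaves V E. v \<noteq> l \<and> parent l v = w"
proof -
  obtain l where l: "l \<in> graph_leaves V E" "l \<in> branch E w v" using exists_leaf_in_branch[OF assms] by blast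
  then show ?thesis
    using parent_eqI[OF leaf_in_V[OF l(1)], of v w] assms edgeD[OF assms] by (auto simp: neighbours_def)
qed

lemma njoint_pos:
  assumes "v \<in> V" "admissible_degree \<epsilon> m t"
  shows "0 < njoint m (single v t)"
proof -
  obtain w where "{v, w} \<in> E" using exists_neighbour[OF assms(1)] by (auto simp: neighbours_def)
  then obtain l where l: "l \<in> graph_leaves V E" using exists_leaf_with_parent by blast
  note lV = leaf_in_V[OF l]
  have ad: "admissible_degree \<epsilon> m (single v t u + (if u = l then 0 else single v t (parent l u)))"
    if "u \<in> V" for u
    by (rule admissible_degree_mono[OF assms(2)]) (use parent_neq[OF lV that] in \<open>auto simp: single_def\<close>)
  have "0 < nG l m (single v t u) (single v t (parent l u)) u" if u: "u \<in> V" for u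
  proof -
    have "0 < G l m 0 0 u" by (rule G_pos[OF lV u]) (use admissible_degree_mono[OF assms(2)] in auto)
    moreover have "0 < G l m (single v t u) (single v t (parent l u)) u"
      using G_pos[OF lV u ad[OF u]] by (cases "u = l") (simp_all add: G_def)
    ultimately show ?thesis by (simp add: nG_def)
  qed
  then have "0 < (\<Prod>u\<in>V. nG l m (single v t u) (single v t (parent l u)) u)" by (intro prod_pos) auto
  then show ?thesis using njoint_eq[OF l, of m "single v t"] ad by simp
qed

lemma R_pos: "v \<in> V \<Longrightarrow> admissible_degree \<epsilon> m t \<Longrightarrow> 0 < R v m t"
  unfolding R_def by (intro divide_pos_pos njoint_pos neighbour_prod_pos)

text \<open>One mixed moment is computed from leaves on either side of the edge. Multiplying by the
  two missing factors completes the products over all neighbours of \<open>v\<close> and of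
  \<open>w\<close>, which are the denominators of \<open>R\<close>.\<close>

lemma edge_reversal:
  assumes e: "{v, w} \<in> E" and ad: "admissible_degree \<epsilon> m (t + s)"
  shows "nF v w m t s * R w m s = nF w v m s t * R v m t"
proof -
  note mono = admissible_degree_mono[OF ad]
  have e': "{w, v} \<in> E" using e by (simp add: insert_commute)
  have vw: "v \<in> V" "w \<in> V" "v \<noteq> w" using edgeD[OF e] by auto
  obtain l where l: "l \<in> graph_leaves V E" "v \<noteq> l" "parent l v = w" using exists_leaf_with_parent[OF e] by blast
  obtain l' where l': "l' \<in> graph_leaves V E" "w \<noteq> l'" "parent l' w = v" using exists_leaf_with_parent[OF e'] by blast
  define Q where "Q = njoint m (double v t w s)"
  have Q': "Q = njoint m (double w s v t)" using double_swap[OF vw(3)] by (simp add: Q_def)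
  define Nv Nw where "Nv = (\<Prod>c\<in>neighbours E v. nF c v m 0 t)" and "Nw = (\<Prod>c\<in>neighbours E w. nF c w m 0 s)"
  have pos: "0 < Nv" "0 < Nw" unfolding Nv_def Nw_def by (rule neighbour_prod_pos, rule mono, simp)+
  have N: "Nv = nF w v m 0 t * (\<Prod>c\<in>neighbours E v - {w}. nF c v m 0 t)"
    "Nw = nF v w m 0 s * (\<Prod>c\<in>neighbours E w - {v}. nF c w m 0 s)"
    unfolding Nv_def Nw_def using e e' finite_neighbours by (auto simp: neighbours_def intro!: prod.remove)
  have ad': "admissible_degree \<epsilon> m (s + t)" by (rule mono) simp
  have "Q * nF v w m 0 s * nF w v m 0 t = nF v w m t s * Nv * njoint m (single w s)"
    using edge_factorization[OF l(1) vw(1) l(2,3) ad] by (simp add: Q_def N mult_ac)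
  moreover have "Q * nF w v m 0 t * nF v w m 0 s = nF w v m s t * Nw * njoint m (single v t)"
    using edge_factorization[OF l'(1) vw(2) l'(2,3) ad'] by (simp add: Q' N mult_ac)
  ultimately have "nF v w m t s * Nv * njoint m (single w s) = nF w v m s t * Nw * njoint m (single v t)"
    by (simp add: mult_ac)
  then show ?thesis using pos unfolding R_def Nv_def[symmetric] Nw_def[symmetric]
    by (simp add: divide_simps mult_ac)
qed

text \<open>With the leaf itself as root, the neighbour factors in \<open>R\<close> cancel and the
  normalized moments of the root message remain. This anchors the bounds on ratios and gives the law
  of the root message.\<close>

lemma R_leaf:
  assumes l: "l \<in> graph_leaves V E" and ad: "admissible_degree \<epsilon> m t"
  shows "R l m t = range_rv.moment M \<epsilon> 0 (Y l l) m t 0 / range_rv.moment M \<epsilon> 0 (Y l l) m 0 0"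
proof -
  note lV = leaf_in_V[OF l]
  have adP: "admissible_degree \<epsilon> m (single l t u + (if u = l then 0 else single l t (parent l u)))"
    if "u \<in> V" for u
    by (rule admissible_degree_mono[OF ad]) (use parent_neq[OF lV that] in \<open>auto simp: single_def\<close>)
  have termwise: "nG l m (single l t u) (single l t (parent l u)) u
    = (if u = l then nG l m t 0 l else 1) * (if u \<in> children l l then nF u l m 0 t else 1)" if u: "u \<in> V" for u
  proof (cases "u = l")
    case True
    then show ?thesis using children_iff[OF lV lV] nG_root[of l m t _ 0] by (auto simp: single_def)
  next
    case False
    have "{u, parent l u} \<in> E" by (rule parent_edge'[OF lV u False])
    then have "nF u (parent l u) m 0 0 = 1"
      using F_pos[of u "parent l u" m 0 0] admissible_degree_mono[OF ad, of 0] by (simp add: nF_def)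
    then show ?thesis using False children_iff[OF lV lV, of u] u by (auto simp: nG_nonroot single_def)
  qed
  have "njoint m (single l t) = (\<Prod>u\<in>V. (if u = l then nG l m t 0 l else 1) * (if u \<in> children l l then nF u l m 0 t else 1))"
    using njoint_eq[OF l, of m "single l t"] adP prod.cong[OF refl termwise] by simp
  also have "\<dots> = nG l m t 0 l * (\<Prod>u\<in>V. if u \<in> children l l then nF u l m 0 t else 1)"
    unfolding prod.distrib using finite_V lV by simp
  also have "(\<Prod>u\<in>V. if u \<in> children l l then nF u l m 0 t else 1) = (\<Prod>c\<in>neighbours E l. nF c l m 0 t)"
    unfolding children_root[symmetric, OF lV] using finite_V children_subset[OF lV]
    by (intro prod.mono_neutral_cong_right) auto
  finally show ?thesis using neighbour_prod_pos[OF ad, of l] by (simp add: R_def nG_def G_def)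
qed

end

section \<open>Identification of the law\<close>

context tree_law
begin

text \<open>Undoes the normalization in \<open>nF\<close>, since \<open>edge_pair\<close> speaks of
  plain moments. The default 1 covers tilts for which no moment is available.\<close>

definition scale :: "'v \<Rightarrow> 'v \<Rightarrow> nat \<Rightarrow> real" where
  "scale v w m = (if admissible_degree \<epsilon> m 0 then F v w m 0 0 else 1)"

lemma scale_pos: "{v, w} \<in> E \<Longrightarrow> 0 < scale v w m"
  using F_pos[of v w m 0 0] by (simp add: scale_def)

lemma edge_pair_edge:
  assumes e: "{v, w} \<in> E"
  shows "edge_pair M \<epsilon> (q {v, w}) (X v w) (X w v) (\<lambda>m t. R v m t * scale v w m) (\<lambda>m t. R w m t * scale w v m)"
proof -
  have e': "{w, v} \<in> E" and q: "q {w, v} = q {v, w}" using e by (simp_all add: insert_commute)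
  have vw: "v \<in> V" "w \<in> V" using edgeD[OF e] by auto
  interpret X1: range_rv M \<epsilon> "q {v, w}" "X v w" by (rule X_rv[OF e])
  interpret X2: range_rv M \<epsilon> "q {v, w}" "X w v" using X_rv[OF e'] by (simp add: q)
  show ?thesis
  proof
    fix m t s assume ad: "admissible_degree \<epsilon> m (t + s)"
    have ad0: "admissible_degree \<epsilon> m 0" by (rule admissible_degree_mono[OF ad]) simp
    have pos: "0 < F v w m 0 0" "0 < F w v m 0 0" using F_pos[OF e, of m 0 0] F_pos[OF e', of m 0 0] ad0 by auto
    show "X1.moment m t s * (R w m s * scale w v m) = X2.moment m s t * (R v m t * scale v w m)"
      using edge_reversal[OF e ad] pos ad0 unfolding nF_def scale_def F_def q by (simp add: divide_simps mult_ac)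
  qed (use R_pos vw scale_pos[OF e] scale_pos[OF e'] in auto)
qed

lemma exists_leaf: "\<exists>l. l \<in> graph_leaves V E"
  using exists_edge exists_leaf_in_branch by blast

text \<open>At a leaf \<open>R\<close> is the moment sequence of a law on the unit interval, which
  is strictly decreasing; from there the bound travels along the edges.\<close>

lemma ratio_R_less_1:
  assumes "\<epsilon> = -1" "v \<in> V"
  shows "ratio (R v 0) t < 1"
proof -
  have ad: "admissible_degree \<epsilon> 0 n" for n using assms by (simp add: admissible_degree_def)
  obtain l where l: "l \<in> graph_leaves V E" using exists_leaf by blast
  note lV = leaf_in_V[OF l]
  interpret Y: range_rv M \<epsilon> 0 "Y l l" by (rule Y_rv[OF lV lV weight_0])
  have "\<forall>t. ratio (R v 0) t < 1"
  proof (rule tree_propagate[OF lV, of "\<lambda>v. \<forall>t. ratio (R v 0) t < 1"])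
    show "\<forall>t. ratio (R l 0) t < 1"
      unfolding ratio_def R_leaf[OF l ad] using Y.moment_decreasing[OF assms(1)] Y.moment_pos[of 0 _ 0] ad
      by (simp add: divide_simps)
    fix v w assume e: "{v, w} \<in> E" and v: "\<forall>t. ratio (R v 0) t < 1"
    have e': "{w, v} \<in> E" using e by (simp add: insert_commute)
    interpret P: edge_pair M \<epsilon> "q {w, v}" "X w v" "X v w" "\<lambda>m t. R w m t * scale w v m" "\<lambda>m t. R v m t * scale v w m"
      by (rule edge_pair_edge[OF e'])
    have nz: "scale v w 0 \<noteq> 0" "scale w v 0 \<noteq> 0" using scale_pos[OF e, of 0] scale_pos[OF e', of 0] by auto
    show "\<forall>t. ratio (R w 0) t < 1"
      using P.ratio_less_1[OF assms(1)] v by (simp add: ratio_scale[OF nz(1)] ratio_scale[OF nz(2)])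
  qed fact
  then show ?thesis by blast
qed

lemma non_const_X:
  assumes "{v, w} \<in> E" shows "\<not> (\<exists>c. AE \<omega> in M. X v w \<omega> = c)"
proof -
  obtain l where l: "l \<in> graph_leaves V E" "v \<noteq> l" "parent l v = w"
    using exists_leaf_with_parent[OF assms] by blast
  have "v \<in> V" using edgeD[OF assms] by blast
  from non_const_messages[OF l(1) this] have "\<not> (\<exists>c. AE \<omega> in M. Y l v \<omega> = c)"
    unfolding Y_def message_def .
  then show ?thesis unfolding Y_nonroot[OF l(2)] l(3) .
qed

lemma regular_edge_pair_edge:
  assumes e: "{v, w} \<in> E"
  shows "regular_edge_pair M \<epsilon> (q {v, w}) (X v w) (X w v) (\<lambda>m t. R v m t * scale v w m) (\<lambda>m t. R w m t * scale w v m)"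
proof -
  have e': "{w, v} \<in> E" using e by (simp add: insert_commute)
  interpret P: edge_pair M \<epsilon> "q {v, w}" "X v w" "X w v" "\<lambda>m t. R v m t * scale v w m" "\<lambda>m t. R w m t * scale w v m"
    by (rule edge_pair_edge[OF e])
  have nz: "scale v w 0 \<noteq> 0" "scale w v 0 \<noteq> 0" using scale_pos[OF e, of 0] scale_pos[OF e', of 0] by auto
  have vw: "v \<in> V" "w \<in> V" using edgeD[OF e] by auto
  show ?thesis
  proof
    show "ratio (\<lambda>t. R v 0 t * scale v w 0) t < 1" if "\<epsilon> = -1" for t
      unfolding ratio_scale[OF nz(1)] by (rule ratio_R_less_1[OF that vw(1)])
    show "ratio (\<lambda>t. R w 0 t * scale w v 0) t < 1" if "\<epsilon> = -1" for t
      unfolding ratio_scale[OF nz(2)] by (rule ratio_R_less_1[OF that vw(2)])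
    show "\<not> (\<exists>c. AE \<omega> in M. X v w \<omega> = c)" by (rule non_const_X[OF e])
  qed
qed

definition exponent :: "'v \<Rightarrow> real" where
  "exponent v = exponent_param \<epsilon> (R v)"

definition shift :: real where
  "shift = shift_param \<epsilon> (R (SOME v. v \<in> V))"

lemma params_edge:
  assumes e: "{v, w} \<in> E"
  shows "shift_param \<epsilon> (\<lambda>m t. R v m t * scale v w m) = shift_param \<epsilon> (R v)"
    "exponent_param \<epsilon> (\<lambda>m t. R v m t * scale v w m) = exponent v"
  using params_scale[of "scale v w" \<epsilon> "R v"] scale_pos[OF e, of "base_level \<epsilon>"] by (simp_all add: exponent_def)

text \<open>The slopes at the two ends of an edge agree, so connectedness makes the parameter
  global.\<close>

lemma shift_eq:
  assumes "v \<in> V" shows "shift_param \<epsilon> (R v) = shift"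
proof (rule tree_propagate[of "SOME v. v \<in> V" "\<lambda>v. shift_param \<epsilon> (R v) = shift"])
  show "(SOME v. v \<in> V) \<in> V" by (rule someI[of "\<lambda>v. v \<in> V", OF assms])
  show "shift_param \<epsilon> (R (SOME v. v \<in> V)) = shift" by (simp add: shift_def)
  fix v w assume e: "{v, w} \<in> E" and v: "shift_param \<epsilon> (R v) = shift"
  have e': "{w, v} \<in> E" using e by (simp add: insert_commute)
  interpret P: regular_edge_pair M \<epsilon> "q {v, w}" "X v w" "X w v" "\<lambda>m t. R v m t * scale v w m" "\<lambda>m t. R w m t * scale w v m"
    by (rule regular_edge_pair_edge[OF e])
  show "shift_param \<epsilon> (R w) = shift"
    using P.shift_param_swap v unfolding params_edge(1)[OF e] params_edge(1)[OF e'] by simp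
qed fact

lemma exists_incident: "v \<in> V \<Longrightarrow> \<exists>w. {v, w} \<in> E"
  using exists_neighbour[of v] by (auto simp: neighbours_def)

lemma param_signs:
  assumes "v \<in> V" shows "0 < exponent v" "\<epsilon> = -1 \<Longrightarrow> shift < 0"
proof -
  obtain w where e: "{v, w} \<in> E" using exists_incident[OF assms] by blast
  interpret P: regular_edge_pair M \<epsilon> "q {v, w}" "X v w" "X w v" "\<lambda>m t. R v m t * scale v w m" "\<lambda>m t. R w m t * scale w v m"
    by (rule regular_edge_pair_edge[OF e])
  show "0 < exponent v" "\<epsilon> = -1 \<Longrightarrow> shift < 0"
    using P.param_signs unfolding params_edge[OF e] shift_eq[OF assms] by auto
qed

lemma lin_R:
  assumes "v \<in> V" "relevant_index \<epsilon> m t"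
  shows "lin \<epsilon> (R v m) t * (shift + real m) = shift + real m - exponent v - real t"
    "1 + \<epsilon> * ratio (R v m) t \<noteq> 0"
proof -
  obtain w where e: "{v, w} \<in> E" using exists_incident[OF assms(1)] by blast
  interpret P: regular_edge_pair M \<epsilon> "q {v, w}" "X v w" "X w v" "\<lambda>m t. R v m t * scale v w m" "\<lambda>m t. R w m t * scale w v m"
    by (rule regular_edge_pair_edge[OF e])
  have nz: "scale v w m \<noteq> 0" using scale_pos[OF e, of m] by simp
  show "lin \<epsilon> (R v m) t * (shift + real m) = shift + real m - exponent v - real t"
    using P.lin_params(1)[OF assms(2)] unfolding params_edge[OF e] shift_eq[OF assms(1)] lin_scale[OF nz] .
  have "admissible_degree \<epsilon> m (Suc t)"
    using relevant_index_degree[OF assms(2)] by (auto intro: admissible_degree_mono)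
  from P.lin_denominator(1)[OF this] show "1 + \<epsilon> * ratio (R v m) t \<noteq> 0"
    unfolding ratio_scale[OF nz] by simp
qed

lemma edge_law:
  assumes e: "{v, w} \<in> E"
  shows "\<exists>\<kappa>>0. distr M borel (X v w)
    = density lborel (\<lambda>x. ennreal (\<kappa> * edge_density \<epsilon> (q {v, w}) (exponent v) (exponent w) shift x))"
proof -
  have vw: "v \<in> V" "w \<in> V" and e': "{w, v} \<in> E" using edgeD[OF e] e by (auto simp: insert_commute)
  interpret P: regular_edge_pair M \<epsilon> "q {v, w}" "X v w" "X w v" "\<lambda>m t. R v m t * scale v w m" "\<lambda>m t. R w m t * scale w v m"
    by (rule regular_edge_pair_edge[OF e])
  show ?thesis
  proof (rule P.X.law_of_stein_identities)
    fix m t assume rel: "relevant_index \<epsilon> m t"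
    then have rel0: "relevant_index \<epsilon> m 0" by (auto simp: relevant_index_def)
    have nz: "scale w v m \<noteq> 0" using scale_pos[OF e', of m] by simp
    have "lin \<epsilon> (\<lambda>t. R w m t * scale w v m) 0 * (shift + real m) = shift + real m - exponent w"
      unfolding lin_scale[OF nz] using lin_R(1)[OF vw(2) rel0] by simp
    then show "P.X.stein_identity (exponent v) (exponent w) shift m t"
      using P.edge_stein_identity[OF rel, of "exponent w"] unfolding params_edge[OF e] shift_eq[OF vw(1)] by simp
  qed
qed

lemma root_law:
  assumes l: "l \<in> graph_leaves V E"
  shows "\<exists>\<kappa>>0. distr M borel (Y l l) = density lborel (\<lambda>x. ennreal (\<kappa> * edge_density \<epsilon> 0 (exponent l) 0 shift x))"
proof -
  note lV = leaf_in_V[OF l]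
  interpret Y: range_rv M \<epsilon> 0 "Y l l" by (rule Y_rv[OF lV lV weight_0])
  show ?thesis
  proof (rule Y.law_of_stein_identities)
    fix m t assume rel: "relevant_index \<epsilon> m t"
    have "admissible_degree \<epsilon> m (Suc t)"
      using relevant_index_degree[OF rel] by (auto intro: admissible_degree_mono)
    then show "Y.stein_identity (exponent l) 0 shift m t"
      using Y.root_stein_identity[of m "R l m", OF R_leaf[OF l] lin_R[OF lV rel]] by blast
  qed
qed

lemma signed_domain_meas: "signed_domain V E q \<epsilon> \<in> sets (\<Pi>\<^sub>M v\<in>V. lborel)"
proof -
  let ?P = "\<Pi>\<^sub>M v\<in>V. (borel :: real measure)"
  have "signed_domain V E q \<epsilon>
    = {k \<in> space ?P. (\<forall>v\<in>V. 0 < k v) \<and> (\<forall>U\<in>Pow V. 0 < graph_delta E q U (\<lambda>v. \<epsilon> * k v))}"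
    by (auto simp: signed_domain_def space_PiM PiE_iff)
  also have "\<dots> \<in> sets ?P"
  proof (intro sets.sets_Collect_conj sets.sets_Collect_finite_All)
    show "{k \<in> space ?P. 0 < k v} \<in> sets ?P" if "v \<in> V" for v
      using measurable_component_singleton[OF that, of "\<lambda>_. borel :: real measure"] by simp
    show "{k \<in> space ?P. 0 < graph_delta E q U (\<lambda>v. \<epsilon> * k v)} \<in> sets ?P" if "U \<in> Pow V" for U
      using delta_meas[of U] that by simp
  qed (use finite_V in auto)
  also have "sets ?P = sets (\<Pi>\<^sub>M v\<in>V. lborel)" by (rule sets_PiM_cong) auto
  finally show ?thesis .
qed

text \<open>The density of both tree-beta laws: the parameter \<beta> of the law is
  \<open>- shift\<close> for \<epsilon> = -1 and \<open>shift + 1\<close> for \<epsilon> =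
  1.\<close>

definition law_density :: "('v \<Rightarrow> real) \<Rightarrow> real" where
  "law_density k = graph_delta E q V (\<lambda>v. \<epsilon> * k v) powr (- shift - 1) * (\<Prod>v\<in>V. k v powr (exponent v - 1))
     * indicator (signed_domain V E q \<epsilon>) k"

lemma law_density_nonneg: "0 \<le> law_density k"
  by (simp add: law_density_def prod_nonneg)

lemma law_density_meas: "law_density \<in> borel_measurable (\<Pi>\<^sub>M v\<in>V. lborel)"
proof -
  let ?P = "\<Pi>\<^sub>M v\<in>V. (lborel :: real measure)"
  have sets_P: "sets ?P = sets (\<Pi>\<^sub>M v\<in>V. (borel :: real measure))" by (rule sets_PiM_cong) auto
  have comp: "(\<lambda>x. x v) \<in> borel_measurable ?P" if "v \<in> V" for v
    using measurable_component_singleton[OF that, of "\<lambda>_. lborel :: real measure"] by simp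
  have "(\<lambda>k. graph_delta E q V (\<lambda>v. \<epsilon> * k v)) \<in> borel_measurable ?P"
    using delta_meas[of V] measurable_cong_sets[OF sets_P refl] by blast
  moreover have "(\<lambda>k. \<Prod>v\<in>V. k v powr (exponent v - 1)) \<in> borel_measurable ?P"
    using comp by (intro borel_measurable_prod powr_real_measurable borel_measurable_const)
  ultimately show ?thesis
    unfolding law_density_def using signed_domain_meas by simp
qed

text \<open>
  Only the implication from \<open>T x\<close> in the domain to \<open>x = Y l\<close> is needed for the change of variables,
  since \<open>K\<close> takes its values in the domain.
\<close>

theorem law_of_K:
  "\<exists>C>0. distr M (\<Pi>\<^sub>M v\<in>V. lborel) K = density (\<Pi>\<^sub>M v\<in>V. lborel) (\<lambda>k. ennreal (C * law_density k))"
proof -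
  let ?P = "\<Pi>\<^sub>M v\<in>V. (lborel :: real measure)"
  let ?D = "signed_domain V E q \<epsilon>"
  have sets_P: "sets ?P = sets (\<Pi>\<^sub>M v\<in>V. (borel :: real measure))" by (rule sets_PiM_cong) auto
  have K_P: "K \<in> measurable M ?P" using K_meas measurable_cong_sets[OF refl sets_P] by blast
  have comp: "(\<lambda>x. x v) \<in> borel_measurable ?P" if "v \<in> V" for v
    using measurable_component_singleton[OF that, of "\<lambda>_. lborel :: real measure"] by simp
  obtain l where l: "l \<in> graph_leaves V E" using exists_leaf by blast
  note lV = leaf_in_V[OF l]
  define p where "p u = (if u = l then 0 else q {u, parent l u})" for u
  define b where "b u = (if u = l then 0 else exponent (parent l u))" for u
  have "\<exists>\<kappa>>0. distr M borel (Y l u) = density lborel (\<lambda>x. ennreal (\<kappa> * edge_density \<epsilon> (p u) (exponent u) (b u) shift x))"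
    if "u \<in> V" for u
    using root_law[OF l] edge_law[OF parent_edge'[OF lV that]] by (cases "u = l") (simp_all add: p_def b_def Y_nonroot)
  then obtain \<kappa> where \<kappa>: "\<And>u. u \<in> V \<Longrightarrow> 0 < \<kappa> u" "\<And>u. u \<in> V \<Longrightarrow> distr M borel (Y l u)
      = density lborel (\<lambda>x. ennreal (\<kappa> u * edge_density \<epsilon> (p u) (exponent u) (b u) shift x))" by metis
  define d where "d u x = \<kappa> u * edge_density \<epsilon> (p u) (exponent u) (b u) shift x" for u x
  define C where "C = (\<Prod>u\<in>V. \<kappa> u)"
  \<comment> \<open>The value 0 off \<open>V\<close> makes every index carry a measurable variable,
    hence a probability law, as \<open>PiM_density\<close> asks.\<close>
  define Z where "Z v \<omega> = (if v \<in> V then Y l v \<omega> else 0)" for v \<omega>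
  have Z_meas: "Z v \<in> borel_measurable M" for v
    using range_rv.X_meas[OF Y_rv[OF lV _ weight_0], of v] by (cases "v \<in> V") (simp_all add: Z_def[abs_def])
  have "indep_vars (\<lambda>_. borel) Z V"
    using indep_messages[OF l] by (rule indep_vars_cong[THEN iffD1, rotated -1]) (auto simp: Z_def Y_def message_def)
  then have "distr M (\<Pi>\<^sub>M v\<in>V. borel) (\<lambda>\<omega>. \<lambda>v\<in>V. Z v \<omega>) = (\<Pi>\<^sub>M v\<in>V. distr M borel (Z v))"
    using indep_vars_iff_distr_eq_PiM[where I = V and M' = "\<lambda>_. borel" and X = Z] lV Z_meas by auto
  also have "\<dots> = density ?P (\<lambda>x. \<Prod>v\<in>V. ennreal (d v (x v)))"
  proof (rule PiM_density[OF finite_V])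
    show "prob_space (distr M borel (Z v))" for v by (rule prob_space_distr[OF Z_meas])
    show "(\<lambda>x. ennreal (d v x)) \<in> borel_measurable borel" for v unfolding d_def by measurable
    show "distr M borel (Z v) = density lborel (\<lambda>x. ennreal (d v x))" if "v \<in> V" for v
      using \<kappa>(2)[OF that] that by (simp add: Z_def[abs_def] d_def)
  qed
  finally have law_Z: "distr M ?P (\<lambda>\<omega>. \<lambda>v\<in>V. Z v \<omega>) = density ?P (\<lambda>x. \<Prod>v\<in>V. ennreal (d v (x v)))"
    using distr_cong[OF refl sets_P, of M "\<lambda>\<omega>. \<lambda>v\<in>V. Z v \<omega>"] by simp
  have Z_P: "(\<lambda>\<omega>. \<lambda>v\<in>V. Z v \<omega>) \<in> measurable M ?P"
    by (rule measurable_restrict) (use Z_meas in simp)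
  \<comment> \<open>Replacing \<phi> by 1 off its range keeps the scaling factors positive
    everywhere, as \<open>triangular_scaling\<close> requires.\<close>
  define \<psi> where "\<psi> r x = (if x \<in> range_set \<epsilon> then phi \<epsilon> r x else 1)" for r x
  define c where "c v x = (\<Prod>u\<in>children l v. \<psi> (q {v, u}) (x u))" for v and x :: "'v \<Rightarrow> real"
  define T where "T x = (\<lambda>v\<in>V. x v * c v x)" for x
  have child_V: "u \<in> V" if "u \<in> children l v" for u v using children_subset[OF lV] that by auto
  have c_pos: "0 < c v x" for v x
    unfolding c_def \<psi>_def using phi_pos[OF child_weight] by (intro prod_pos) auto
  have \<psi>_meas: "\<psi> r \<in> borel_measurable borel" for r unfolding \<psi>_def phi_def by measurable
  have c_meas: "c v \<in> borel_measurable ?P" for v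
    unfolding c_def by (intro borel_measurable_prod measurable_compose[OF comp \<psi>_meas] child_V)
  have T_P: "T \<in> measurable ?P ?P"
    unfolding T_def by (rule measurable_restrict) (use comp c_meas in simp)
  have T_Z: "T (\<lambda>v\<in>V. Z v \<omega>) = K \<omega>" if om: "\<omega> \<in> space M" for \<omega>
  proof
    fix v
    show "T (\<lambda>v\<in>V. Z v \<omega>) v = K \<omega> v"
    proof (cases "v \<in> V")
      case True
      have "\<psi> r (Y l u \<omega>) = phi \<epsilon> r (message (subtree l u) u (K \<omega>))" if "u \<in> V" for u r
        using message_range[OF K_dom[OF om] lV that] by (simp add: \<psi>_def Y_def)
      then have "c v (\<lambda>v\<in>V. Z v \<omega>) = (\<Prod>u\<in>children l v. phi \<epsilon> (q {v, u}) (message (subtree l u) u (K \<omega>)))"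
        unfolding c_def using child_V by (intro prod.cong refl) (auto simp: Z_def)
      then show ?thesis
        using coordinate_eq[OF K_dom[OF om] lV True] True by (simp add: T_def Z_def Y_def)
    next
      case False
      then show ?thesis using K_dom[OF om] by (auto simp: T_def signed_domain_def PiE_iff extensional_def)
    qed
  qed
  have inverse: "x v = message (subtree l v) v (T x)" if x: "T x \<in> ?D" and "v \<in> V" for x v
    using lV that(2)
  proof (induction v rule: tree_induct[consumes 2, case_names step])
    case (step v)
    let ?m = "\<lambda>u. message (subtree l u) u (T x)"
    have "\<psi> (q {v, u}) (x u) = phi \<epsilon> (q {v, u}) (?m u)" if "u \<in> children l v" for u
      unfolding step.IH[OF that] using message_range[OF x lV child_V[OF that]] by (simp add: \<psi>_def)
    then have cv: "c v x = (\<Prod>u\<in>children l v. phi \<epsilon> (q {v, u}) (?m u))" by (simp add: c_def)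
    have "T x v = ?m v * c v x" unfolding cv by (rule coordinate_eq[OF x lV step(1)])
    moreover have "T x v = x v * c v x" using step(1) by (simp add: T_def)
    ultimately show ?case using c_pos[of v x] by simp
  qed
  have density_eq: "(\<Prod>v\<in>V. d v (x v)) = C * law_density (T x) * (\<Prod>v\<in>V. c v x)" if x: "T x \<in> ?D" for x
  proof -
    have rng: "x v \<in> range_set \<epsilon>" if "v \<in> V" for v
      using message_range[OF x lV that] inverse[OF x that] by simp
    have c_phi: "c v x = (\<Prod>u\<in>children l v. phi \<epsilon> (q {v, u}) (x u))" for v
      unfolding c_def using rng[OF child_V] by (intro prod.cong) (auto simp: \<psi>_def)
    have phi_p: "0 < phi \<epsilon> (p u) (x u)" if "u \<in> V" for u
      using phi_pos[OF _ rng[OF that]] weight_0 weight[OF parent_edge'[OF lV that]] by (auto simp: p_def)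
    have delta: "graph_delta E q V (\<lambda>v. \<epsilon> * T x v) = (\<Prod>u\<in>V. 1 + \<epsilon> * x u)"
      unfolding delta_eq_prod[OF x lV] using inverse[OF x] by (intro prod.cong) auto
    \<comment> \<open>The Jacobian raises the exponent of each scaling factor from
      \<open>exponent v - 1\<close> to \<open>exponent v\<close>. Regrouped by child, this is the
      power of \<phi> that \<open>edge_density\<close> assigns to the receiving vertex.\<close>
    have "(\<Prod>v\<in>V. T x v powr (exponent v - 1)) * (\<Prod>v\<in>V. c v x) = (\<Prod>v\<in>V. x v powr (exponent v - 1) * c v x powr exponent v)"
      unfolding prod.distrib[symmetric]
    proof (rule prod.cong[OF refl])
      fix v assume "v \<in> V"
      have "0 < x v" using rng[OF \<open>v \<in> V\<close>] by (simp add: range_set_def)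
      have "c v x powr exponent v = c v x powr (exponent v - 1) * c v x"
        using c_pos[of v x] powr_add[of "c v x" "exponent v - 1" 1] by simp
      then show "T x v powr (exponent v - 1) * c v x = x v powr (exponent v - 1) * c v x powr exponent v"
        using \<open>0 < x v\<close> c_pos[of v x] \<open>v \<in> V\<close> by (simp add: T_def powr_mult)
    qed
    also have "\<dots> = (\<Prod>v\<in>V. x v powr (exponent v - 1)) * (\<Prod>v\<in>V. \<Prod>u\<in>children l v. phi \<epsilon> (q {v, u}) (x u) powr exponent v)"
    proof -
      have "c v x powr exponent v = (\<Prod>u\<in>children l v. phi \<epsilon> (q {v, u}) (x u) powr exponent v)" for v
        unfolding c_phi by (rule prod_powr_distrib)
      then show ?thesis by (simp add: prod.distrib)
    qed
    also have "(\<Prod>v\<in>V. \<Prod>u\<in>children l v. phi \<epsilon> (q {v, u}) (x u) powr exponent v)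
        = (\<Prod>u\<in>V - {l}. phi \<epsilon> (q {parent l u, u}) (x u) powr exponent (parent l u))"
      by (rule prod_children[OF lV])
    also have "\<dots> = (\<Prod>u\<in>V. phi \<epsilon> (p u) (x u) powr b u)"
    proof -
      have "phi \<epsilon> 0 (x l) \<noteq> 0" using phi_p[OF lV] by (simp add: p_def)
      then show ?thesis
        using finite_V lV by (intro prod.mono_neutral_cong_left) (auto simp: p_def b_def insert_commute)
    qed
    finally have prod_T: "(\<Prod>v\<in>V. T x v powr (exponent v - 1)) * (\<Prod>v\<in>V. c v x)
        = (\<Prod>v\<in>V. x v powr (exponent v - 1)) * (\<Prod>u\<in>V. phi \<epsilon> (p u) (x u) powr b u)" .
    have "(\<Prod>u\<in>V. 1 + \<epsilon> * x u) powr (- shift - 1) = (\<Prod>u\<in>V. (1 + \<epsilon> * x u) powr (- shift - 1))"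
      by (rule prod_powr_distrib)
    moreover have "(\<Prod>v\<in>V. d v (x v)) = C * ((\<Prod>v\<in>V. x v powr (exponent v - 1))
        * (\<Prod>u\<in>V. (1 + \<epsilon> * x u) powr (- shift - 1)) * (\<Prod>u\<in>V. phi \<epsilon> (p u) (x u) powr b u))"
      unfolding C_def prod.distrib[symmetric] using rng by (intro prod.cong refl) (simp add: d_def edge_density_def)
    ultimately show ?thesis
      using x prod_T by (simp add: law_density_def delta mult_ac)
  qed
  have C_pos: "0 < C" unfolding C_def using \<kappa>(1) by (rule prod_pos)
  have d_nonneg: "0 \<le> d v x" if "v \<in> V" for v x
    using \<kappa>(1)[OF that] edge_density_nonneg by (simp add: d_def less_imp_le)
  have dens_meas: "(\<lambda>k. ennreal (C * law_density k)) \<in> borel_measurable ?P"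
    using law_density_meas by simp
  have "distr M ?P K = density ?P (\<lambda>k. ennreal (C * law_density k))"
  proof (rule measure_eqI)
    fix A assume "A \<in> sets (distr M ?P K)"
    then have A: "A \<in> sets ?P" by simp
    define h where "h k = (indicator (A \<inter> ?D) k :: ennreal)" for k
    have h: "h \<in> borel_measurable ?P" unfolding h_def using A signed_domain_meas by simp
    have "emeasure (distr M ?P K) A = (\<integral>\<^sup>+\<omega>. indicator (K -` A \<inter> space M) \<omega> \<partial>M)"
      using A K_P by (simp add: emeasure_distr measurable_sets)
    also have "\<dots> = (\<integral>\<^sup>+\<omega>. h (T (\<lambda>v\<in>V. Z v \<omega>)) \<partial>M)"
      by (rule nn_integral_cong) (use T_Z K_dom in \<open>auto simp: h_def indicator_def\<close>)
    also have "\<dots> = (\<integral>\<^sup>+x. h (T x) \<partial>distr M ?P (\<lambda>\<omega>. \<lambda>v\<in>V. Z v \<omega>))"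
      using measurable_compose[OF T_P h] by (intro nn_integral_distr[symmetric] Z_P) simp
    also have "\<dots> = (\<integral>\<^sup>+x. (\<Prod>v\<in>V. ennreal (d v (x v))) * h (T x) \<partial>?P)"
      unfolding law_Z
    proof (rule nn_integral_density)
      have "(\<lambda>x. ennreal (d v x)) \<in> borel_measurable borel" for v unfolding d_def by measurable
      then show "(\<lambda>x. \<Prod>v\<in>V. ennreal (d v (x v))) \<in> borel_measurable ?P"
        by (intro borel_measurable_prod_ennreal measurable_compose[OF comp])
      show "(\<lambda>x. h (T x)) \<in> borel_measurable ?P" by (rule measurable_compose[OF T_P h])
    qed
    also have "\<dots> = (\<integral>\<^sup>+x. (ennreal (C * law_density (\<lambda>v\<in>V. x v * c v x)) * h (\<lambda>v\<in>V. x v * c v x))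
        * (\<Prod>v\<in>V. ennreal (c v x)) \<partial>?P)"
    proof (rule nn_integral_cong)
      fix x
      show "(\<Prod>v\<in>V. ennreal (d v (x v))) * h (T x)
        = (ennreal (C * law_density (\<lambda>v\<in>V. x v * c v x)) * h (\<lambda>v\<in>V. x v * c v x)) * (\<Prod>v\<in>V. ennreal (c v x))"
      proof (cases "T x \<in> ?D")
        case True
        have "(\<Prod>v\<in>V. ennreal (d v (x v))) = ennreal (C * law_density (T x) * (\<Prod>v\<in>V. c v x))"
          using density_eq[OF True] d_nonneg by (simp add: prod_ennreal)
        also have "\<dots> = ennreal (C * law_density (T x)) * (\<Prod>v\<in>V. ennreal (c v x))"
          using C_pos law_density_nonneg c_pos by (simp add: prod_ennreal less_imp_le ennreal_mult prod_nonneg)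
        finally show ?thesis by (simp add: T_def mult_ac)
      next
        case False
        then show ?thesis by (simp add: h_def T_def)
      qed
    qed
    also have "\<dots> = (\<integral>\<^sup>+x. ennreal (C * law_density x) * h x \<partial>?P)"
    \<comment> \<open>The factor of \<open>v\<close> involves its children only, and their subtrees
      are strictly smaller.\<close>
    proof (rule triangular_scaling[where rank = "\<lambda>v. card (subtree l v)", OF finite_V c_meas c_pos])
      fix v u x y assume v: "v \<in> V" and le: "card (subtree l v) \<le> card (subtree l u)"
      have "u \<notin> children l v" using card_subtree_less[OF lV v, of u] le by auto
      then show "c v (x(u := y)) = c v x" unfolding c_def by (intro prod.cong) auto
    qed (use dens_meas h in \<open>intro borel_measurable_times_ennreal\<close>)
    also have "\<dots> = (\<integral>\<^sup>+x. ennreal (C * law_density x) * indicator A x \<partial>?P)"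
      by (rule nn_integral_cong) (auto simp: h_def law_density_def indicator_def)
    also have "\<dots> = emeasure (density ?P (\<lambda>k. ennreal (C * law_density k))) A"
      by (rule emeasure_density[OF dens_meas A, symmetric])
    finally show "emeasure (distr M ?P K) A = emeasure (density ?P (\<lambda>k. ennreal (C * law_density k))) A" .
  qed simp
  then show ?thesis using C_pos by blast
qed

end

section \<open>Parameter bounds from integrability at infinity\<close>

lemma heavy_tail_not_density:
  fixes d :: "real \<Rightarrow> real"
  assumes "prob_space (density lborel (\<lambda>x. ennreal (d x)))" and [measurable]: "d \<in> borel_measurable borel"
    and "0 < m" "\<And>x. 1 \<le> x \<Longrightarrow> m / x \<le> d x"
  shows False
proof -
  interpret prob_space "density lborel (\<lambda>x. ennreal (d x))" by fact
  have one: "1 \<le> exp (2 / m)" using assms(3) by simp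
  \<comment> \<open>The end point is chosen so that m / x has integral 2, more than a probability
    density can carry.\<close>
  have "(\<integral>\<^sup>+x. ennreal (m / x) * indicator {1..exp (2 / m)} x \<partial>lborel)
      = ennreal (m * ln (exp (2 / m)) - m * ln 1)"
  proof (rule nn_integral_FTC_Icc)
    show "((\<lambda>x. m * ln x) has_real_derivative m / x) (at x)" if "x \<in> {1..exp (2 / m)}" for x
      using that by (auto intro!: derivative_eq_intros)
  qed (use one assms(3) in auto)
  then have "ennreal 2 = (\<integral>\<^sup>+x. ennreal (m / x) * indicator {1..exp (2 / m)} x \<partial>lborel)"
    using assms(3) by simp
  also have "\<dots> \<le> (\<integral>\<^sup>+x. ennreal (d x) \<partial>lborel)"
    using assms(4) by (intro nn_integral_mono) (auto simp: indicator_def intro!: ennreal_leI)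
  also have "\<dots> = 1" using emeasure_space_1 by (simp add: emeasure_density)
  finally show False by (simp add: ennreal_le_1)
qed

text \<open>At infinity \<phi> grows like x if q = 0 and stays bounded away from 0 and infinity if q
  > 0. The density thus decays like the power a + b - \<beta> - 2 or a - \<beta> - 2 of x, and
  integrability needs an exponent below -1.\<close>

lemma edge_density_tail:
  assumes prob: "prob_space (density lborel (\<lambda>x. ennreal (\<kappa> * edge_density 1 q a b \<beta> x)))"
    and \<kappa>: "0 < \<kappa>" and q: "0 \<le> q" and b: "0 < b"
  shows "if q = 0 then a + b < \<beta> + 1 else a < \<beta> + 1"
proof (rule ccontr)
  assume neg: "\<not> ?thesis"
  \<comment> \<open>\<open>e\<close> is the power of 1 + x left over after the contribution of
    \<phi>, and \<open>c\<close> a lower bound for the rest, from \<phi> \<ge> min 1 (1 / q) when q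
    > 0.\<close>
  define e where "e = (if q = 0 then b - \<beta> - 1 else - \<beta> - 1)"
  define c where "c = (if q = 0 then 1 else min 1 (1 / q) powr b)"
  have c: "0 < c"
  proof (cases "q = 0")
    case False
    then have "0 < min 1 (1 / q)" using q by simp
    then have "0 < min 1 (1 / q) powr b" by (metis powr_gt_zero less_irrefl)
    then show ?thesis using False by (simp add: c_def)
  qed (simp add: c_def)
  have ae: "0 \<le> a + e" using neg by (auto simp: e_def split: if_splits)
  \<comment> \<open>For x \<ge> 1 the constant \<open>min 1 (2 powr e)\<close> compares (1 + x)^e
    with x^e, whatever the sign of \<open>e\<close>.\<close>
  define m where "m = \<kappa> * (c * min 1 (2 powr e))"
  have "m / x \<le> \<kappa> * edge_density 1 q a b \<beta> x" if x: "1 \<le> x" for x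
  proof -
    have "min 1 (2 powr e) * x powr e \<le> (1 + x) powr e"
    proof (cases "0 \<le> e")
      case True
      have "min 1 (2 powr e) * x powr e \<le> 1 * x powr e" by (intro mult_right_mono) auto
      also have "\<dots> \<le> (1 + x) powr e" using True x by (simp add: powr_mono2)
      finally show ?thesis .
    next
      case False
      have "min 1 (2 powr e) * x powr e \<le> 2 powr e * x powr e" by (intro mult_right_mono) auto
      also have "\<dots> = (2 * x) powr e" using x by (simp add: powr_mult)
      also have "\<dots> \<le> (1 + x) powr e" using False x by (intro powr_mono2') auto
      finally show ?thesis .
    qed
    moreover have "c * (1 + x) powr e \<le> (1 + x) powr (- \<beta> - 1) * phi 1 q x powr b"
    proof (cases "q = 0")
      case True
      then show ?thesis using x by (simp add: c_def e_def phi_def powr_add[symmetric])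
    next
      case False
      then have "0 < q" using q by simp
      have p: "0 < 1 + q * x" using \<open>0 < q\<close> x by (simp add: add_pos_pos)
      have "min 1 (1 / q) \<le> phi 1 q x"
      proof (cases "q \<le> 1")
        case True
        then have "q * x \<le> 1 * x" using x by (intro mult_right_mono) auto
        then have "1 \<le> phi 1 q x" using pos_le_divide_eq[OF p] by (simp add: phi_def)
        then show ?thesis by simp
      next
        case False
        have "1 / q * (1 + q * x) = 1 / q + x" using \<open>0 < q\<close> by (simp add: field_simps)
        also have "\<dots> \<le> 1 + x" using False by simp
        finally have "1 / q \<le> phi 1 q x" using pos_le_divide_eq[OF p] by (simp add: phi_def)
        then show ?thesis by simp
      qed
      then have "min 1 (1 / q) powr b \<le> phi 1 q x powr b" using b \<open>0 < q\<close> by (intro powr_mono2) auto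
      then have "c \<le> phi 1 q x powr b" using False by (simp add: c_def)
      then have "(1 + x) powr (- \<beta> - 1) * c \<le> (1 + x) powr (- \<beta> - 1) * phi 1 q x powr b"
        by (intro mult_left_mono) auto
      then show ?thesis using False by (simp add: e_def mult.commute)
    qed
    ultimately have "c * (min 1 (2 powr e) * x powr e) \<le> (1 + x) powr (- \<beta> - 1) * phi 1 q x powr b"
      using c by (meson mult_left_mono less_imp_le order_trans)
    then have "x powr (a - 1) * (c * (min 1 (2 powr e) * x powr e))
        \<le> x powr (a - 1) * ((1 + x) powr (- \<beta> - 1) * phi 1 q x powr b)"
      by (intro mult_left_mono) auto
    moreover have "edge_density 1 q a b \<beta> x = x powr (a - 1) * ((1 + x) powr (- \<beta> - 1) * phi 1 q x powr b)"
      using x by (simp add: edge_density_def range_set_eq)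
    moreover have "x powr (- 1) \<le> x powr (a - 1 + e)" using ae x by (intro powr_mono) auto
    then have "c * min 1 (2 powr e) * x powr (- 1) \<le> c * min 1 (2 powr e) * x powr (a - 1 + e)"
      using c by (intro mult_left_mono) auto
    then have "c * min 1 (2 powr e) / x \<le> x powr (a - 1) * (c * (min 1 (2 powr e) * x powr e))"
      using x by (simp add: powr_add powr_minus_divide mult_ac)
    ultimately have "c * min 1 (2 powr e) / x \<le> edge_density 1 q a b \<beta> x" by linarith
    then have "\<kappa> * (c * min 1 (2 powr e) / x) \<le> \<kappa> * edge_density 1 q a b \<beta> x"
      using \<kappa> by (intro mult_left_mono) auto
    then show ?thesis by (simp add: m_def)
  qed
  moreover have "0 < m" using \<kappa> c by (simp add: m_def)
  ultimately show False using heavy_tail_not_density[OF prob] by auto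
qed

lemma normalized_densityI:
  assumes "prob_space (density N (\<lambda>x. ennreal (C * f x)))" and f: "f \<in> borel_measurable N" "\<And>x. 0 \<le> f x" and C: "0 < C"
  shows "density N (\<lambda>x. ennreal (C * f x)) = normalized_density N f"
proof -
  interpret prob_space "density N (\<lambda>x. ennreal (C * f x))" by fact
  define I where "I = (\<integral>\<^sup>+x. ennreal (f x) \<partial>N)"
  have "1 = (\<integral>\<^sup>+x. ennreal (C * f x) \<partial>N)"
    using emeasure_space_1 f by (simp add: emeasure_density cong: nn_integral_cong)
  also have "\<dots> = ennreal C * I"
    unfolding I_def using C f by (simp add: ennreal_mult nn_integral_cmult)
  finally have "ennreal (1 / C) = ennreal (1 / C) * (ennreal C * I)" by simp
  also have "\<dots> = I" using C by (simp add: mult.assoc[symmetric] ennreal_mult[symmetric])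
  finally have I: "I = ennreal (1 / C)" by simp
  have "ennreal (C * f x) = ennreal (f x) / I" for x
    unfolding I using C f(2)[of x] by (simp add: divide_ennreal mult.commute)
  then show ?thesis by (simp add: normalized_density_def I_def)
qed


lemma (in tree_law) law_of_K_normalized:
  "distr M (\<Pi>\<^sub>M v\<in>V. lborel) K = normalized_density (\<Pi>\<^sub>M v\<in>V. lborel) law_density"
proof -
  let ?P = "\<Pi>\<^sub>M v\<in>V. (lborel :: real measure)"
  obtain C where C: "0 < C" "distr M ?P K = density ?P (\<lambda>k. ennreal (C * law_density k))"
    using law_of_K by blast
  have "sets ?P = sets (\<Pi>\<^sub>M v\<in>V. (borel :: real measure))" by (rule sets_PiM_cong) auto
  then have "K \<in> measurable M ?P" using K_meas measurable_cong_sets by blast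
  then have "prob_space (density ?P (\<lambda>k. ennreal (C * law_density k)))"
    unfolding C(2)[symmetric] by (rule prob_space_distr)
  from normalized_densityI[OF this law_density_meas law_density_nonneg C(1)] C(2) show ?thesis by simp
qed

lemma (in tree_law) exponent_bounds:
  assumes "\<epsilon> = 1" and e: "{v, w} \<in> E"
  shows "exponent v < shift + 1" "q {v, w} = 0 \<Longrightarrow> exponent v + exponent w < shift + 1"
proof -
  have "w \<in> V" using edgeD[OF e] by simp
  then have w: "0 < exponent w" by (rule param_signs)
  obtain \<kappa> where \<kappa>: "0 < \<kappa>" "distr M borel (X v w)
      = density lborel (\<lambda>x. ennreal (\<kappa> * edge_density \<epsilon> (q {v, w}) (exponent v) (exponent w) shift x))"
    using edge_law[OF e] by blast
  have "prob_space (distr M borel (X v w))"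
    by (rule prob_space_distr[OF range_rv.X_meas[OF X_rv[OF e]]])
  then have prob: "prob_space (density lborel (\<lambda>x. ennreal (\<kappa> * edge_density 1 (q {v, w}) (exponent v) (exponent w) shift x)))"
    using \<kappa>(2) assms(1) by simp
  have "0 \<le> q {v, w}" using weight[OF e] assms(1) by (auto simp: admissible_weight_def)
  from edge_density_tail[OF prob \<kappa>(1) this w]
  show "exponent v < shift + 1" "q {v, w} = 0 \<Longrightarrow> exponent v + exponent w < shift + 1"
    using w by (auto split: if_splits)
qed

section \<open>Both parts as instances of the signed setting\<close>

context finite_tree
begin

lemma graph_delta_singleton: "graph_delta E q {v} k = 1 + k v"
proof -
  have "Pow {v} = {{}, {v}}" by auto
  then show ?thesis by (simp add: graph_delta_def no_induced_edges_small)
qed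

lemma Delta_eq: "U \<subseteq> V \<Longrightarrow> graph_Delta E q U k = graph_delta E q U (\<lambda>v. -1 * k v)"
  using graph_Delta_eq_delta[OF finite_subset[OF _ finite_V]] by simp

lemma Delta_domain_eq: "Delta_domain V E q = signed_domain V E q (-1)"
proof (rule set_eqI)
  fix k
  have "k v < 1" if "\<forall>U\<subseteq>V. 0 < graph_delta E q U (\<lambda>v. -1 * k v)" "v \<in> V" for v
  proof -
    have "0 < graph_delta E q {v} (\<lambda>v. -1 * k v)" using that by blast
    then show ?thesis by (simp add: graph_delta_singleton)
  qed
  then have "(\<forall>v\<in>V. 0 < k v \<and> k v < 1) \<and> (\<forall>U\<subseteq>V. 0 < graph_delta E q U (\<lambda>v. -1 * k v))
    \<longleftrightarrow> (\<forall>v\<in>V. 0 < k v) \<and> (\<forall>U\<subseteq>V. 0 < graph_delta E q U (\<lambda>v. -1 * k v))" by blast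
  then show "k \<in> Delta_domain V E q \<longleftrightarrow> k \<in> signed_domain V E q (-1)"
    using Delta_eq[of _ q k] by (auto simp: Delta_domain_def signed_domain_def PiE_iff)
qed

text \<open>All terms of the polynomial are nonnegative, and the empty set contributes 1.\<close>

lemma positive_orthant_eq:
  assumes "\<forall>e\<in>E. 0 \<le> q e"
  shows "(\<Pi>\<^sub>E v\<in>V. {0<..}) = signed_domain V E q 1"
proof -
  have "0 < graph_delta E q U (\<lambda>v. 1 * k v)" if "k \<in> (\<Pi>\<^sub>E v\<in>V. {0<..})" "U \<subseteq> V" for k U
  proof -
    have fin: "finite (Pow U)" using finite_subset[OF that(2) finite_V] by simp
    have "0 \<le> (\<Prod>e\<in>induced_edges E W. q e) * (\<Prod>v\<in>W. 1 * k v)" if "W \<in> Pow U" for W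
    proof -
      have "0 \<le> q e" if "e \<in> induced_edges E W" for e
        using that assms by (simp add: induced_edges_def)
      moreover have "0 \<le> 1 * k v" if "v \<in> W" for v
      proof -
        have "v \<in> V" using \<open>v \<in> W\<close> \<open>W \<in> Pow U\<close> \<open>U \<subseteq> V\<close> by blast
        then show ?thesis using \<open>k \<in> _\<close> by (auto simp: PiE_iff less_imp_le)
      qed
      ultimately show ?thesis by (simp add: prod_nonneg)
    qed
    moreover have "(0::real) < (\<Prod>e\<in>induced_edges E {}. q e) * (\<Prod>v\<in>{}. 1 * k v)"
      by (simp add: no_induced_edges_small)
    ultimately show ?thesis
      unfolding graph_delta_def using fin by (intro sum_pos2[of _ "{}"]) auto
  qed
  then show ?thesis unfolding signed_domain_def by blast
qed

lemma graph_Psi_eq: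
  assumes "l \<in> V" "v \<in> V"
  shows "graph_Psi V E q l k v = -1 * branch_ratio q (\<lambda>u. -1 * k u) (subtree l v) v"
proof -
  have "subtree l v \<subseteq> V" "subtree l v - {v} \<subseteq> V" using subtree_subset[OF assms] by auto
  then show ?thesis
    unfolding graph_Psi_def branch_ratio_def closed_descendants_eq[OF assms] descendants_eq[OF assms]
    by (simp only: Delta_eq) simp
qed

lemma graph_psi_eq:
  assumes "l \<in> V" "v \<in> V"
  shows "graph_psi V E q l k v = 1 * branch_ratio q (\<lambda>u. 1 * k u) (subtree l v) v"
  by (simp add: graph_psi_def branch_ratio_def closed_descendants_eq[OF assms] descendants_eq[OF assms])

end

theorem theorem1p7:
  fixes V :: "'v set" and E :: "'v set set" and q :: "'v set \<Rightarrow> real"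
    and M :: "'a measure" and K :: "'a \<Rightarrow> 'v \<Rightarrow> real"
  assumes "graph_tree V E" and "finite V" and "1 < card V"
    and "prob_space M"
    and "K \<in> measurable M (\<Pi>\<^sub>M v\<in>V. borel)"
  shows
    "((\<forall>e\<in>E. q e < 1) \<and>
      (\<forall>\<omega>\<in>space M. K \<omega> \<in> Delta_domain V E q) \<and>
      (\<forall>l\<in>graph_leaves V E.
         prob_space.indep_vars M (\<lambda>_. borel) (\<lambda>v \<omega>. graph_Psi V E q l (K \<omega>) v) V \<and>
         (\<forall>v\<in>V. non_Dirac M (\<lambda>\<omega>. graph_Psi V E q l (K \<omega>) v)))
      \<longrightarrow> (\<exists>\<beta> a. 0 < \<beta> \<and> (\<forall>v\<in>V. 0 < a v) \<and>
             distr M (\<Pi>\<^sub>M v\<in>V. lborel) K = TB_I V E a \<beta> q))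
     \<and>
     ((\<forall>e\<in>E. 0 \<le> q e) \<and> (\<forall>e\<in>E. q e \<noteq> 1) \<and>
      (\<forall>\<omega>\<in>space M. K \<omega> \<in> (\<Pi>\<^sub>E v\<in>V. {0<..})) \<and>
      (\<forall>l\<in>graph_leaves V E.
         prob_space.indep_vars M (\<lambda>_. borel) (\<lambda>v \<omega>. graph_psi V E q l (K \<omega>) v) V \<and>
         (\<forall>v\<in>V. non_Dirac M (\<lambda>\<omega>. graph_psi V E q l (K \<omega>) v)))
      \<longrightarrow> (\<exists>\<beta> a. 0 < \<beta> \<and> (\<forall>v\<in>V. 0 < a v \<and> a v < \<beta>) \<and>
             (\<forall>v\<in>V. \<forall>w\<in>V. {v, w} \<in> E \<and> q {v, w} = 0 \<longrightarrow> a v + a w < \<beta>) \<and>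
             distr M (\<Pi>\<^sub>M v\<in>V. lborel) K = TB_II V E a \<beta> q))"
proof -
  interpret prob_space M by fact
  interpret G: finite_tree V E using assms(1-3) by unfold_locales
  have leaf: "l \<in> V" if "l \<in> graph_leaves V E" for l using that by (simp add: graph_leaves_def)
  show ?thesis
  proof (intro conjI impI)
    assume h: "(\<forall>e\<in>E. q e < 1) \<and>
      (\<forall>\<omega>\<in>space M. K \<omega> \<in> Delta_domain V E q) \<and>
      (\<forall>l\<in>graph_leaves V E. indep_vars (\<lambda>_. borel) (\<lambda>v \<omega>. graph_Psi V E q l (K \<omega>) v) V \<and>
         (\<forall>v\<in>V. non_Dirac M (\<lambda>\<omega>. graph_Psi V E q l (K \<omega>) v)))"
    interpret T: tree_law V E M "-1" q K
    proof
      show "admissible_weight (-1) (q e)" if "e \<in> E" for e using h that by (simp add: admissible_weight_def)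
      show "K \<in> measurable M (\<Pi>\<^sub>M v\<in>V. borel)" by fact
      show "K \<omega> \<in> signed_domain V E q (-1)" if "\<omega> \<in> space M" for \<omega>
        using h that unfolding G.Delta_domain_eq by blast
      fix l assume l: "l \<in> graph_leaves V E"
      have "indep_vars (\<lambda>_. borel) (\<lambda>v \<omega>. graph_Psi V E q l (K \<omega>) v) V" using h l by blast
      then show "indep_vars (\<lambda>_. borel) (\<lambda>v \<omega>. -1 * G.branch_ratio q (\<lambda>u. -1 * K \<omega> u) (G.subtree l v) v) V"
        by (rule indep_vars_cong[THEN iffD1, rotated -1]) (simp_all only: G.graph_Psi_eq[OF leaf[OF l]])
      fix v assume v: "v \<in> V"
      show "\<not> (\<exists>c. AE \<omega> in M. -1 * G.branch_ratio q (\<lambda>u. -1 * K \<omega> u) (G.subtree l v) v = c)"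
        using h l v unfolding non_Dirac_def G.graph_Psi_eq[OF leaf[OF l] v, symmetric] by blast
    qed
    have density: "T.law_density k = graph_Delta E q V k powr (- T.shift - 1) * (\<Prod>v\<in>V. k v powr (T.exponent v - 1))
        * indicator (Delta_domain V E q) k" for k
      unfolding T.law_density_def G.Delta_domain_eq G.Delta_eq[OF order_refl] ..
    have "distr M (\<Pi>\<^sub>M v\<in>V. lborel) K = TB_I V E T.exponent (- T.shift) q"
      unfolding TB_I_def T.law_of_K_normalized density[abs_def] ..
    moreover obtain v where "v \<in> V" using G.card_V by fastforce
    then have "0 < - T.shift" using T.param_signs(2)[OF _ refl] by simp
    moreover have "\<forall>v\<in>V. 0 < T.exponent v" using T.param_signs(1) by blast
    ultimately show "\<exists>\<beta> a. 0 < \<beta> \<and> (\<forall>v\<in>V. 0 < a v) \<and> distr M (\<Pi>\<^sub>M v\<in>V. lborel) K = TB_I V E a \<beta> q"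
      by blast
  next
    assume h: "(\<forall>e\<in>E. 0 \<le> q e) \<and> (\<forall>e\<in>E. q e \<noteq> 1) \<and>
      (\<forall>\<omega>\<in>space M. K \<omega> \<in> (\<Pi>\<^sub>E v\<in>V. {0<..})) \<and>
      (\<forall>l\<in>graph_leaves V E. indep_vars (\<lambda>_. borel) (\<lambda>v \<omega>. graph_psi V E q l (K \<omega>) v) V \<and>
         (\<forall>v\<in>V. non_Dirac M (\<lambda>\<omega>. graph_psi V E q l (K \<omega>) v)))"
    then have orthant: "(\<Pi>\<^sub>E v\<in>V. {0<..}) = signed_domain V E q 1" by (intro G.positive_orthant_eq) blast
    interpret T: tree_law V E M 1 q K
    proof
      show "admissible_weight 1 (q e)" if "e \<in> E" for e using h that by (simp add: admissible_weight_def)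
      show "K \<in> measurable M (\<Pi>\<^sub>M v\<in>V. borel)" by fact
      show "K \<omega> \<in> signed_domain V E q 1" if "\<omega> \<in> space M" for \<omega>
        using h that unfolding orthant by blast
      fix l assume l: "l \<in> graph_leaves V E"
      have "indep_vars (\<lambda>_. borel) (\<lambda>v \<omega>. graph_psi V E q l (K \<omega>) v) V" using h l by blast
      then show "indep_vars (\<lambda>_. borel) (\<lambda>v \<omega>. 1 * G.branch_ratio q (\<lambda>u. 1 * K \<omega> u) (G.subtree l v) v) V"
        by (rule indep_vars_cong[THEN iffD1, rotated -1]) (simp_all only: G.graph_psi_eq[OF leaf[OF l]])
      fix v assume v: "v \<in> V"
      show "\<not> (\<exists>c. AE \<omega> in M. 1 * G.branch_ratio q (\<lambda>u. 1 * K \<omega> u) (G.subtree l v) v = c)"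
        using h l v unfolding non_Dirac_def G.graph_psi_eq[OF leaf[OF l] v, symmetric] by blast
    qed
    have density: "T.law_density k = graph_delta E q V k powr - (T.shift + 1) * (\<Prod>v\<in>V. k v powr (T.exponent v - 1))
        * indicator (\<Pi>\<^sub>E v\<in>V. {0<..}) k" for k
      unfolding T.law_density_def orthant by simp
    have law: "distr M (\<Pi>\<^sub>M v\<in>V. lborel) K = TB_II V E T.exponent (T.shift + 1) q"
      unfolding TB_II_def T.law_of_K_normalized density[abs_def] ..
    have bounds: "0 < T.exponent v \<and> T.exponent v < T.shift + 1" if "v \<in> V" for v
      using T.param_signs(1)[OF that] T.exists_incident[OF that] T.exponent_bounds(1)[OF refl] by blast
    obtain v where "v \<in> V" using G.card_V by fastforce
    then have "0 < T.shift + 1" using bounds by force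
    then show "\<exists>\<beta> a. 0 < \<beta> \<and> (\<forall>v\<in>V. 0 < a v \<and> a v < \<beta>) \<and>
             (\<forall>v\<in>V. \<forall>w\<in>V. {v, w} \<in> E \<and> q {v, w} = 0 \<longrightarrow> a v + a w < \<beta>) \<and>
             distr M (\<Pi>\<^sub>M v\<in>V. lborel) K = TB_II V E a \<beta> q"
      using law bounds T.exponent_bounds(2)[OF refl] by blast
  qed
qed

end
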